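(* Let $M$ be a metrizable topological manifold of dimension $n\ge 1$, with boundary $\partial_M$ and interior $M^o$, and assume that $\partial_M$ is compact. If the group $\mathcal{H}_c(M)$ is bounded, then the group $\mathcal{H}(\partial_M)$ is bounded. Moreover, if the group $\mathcal{H}_c(M^o)$ is bounded, then so is the group $\mathcal{H}_c^{\partial}(M)$.
   Context: An isotopy of a manifold $N$ is a family of homeomorphisms $h_t:N\to N$, $t\in[0,1]$, such that $(x,t)\mapsto h_t(x)$ is continuous; it is compactly supported if there is a compact set $K\subset N$ with $\mathrm{supp}(h_t)\subset K$ for all $t$. $\mathcal{H}_c(N)$ is the group of all homeomorphisms $h$ of $N$ for which there is a compactly supported isotopy with $h_0=\mathrm{id}$, $h_1=h$. $\mathcal{H}(N)$ is the path connected identity component of the group of all homeomorphisms of $N$ with the compact-open topology. $\mathcal{H}_c^{\partial}(M)$ is the group of all homeomorphisms $h$ of $M$ for which there is a compactly supported isotopy $h_t$ with $h_0=\mathrm{id}$, $h_1=h$ and $h_t=\mathrm{id}$ on $\partial_M$ for all $t$. A conjugation-invariant norm on a group $G$ is a function $\nu:G\to[0,\infty)$ such that for all $g,h\in G$: $\nu(g)>0$ iff $g\ne e$; $\nu(g^{-1})=\nu(g)$; $\nu(gh)\le\nu(g)+\nu(h)$; $\nu(hgh^{-1})=\nu(g)$. A group is bounded if every conjugation-invariant norm on it is bounded. *)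

theory Defs
  imports "HOL-Analysis.Analysis" "HOL-Algebra.Bij"
begin

section \<open>Topological manifolds with boundary\<close>

definition half_space :: "nat \<Rightarrow> (nat \<Rightarrow> real) topology" where
  "half_space n = subtopology (Euclidean_space n) {x. 0 \<le> x 0}"

text \<open>
  Second countability and connectedness are not part of the definition, and the boundary may be
  empty. The boundary consists of the points without a Euclidean neighbourhood; for \<open>n \<ge> 1\<close>,
  invariance of domain identifies them with the points sent to \<open>x 0 = 0\<close> by a chart.
\<close>

definition topological_manifold :: "nat \<Rightarrow> 'a topology \<Rightarrow> bool" where
  "topological_manifold n M \<longleftrightarrow>
     Hausdorff_space M \<and>
     (\<forall>x \<in> topspace M. \<exists>U V. openin M U \<and> x \<in> U \<and> openin (half_space n) V \<and>
        subtopology M U homeomorphic_space subtopology (half_space n) V)"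

definition manifold_interior :: "nat \<Rightarrow> 'a topology \<Rightarrow> 'a set" where
  "manifold_interior n M =
     {x \<in> topspace M. \<exists>U V. openin M U \<and> x \<in> U \<and> openin (Euclidean_space n) V \<and>
        subtopology M U homeomorphic_space subtopology (Euclidean_space n) V}"

definition manifold_boundary :: "nat \<Rightarrow> 'a topology \<Rightarrow> 'a set" where
  "manifold_boundary n M = topspace M - manifold_interior n M"

section \<open>Groups of homeomorphisms\<close>

text \<open>
  As in \<^const>\<open>BijGroup\<close>, homeomorphisms are represented by extensional functions, so that two
  of them are equal as soon as they agree on the space.
\<close>

definition homeos :: "'a topology \<Rightarrow> ('a \<Rightarrow> 'a) set" where
  "homeos N = {h \<in> extensional (topspace N). homeomorphic_map N N h}"

definition supp :: "'a topology \<Rightarrow> ('a \<Rightarrow> 'a) \<Rightarrow> 'a set" where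
  "supp N h = N closure_of {x \<in> topspace N. h x \<noteq> x}"

definition isotopy :: "'a topology \<Rightarrow> (real \<Rightarrow> 'a \<Rightarrow> 'a) \<Rightarrow> bool" where
  "isotopy N h \<longleftrightarrow>
     (\<forall>t \<in> {0..1}. h t \<in> homeos N) \<and>
     continuous_map (prod_topology N (top_of_set {0..1})) N (\<lambda>(x, t). h t x)"

definition compactly_supported_isotopy :: "'a topology \<Rightarrow> (real \<Rightarrow> 'a \<Rightarrow> 'a) \<Rightarrow> bool" where
  "compactly_supported_isotopy N h \<longleftrightarrow>
     isotopy N h \<and> (\<exists>K. compactin N K \<and> (\<forall>t \<in> {0..1}. supp N (h t) \<subseteq> K))"

definition Hc_group :: "'a topology \<Rightarrow> ('a \<Rightarrow> 'a) monoid" where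
  "Hc_group N = (BijGroup (topspace N))
     \<lparr>carrier := {g \<in> homeos N. \<exists>h. compactly_supported_isotopy N h \<and>
        h 0 = (\<lambda>x \<in> topspace N. x) \<and> h 1 = g}\<rparr>"

definition Hc_boundary_group :: "nat \<Rightarrow> 'a topology \<Rightarrow> ('a \<Rightarrow> 'a) monoid" where
  "Hc_boundary_group n M = (BijGroup (topspace M))
     \<lparr>carrier := {g \<in> homeos M. \<exists>h. compactly_supported_isotopy M h \<and>
        h 0 = (\<lambda>x \<in> topspace M. x) \<and> h 1 = g \<and>
        (\<forall>t \<in> {0..1}. \<forall>x \<in> manifold_boundary n M. h t x = x)}\<rparr>"

definition compact_open_topology :: "'a topology \<Rightarrow> ('a \<Rightarrow> 'a) topology" where
  "compact_open_topology N = topology_generated_by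
     {{h \<in> homeos N. h ` K \<subseteq> U} | K U. compactin N K \<and> openin N U}"

text \<open>
  The path component of the identity in the group of all homeomorphisms with the compact-open
  topology.
\<close>

definition H_group :: "'a topology \<Rightarrow> ('a \<Rightarrow> 'a) monoid" where
  "H_group N = (BijGroup (topspace N))
     \<lparr>carrier := path_component_of_set (compact_open_topology N) (\<lambda>x \<in> topspace N. x)\<rparr>"

section \<open>Bounded groups\<close>

definition conj_invariant_norm :: "('g, 'm) monoid_scheme \<Rightarrow> ('g \<Rightarrow> real) \<Rightarrow> bool" where
  "conj_invariant_norm G \<nu> \<longleftrightarrow>
     (\<forall>g \<in> carrier G. 0 \<le> \<nu> g) \<and>
     (\<forall>g \<in> carrier G. 0 < \<nu> g \<longleftrightarrow> g \<noteq> \<one>\<^bsub>G\<^esub>) \<and>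
     (\<forall>g \<in> carrier G. \<nu> (inv\<^bsub>G\<^esub> g) = \<nu> g) \<and>
     (\<forall>g \<in> carrier G. \<forall>h \<in> carrier G. \<nu> (g \<otimes>\<^bsub>G\<^esub> h) \<le> \<nu> g + \<nu> h) \<and>
     (\<forall>g \<in> carrier G. \<forall>h \<in> carrier G. \<nu> (h \<otimes>\<^bsub>G\<^esub> g \<otimes>\<^bsub>G\<^esub> inv\<^bsub>G\<^esub> h) = \<nu> g)"

definition bounded_group :: "('g, 'm) monoid_scheme \<Rightarrow> bool" where
  "bounded_group G \<longleftrightarrow>
     group G \<and> (\<forall>\<nu>. conj_invariant_norm G \<nu> \<longrightarrow> (\<exists>C. \<forall>g \<in> carrier G. \<nu> g \<le> C))"

section \<open>The groups of compactly supported homeomorphisms are groups\<close>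

lemma homeos_Bij: "h \<in> homeos N \<Longrightarrow> h \<in> Bij (topspace N)"
  by (auto simp: homeos_def Bij_def bij_betw_def homeomorphic_imp_injective_map
      homeomorphic_imp_surjective_map)

lemma homeos_id: "(\<lambda>x \<in> topspace N. x) \<in> homeos N"
  unfolding homeos_def
  by (auto intro: homeomorphic_map_eq[OF homeomorphic_map_id[THEN iffD2, OF refl]])

lemma homeos_compose:
  assumes "f \<in> homeos N" "g \<in> homeos N"
  shows "compose (topspace N) f g \<in> homeos N"
proof -
  have "homeomorphic_map N N (f \<circ> g)"
    using assms by (auto simp: homeos_def intro: homeomorphic_map_compose)
  then have "homeomorphic_map N N (compose (topspace N) f g)"
    by (rule homeomorphic_map_eq) (simp add: compose_eq)
  then show ?thesis by (simp add: homeos_def)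
qed

lemma homeos_inv:
  assumes "f \<in> homeos N"
  shows "(\<lambda>x \<in> topspace N. inv_into (topspace N) f x) \<in> homeos N"
proof -
  obtain g where g: "homeomorphic_maps N N f g"
    using assms by (auto simp: homeos_def homeomorphic_map_maps)
  have b: "inj_on f (topspace N)"
    using assms homeos_Bij[OF assms] by (simp add: Bij_def bij_betw_def)
  have "homeomorphic_map N N g"
    using g homeomorphic_maps_map by blast
  moreover have "g x = inv_into (topspace N) f x" if "x \<in> topspace N" for x
    using g that b unfolding homeomorphic_maps_def
    by (metis continuous_map_image_subset_topspace image_subset_iff inv_into_f_f)
  ultimately have "homeomorphic_map N N (\<lambda>x \<in> topspace N. inv_into (topspace N) f x)"
    by (auto intro: homeomorphic_map_eq)
  then show ?thesis by (simp add: homeos_def)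
qed

lemma supp_subset:
  assumes "x \<in> topspace N" "x \<notin> supp N h" shows "h x = x"
  using assms closure_of_subset[of "{x \<in> topspace N. h x \<noteq> x}" N] by (auto simp: supp_def)

lemma compactly_supported_isotopyI:
  assumes "\<And>t. t \<in> {0..1} \<Longrightarrow> h t \<in> homeos N"
    and "continuous_map (prod_topology N (top_of_set {0..1})) N (\<lambda>(x, t). h t x)"
    and "compactin N K"
    and "\<And>t. t \<in> {0..1} \<Longrightarrow> supp N (h t) \<subseteq> K"
  shows "compactly_supported_isotopy N h"
  unfolding compactly_supported_isotopy_def isotopy_def using assms by blast

lemma isotopy_inverse:
  assumes "Hausdorff_space N" "compactly_supported_isotopy N h"
  shows "compactly_supported_isotopy N (\<lambda>t. \<lambda>x \<in> topspace N. inv_into (topspace N) (h t) x)"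
proof -
  define I where "I = top_of_set {0..1::real}"
  define P where "P = prod_topology N I"
  define \<Phi> where "\<Phi> = (\<lambda>(x, t). (h t x, t))"
  obtain K where K: "compactin N K" and sK: "\<And>t. t \<in> {0..1} \<Longrightarrow> supp N (h t) \<subseteq> K"
    and hom: "\<And>t. t \<in> {0..1} \<Longrightarrow> h t \<in> homeos N" and cont: "continuous_map P N (\<lambda>(x, t). h t x)"
    using assms by (auto simp: compactly_supported_isotopy_def isotopy_def P_def I_def)
  have tI: "topspace I = {0..1}" by (simp add: I_def)
  have bij: "bij_betw (h t) (topspace N) (topspace N)" if "t \<in> {0..1}" for t
    using homeos_Bij[OF hom[OF that]] by (simp add: Bij_def)
  have outside: "h t x = x" if "t \<in> {0..1}" "x \<in> topspace N" "x \<notin> K" for t x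
    using that(3) sK[OF that(1)] supp_subset[OF that(2)] by auto
  have c\<Phi>: "continuous_map P P \<Phi>"
    using cont unfolding P_def \<Phi>_def
    by (simp add: continuous_map_pairwise o_def case_prod_unfold continuous_map_snd)
  have HP: "Hausdorff_space P"
    using assms(1) by (simp add: P_def I_def Hausdorff_space_prod_topology
        Hausdorff_space_subtopology)
  have KI: "compactin P (K \<times> {0..1})"
    using K by (simp add: P_def I_def compactin_Times compactin_subtopology)
  have inj: "inj_on \<Phi> (topspace P)"
    using bij by (auto simp: inj_on_def \<Phi>_def P_def tI bij_betw_def)
  have surj: "\<Phi> ` topspace P = topspace P"
  proof
    show "\<Phi> ` topspace P \<subseteq> topspace P" using c\<Phi> by (rule continuous_map_image_subset_topspace)
    show "topspace P \<subseteq> \<Phi> ` topspace P"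
    proof
      fix p assume "p \<in> topspace P"
      then obtain x t where p: "p = (x, t)" "x \<in> topspace N" "t \<in> {0..1}" by (auto simp: P_def tI)
      then obtain y where "y \<in> topspace N" "h t y = x"
        using bij[OF p(3)] by (metis bij_betw_imp_surj_on imageE)
      then show "p \<in> \<Phi> ` topspace P" using p by (force simp: P_def tI \<Phi>_def)
    qed
  qed
  have closed: "closed_map P P \<Phi>"
    unfolding closed_map_def
  proof (intro allI impI)
    fix C assume C: "closedin P C"
    define F where "F = {p \<in> topspace P. \<Phi> p = p}"
    have F: "closedin P F"
      using closedin_continuous_maps_eq[OF HP c\<Phi> continuous_map_id] by (simp add: F_def)
    have "C \<subseteq> topspace P" using C by (rule closedin_subset)
    have dich: "p \<in> K \<times> {0..1} \<or> p \<in> F" if "p \<in> C" for p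
      using that \<open>C \<subseteq> topspace P\<close> outside by (auto simp: F_def P_def tI \<Phi>_def)
    have eq: "\<Phi> ` C = \<Phi> ` (K \<times> {0..1} \<inter> C) \<union> (C \<inter> F)"
    proof
      show "\<Phi> ` C \<subseteq> \<Phi> ` (K \<times> {0..1} \<inter> C) \<union> (C \<inter> F)"
      proof
        fix q assume "q \<in> \<Phi> ` C"
        then obtain p where p: "p \<in> C" "q = \<Phi> p" by blast
        have "\<Phi> p = p" if "p \<in> F" using that unfolding F_def by simp
        then show "q \<in> \<Phi> ` (K \<times> {0..1} \<inter> C) \<union> (C \<inter> F)" using dich[OF p(1)] p by auto
      qed
      have "p \<in> \<Phi> ` C" if "p \<in> C" "p \<in> F" for p
        using that unfolding F_def by (metis (mono_tags, lifting) imageI mem_Collect_eq)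
      then show "\<Phi> ` (K \<times> {0..1} \<inter> C) \<union> (C \<inter> F) \<subseteq> \<Phi> ` C" by blast
    qed
    have "closedin P (\<Phi> ` (K \<times> {0..1} \<inter> C))"
      using KI C c\<Phi> HP by (meson compact_Int_closedin compactin_imp_closedin image_compactin)
    then show "closedin P (\<Phi> ` C)" unfolding eq using C F by blast
  qed
  have "homeomorphic_map P P \<Phi>"
    using bijective_closed_imp_homeomorphic_map c\<Phi> closed surj inj by blast
  then obtain \<Psi> where \<Psi>: "homeomorphic_maps P P \<Phi> \<Psi>" using homeomorphic_map_maps by blast
  have "continuous_map P N (fst \<circ> \<Psi>)"
    using \<Psi> by (auto simp: homeomorphic_maps_def P_def intro!: continuous_map_compose continuous_map_fst)
  moreover have "(fst \<circ> \<Psi>) p = (\<lambda>(x, t). (\<lambda>x \<in> topspace N. inv_into (topspace N) (h t) x) x) p"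
    if pP: "p \<in> topspace P" for p
  proof -
    obtain x t where p: "p = (x, t)" "x \<in> topspace N" "t \<in> {0..1}" using pP by (auto simp: P_def tI)
    obtain y s where q: "\<Psi> p = (y, s)" by fastforce
    have "\<Psi> p \<in> topspace P" "\<Phi> (\<Psi> p) = p"
      using \<Psi> pP by (auto simp: homeomorphic_maps_def continuous_map_def)
    then have "(y, s) \<in> topspace P" "\<Phi> (y, s) = (x, t)" by (simp_all only: q[symmetric] p(1)[symmetric])
    then have "h t y = x" "y \<in> topspace N" by (auto simp: \<Phi>_def P_def)
    then have "inv_into (topspace N) (h t) x = y"
      using bij[OF p(3)] by (auto simp: bij_betw_def)
    then show ?thesis using p(2) q unfolding p(1) by simp
  qed
  ultimately have "continuous_map P N (\<lambda>(x, t). (\<lambda>x \<in> topspace N. inv_into (topspace N) (h t) x) x)"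
    by (rule continuous_map_eq)
  moreover have "supp N (\<lambda>x \<in> topspace N. inv_into (topspace N) (h t) x) \<subseteq> K"
    if t: "t \<in> {0..1}" for t
  proof -
    have "{x \<in> topspace N. (\<lambda>x \<in> topspace N. inv_into (topspace N) (h t) x) x \<noteq> x}
        \<subseteq> {x \<in> topspace N. h t x \<noteq> x}"
      using bij[OF t] by (auto simp: bij_betw_def inv_into_f_eq)
    then show ?thesis using sK[OF t] closure_of_mono unfolding supp_def by blast
  qed
  ultimately show ?thesis
    using compactly_supported_isotopyI[OF homeos_inv[OF hom] _ K] by (simp add: P_def I_def)
qed

lemma isotopy_compose:
  assumes "compactly_supported_isotopy N f" "compactly_supported_isotopy N g"
  shows "compactly_supported_isotopy N (\<lambda>t. compose (topspace N) (f t) (g t))"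
proof -
  define P where "P = prod_topology N (top_of_set {0..1::real})"
  obtain K L where K: "compactin N K" "\<And>t. t \<in> {0..1} \<Longrightarrow> supp N (f t) \<subseteq> K"
    and L: "compactin N L" "\<And>t. t \<in> {0..1} \<Longrightarrow> supp N (g t) \<subseteq> L"
    and f: "\<And>t. t \<in> {0..1} \<Longrightarrow> f t \<in> homeos N" "continuous_map P N (\<lambda>(x, t). f t x)"
    and g: "\<And>t. t \<in> {0..1} \<Longrightarrow> g t \<in> homeos N" "continuous_map P N (\<lambda>(x, t). g t x)"
    using assms by (auto simp: compactly_supported_isotopy_def isotopy_def P_def)
  have "continuous_map P P (\<lambda>(x, t). (g t x, t))"
    using g(2) unfolding P_def
    by (simp add: continuous_map_pairwise o_def case_prod_unfold continuous_map_snd)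
  from continuous_map_compose[OF this f(2)]
  have "continuous_map P N (\<lambda>(x, t). compose (topspace N) (f t) (g t) x)"
    by (rule continuous_map_eq) (auto simp: P_def compose_eq)
  moreover have "supp N (compose (topspace N) (f t) (g t)) \<subseteq> K \<union> L" if t: "t \<in> {0..1}" for t
  proof -
    have "{x \<in> topspace N. compose (topspace N) (f t) (g t) x \<noteq> x}
       \<subseteq> {x \<in> topspace N. f t x \<noteq> x} \<union> {x \<in> topspace N. g t x \<noteq> x}"
      by (auto simp: compose_eq)
    then have "supp N (compose (topspace N) (f t) (g t)) \<subseteq> supp N (f t) \<union> supp N (g t)"
      unfolding supp_def closure_of_Un[symmetric] by (rule closure_of_mono)
    then show ?thesis using K(2)[OF t] L(2)[OF t] by blast
  qed
  moreover have "compactin N (K \<union> L)" using K L by (simp add: compactin_Un)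
  ultimately show ?thesis
    using compactly_supported_isotopyI[OF homeos_compose[OF f(1) g(1)]] by (simp add: P_def)
qed

lemma isotopy_id: "compactly_supported_isotopy N (\<lambda>t. \<lambda>x \<in> topspace N. x)"
proof -
  have "continuous_map (prod_topology N (top_of_set {0..1::real})) N
      (\<lambda>(x, t). (\<lambda>x \<in> topspace N. x) x)"
    by (rule continuous_map_eq[OF continuous_map_fst]) auto
  moreover have "supp N (\<lambda>x \<in> topspace N. x) = {}"
    by (auto simp: supp_def)
  ultimately show ?thesis
    by (auto simp: compactly_supported_isotopy_def isotopy_def homeos_id)
qed

lemma subgroup_isotopies:
  assumes "Hausdorff_space N" "A \<subseteq> topspace N"
  shows "subgroup {g \<in> homeos N. \<exists>h. compactly_supported_isotopy N h \<and>
        h 0 = (\<lambda>x \<in> topspace N. x) \<and> h 1 = g \<and> (\<forall>t \<in> {0..1}. \<forall>x \<in> A. h t x = x)}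
     (BijGroup (topspace N))" (is "subgroup ?H ?B")
proof
  have memI: "h 1 \<in> ?H" if "compactly_supported_isotopy N h" "h 0 = (\<lambda>x \<in> topspace N. x)"
    "\<And>t x. t \<in> {0..1} \<Longrightarrow> x \<in> A \<Longrightarrow> h t x = x" for h
  proof -
    have "h 1 \<in> homeos N"
      using that(1) by (simp add: compactly_supported_isotopy_def isotopy_def)
    then show ?thesis using that by blast
  qed
  have inB: "g \<in> Bij (topspace N)" if "g \<in> ?H" for g
    using that homeos_Bij by blast
  show "?H \<subseteq> carrier ?B" using inB by (auto simp: BijGroup_def)
  show "\<one>\<^bsub>?B\<^esub> \<in> ?H"
    using memI[OF isotopy_id] assms(2) by (simp add: BijGroup_def subset_iff)
  fix a assume a: "a \<in> ?H"
  then obtain f where f: "compactly_supported_isotopy N f" "f 0 = (\<lambda>x \<in> topspace N. x)"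
    "f 1 = a" "\<And>t x. t \<in> {0..1} \<Longrightarrow> x \<in> A \<Longrightarrow> f t x = x" by blast
  have inj: "inj_on (f t) (topspace N)" if "t \<in> {0..1}" for t
    using f(1) that homeos_Bij[of "f t" N]
    by (simp add: compactly_supported_isotopy_def isotopy_def Bij_def bij_betw_def)
  have fixA: "(\<lambda>x \<in> topspace N. inv_into (topspace N) (f t) x) x = x"
    if "t \<in> {0..1}" "x \<in> A" for t x
    using inv_into_f_eq[OF inj[OF that(1)] _ f(4)[OF that]] that(2) assms(2) by auto
  have "inv_into (topspace N) (\<lambda>x \<in> topspace N. x) x = x" if "x \<in> topspace N" for x
    using that by (auto intro!: inv_into_f_eq simp: inj_on_def)
  then have "(\<lambda>x \<in> topspace N. inv_into (topspace N) (f 0) x) = (\<lambda>x \<in> topspace N. x)"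
    unfolding f(2) by (simp cong: restrict_cong)
  then have "(\<lambda>x \<in> topspace N. inv_into (topspace N) (f 1) x) \<in> ?H"
    by (rule memI[OF isotopy_inverse[OF assms(1) f(1)]]) (rule fixA)
  then show "inv\<^bsub>?B\<^esub> a \<in> ?H"
    unfolding inv_BijGroup[OF inB[OF a]] f(3) .
  fix b assume b: "b \<in> ?H"
  then obtain g where g: "compactly_supported_isotopy N g" "g 0 = (\<lambda>x \<in> topspace N. x)"
    "g 1 = b" "\<And>t x. t \<in> {0..1} \<Longrightarrow> x \<in> A \<Longrightarrow> g t x = x" by blast
  have id: "compose (topspace N) (f 0) (g 0) = (\<lambda>x \<in> topspace N. x)"
    by (auto simp: f(2) g(2) compose_def)
  have "compose (topspace N) (f t) (g t) x = x" if "t \<in> {0..1}" "x \<in> A" for t x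
    using that assms(2) by (simp add: compose_eq f(4) g(4) subset_iff)
  from memI[OF isotopy_compose[OF f(1) g(1)] id this]
  show "a \<otimes>\<^bsub>?B\<^esub> b \<in> ?H"
    using inB[OF a] inB[OF b] by (simp add: BijGroup_def f(3) g(3))
qed

lemma group_Hc_group:
  assumes "Hausdorff_space N" shows "group (Hc_group N)"
  using subgroup.subgroup_is_group[OF subgroup_isotopies[OF assms empty_subsetI] group_BijGroup]
  by (simp add: Hc_group_def)

lemma group_Hc_boundary_group:
  assumes "Hausdorff_space M" shows "group (Hc_boundary_group n M)"
  using subgroup.subgroup_is_group[OF subgroup_isotopies[OF assms] group_BijGroup]
  by (simp add: Hc_boundary_group_def manifold_boundary_def)

end

theory Submission
  imports Defs "HOL-Homology.Invariance_of_Domain"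
begin

text \<open>
  If \<open>S\<close> is a compact model of the boundary, a collar \<open>S \<times> [0,1] \<rightarrow> M\<close> exists by Connelly's argument, the
  boundary charts being supplied by invariance of domain. For the first claim, an isotopy \<open>h\<^sub>t\<close> of the
  boundary extends to \<open>(x, s) \<mapsto> (h\<^bsub>t max(0, 1 - 2s)\<^esub> x, s)\<close> on the collar, so restriction to the boundary is onto,
  and boundedness passes to quotients.

  For the second claim, shrinking the collar from level \<open>e\<close> to \<open>[e/2, e]\<close> and conjugating cuts a homeomorphism
  \<open>g\<close> that fixes the boundary off to a homeomorphism supported away from the boundary, and does so
  multiplicatively and continuously in \<open>g\<close> and \<open>e\<close>. Two consequences replace the deformation theorem of
  Edwards and Kirby: an element of the group that is the identity near the boundary is isotopic
  to the identity with compact support in the interior, and every germ at the boundary of a homeomorphism fixing it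
  is represented in the group. So it suffices to bound the norm modulo germs. Decompose a germ as a product
  \<open>O E\<close>, where both factors preserve a sequence of layers converging to the boundary; then transport the layers
  to standard ones, on which \<open>E\<close> acts by \<open>(k\<^sub>0, k\<^sub>1, \<dots>)\<close>. The layers can be chosen
  successively so thin that \<open>K\<^sub>p = k\<^sub>p k\<^bsub>p+1\<^esub> \<dots>\<close> converges. If \<open>F\<close> acts by \<open>(K\<^sub>0, K\<^sub>1, \<dots>)\<close> and \<open>\<phi>\<close> shifts
  each layer to the preceding one, then \<open>[F, \<phi>]\<close> acts by \<open>K\<^sub>p K\<^bsub>p+1\<^esub>\<^sup>-\<^sup>1 = k\<^sub>p\<close> near the boundary. Hence every germ is a
  product of two commutators with conjugates of the fixed element \<open>\<phi>\<close>.
\<close>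

section \<open>Homeomorphisms of a cylinder\<close>

text \<open>Infinite-product arguments usually let supports shrink to points. Layers
  \<open>S \<times> [b, a]\<close> get thin but not narrow, so the horizontal displacement has to
  tend to zero by itself, or \<open>F\<close> would be discontinuous at the boundary. A change of
  height prepares this: with reference heights sent to \<open>1 / (n + 2)\<close>, whose consecutive
  ratios tend to 1, a germ moves heights by a vanishing fraction; geometric heights would only bound
  the ratio. As low points also move little horizontally, the map carried by a low layer, blown up
  to the whole cylinder, is then close to the identity. An arbitrary germ preserves no layer, and
  cutting it off at a level leaves a transition between the germ and the identity; with two families
  of layers, each makes up for the transitions of the other. A layer map depends on its lower level
  as well, which is chosen later, so its smallness has to be uniform in that choice. The resulting
  bound is \<open>B + 4 * \<nu> \<Phi>\<close>, where \<open>B\<close> bounds the norm on the image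
  of the interior group.\<close>

text \<open>The map is a series of clipped ramps, one for each interval: ramp \<open>k\<close>
  climbs by \<open>\<tau> k - \<tau> (Suc k)\<close> across \<open>[t (Suc k), t k]\<close> and is
  constant elsewhere. The heights telescope, so the M-test gives continuity at 0, where the
  breakpoints accumulate.\<close>

lemma piecewise_affine_homeomorphism:
  fixes t \<tau> :: "nat \<Rightarrow> real"
  assumes t: "\<And>k. t (Suc k) < t k" "t 0 = 1/2" "t \<longlonglongrightarrow> 0"
    and \<tau>: "\<And>k. \<tau> (Suc k) < \<tau> k" "\<tau> 0 = 1/2" "\<tau> \<longlonglongrightarrow> 0"
  obtains T U where "homeomorphism {0..1} {0..1} T U" "T 0 = 0" "strict_mono_on {0..1} T"
    "\<And>s. s \<in> {1/2..1} \<Longrightarrow> T s = s"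
    "\<And>k s. s \<in> {t (Suc k)..t k} \<Longrightarrow>
       T s = \<tau> (Suc k) + (\<tau> k - \<tau> (Suc k)) * ((s - t (Suc k)) / (t k - t (Suc k)))"
proof -
  define q where "q k s = (\<tau> k - \<tau> (Suc k)) * max 0 (min 1 ((s - t (Suc k)) / (t k - t (Suc k))))"
    for k s
  have dec_t: "decseq t" and dec_\<tau>: "decseq \<tau>"
    using t(1) \<tau>(1) by (auto intro!: decseq_SucI less_imp_le)
  have t_nn: "0 \<le> t k" for k
    using dec_t t(3) by (simp add: decseq_ge)
  have \<tau>_nn: "0 \<le> \<tau> k" for k
    using dec_\<tau> \<tau>(3) by (simp add: decseq_ge)
  have tne: "t k \<noteq> t (Suc k)" for k using t(1)[of k] by simp
  have t_pos: "0 < t k" for k using t_nn[of "Suc k"] t(1)[of k] by linarith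
  have sm\<tau>: "(\<lambda>j. \<tau> (j + k) - \<tau> (Suc (j + k))) sums \<tau> k" for k
    using telescope_sums'[of "\<lambda>j. \<tau> (j + k)" 0] LIMSEQ_ignore_initial_segment[OF \<tau>(3), of k] by simp
  have qb: "norm (q k s) \<le> \<tau> k - \<tau> (Suc k)" for k s
    using \<tau>(1)[of k] by (auto simp: q_def abs_mult mult_left_le)
  have qs: "summable (\<lambda>k. q k s)" for s
    by (rule summable_comparison_test'[OF sums_summable[OF sm\<tau>[of 0]], of 0])
       (use qb in auto)
  \<comment> \<open>Above \<open>t 0 = 1/2\<close> all ramps are saturated with total
    \<open>\<tau> 0 = 1/2\<close>; the last summand continues with slope 1, which gives
    \<open>T s = s\<close> there.\<close>
  define T where "T s = suminf (\<lambda>k. q k s) + max 0 (s - 1/2)" for s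
  have "uniform_limit UNIV (\<lambda>n s. \<Sum>k<n. q k s) (\<lambda>s. suminf (\<lambda>k. q k s)) sequentially"
    by (rule Weierstrass_m_test[where M="\<lambda>k. \<tau> k - \<tau> (Suc k)"])
       (use qb sums_summable[OF sm\<tau>[of 0]] in auto)
  then have "continuous_on UNIV (\<lambda>s. suminf (\<lambda>k. q k s))"
    by (rule uniform_limit_theorem[rotated])
       (use tne in \<open>auto simp: q_def intro!: continuous_intros always_eventually\<close>)
  then have cT: "continuous_on A T" for A
    unfolding T_def by (intro continuous_intros) (auto intro: continuous_on_subset)
  have q1: "q k s = \<tau> k - \<tau> (Suc k)" if "t k \<le> s" for k s
    using that t(1)[of k] by (simp add: q_def)
  have q0: "q k s = 0" if "s \<le> t (Suc k)" for k s
    using that t(1)[of k] by (simp add: q_def divide_nonpos_pos)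
  have aff: "T s = \<tau> (Suc k) + (\<tau> k - \<tau> (Suc k)) * ((s - t (Suc k)) / (t k - t (Suc k)))"
    if s: "s \<in> {t (Suc k)..t k}" for k s
  proof -
    have "s \<le> 1/2" using s decseqD[OF dec_t, of 0 k] t(2) by simp
    \<comment> \<open>On the interval with index \<open>k\<close> the ramps of larger index are
      saturated and telescope to \<open>\<tau> (Suc k)\<close>, those of smaller index vanish; only
      ramp \<open>k\<close> varies with \<open>s\<close>.\<close>
    have "(\<lambda>j. q (j + Suc k) s) sums \<tau> (Suc k)"
    proof -
      have "q (j + Suc k) s = \<tau> (j + Suc k) - \<tau> (Suc (j + Suc k))" for j
        using s decseqD[OF dec_t, of "Suc k" "j + Suc k"] by (intro q1) auto
      then show ?thesis using sm\<tau>[of "Suc k"] by simp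
    qed
    then have "(\<lambda>j. q j s) sums (\<tau> (Suc k) + (\<Sum>j<Suc k. q j s))"
      using sums_iff_shift[of "\<lambda>j. q j s" "Suc k"] by blast
    moreover have "(\<Sum>j<k. q j s) = 0"
    proof (intro sum.neutral ballI)
      fix j assume "j \<in> {..<k}"
      then show "q j s = 0" using s decseqD[OF dec_t, of "Suc j" k] by (intro q0) auto
    qed
    moreover have "q k s = (\<tau> k - \<tau> (Suc k)) * ((s - t (Suc k)) / (t k - t (Suc k)))"
      using s t(1)[of k] by (simp add: q_def max_absorb2 min_absorb2)
    ultimately show ?thesis using \<open>s \<le> 1/2\<close> by (simp add: T_def sums_iff)
  qed
  have top: "T s = s" if "s \<in> {1/2..1}" for s
  proof -
    have "q j s = \<tau> (j + 0) - \<tau> (Suc (j + 0))" for j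
      using that decseqD[OF dec_t, of 0 j] t(2) q1[of j s] by simp
    then have "(\<lambda>j. q j s) sums (1/2)" using sm\<tau>[of 0] \<tau>(2) by simp
    then show ?thesis using that by (simp add: T_def sums_iff)
  qed
  have "q j 0 = 0" for j using q0[OF t_nn] .
  then have T0: "T 0 = 0" by (simp add: T_def)
  have mono: "T s \<le> T s'" if "s \<le> s'" for s s'
  proof -
    have "q k s \<le> q k s'" for k
      unfolding q_def using t(1)[of k] \<tau>(1)[of k] that
      by (intro mult_left_mono max.mono min.mono divide_right_mono) auto
    then have "suminf (\<lambda>k. q k s) \<le> suminf (\<lambda>k. q k s')" by (intro suminf_le qs)
    then show ?thesis unfolding T_def using that by (simp add: max_def)
  qed
  have smono: "strict_mono_on {0..1} T"
  proof (rule strict_mono_onI)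
    fix s s' :: real assume s: "s \<in> {0..1}" "s' \<in> {0..1}" "s < s'"
    show "T s < T s'"
    proof (cases "s' \<le> 1/2")
      case False
      have "T s \<le> T (max s (1/2))" by (rule mono) simp
      also have "\<dots> < T s'" using False s by (subst (1 2) top) auto
      finally show ?thesis .
    next
      case True
      have "\<exists>k. t k < s'"
        using order_tendstoD(2)[OF t(3), of s'] s by (auto simp: eventually_sequentially)
      then obtain k where k: "t k < s'" "\<And>j. j < k \<Longrightarrow> s' \<le> t j"
        using LeastI_ex[of "\<lambda>k. t k < s'"] not_less_Least[of _ "\<lambda>k. t k < s'"] by (meson not_le)
      have "k \<noteq> 0" using k(1) True t(2) by (metis not_less)
      then obtain j where j: "k = Suc j" using not0_implies_Suc by blast
      have s': "s' \<in> {t (Suc j)..t j}" using k j by auto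
      \<comment> \<open>Strictness is read off on one affine piece: \<open>s\<close> is raised into
        the piece that contains \<open>s'\<close>.\<close>
      have "T s \<le> T (max s (t (Suc j)))" by (rule mono) simp
      also have "\<dots> < T s'"
        using s s' k(1) t(1)[of j] \<tau>(1)[of j] unfolding j
        by (subst (1 2) aff[of _ j]) (auto simp: divide_strict_right_mono)
      finally show ?thesis .
    qed
  qed
  have "T ` {0..1} = {0..1}"
  proof
    show "T ` {0..1} \<subseteq> {0..1}" using mono[of 0] mono[of _ 1] T0 top[of 1] by auto
    show "{0..1} \<subseteq> T ` {0..1}"
    proof
      fix y :: real assume "y \<in> {0..1}"
      then obtain x where "0 \<le> x" "x \<le> 1" "T x = y"
        using IVT'[of T 0 y 1] cT T0 top[of 1] by auto
      then show "y \<in> T ` {0..1}" by auto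
    qed
  qed
  then obtain U where "homeomorphism {0..1} {0..1} T U"
    using homeomorphism_compact[of "{0..1}" T "{0..1}"] cT strict_mono_on_imp_inj_on[OF smono] by auto
  from that[OF this T0 smono top aff] show ?thesis .
qed

section \<open>Germs of homeomorphisms at the bottom of a compact cylinder\<close>

text \<open>The base is later a copy of the compact boundary inside
  \<open>nat \<Rightarrow> real\<close>. Working in a complete metric type makes uniform continuity
  and uniform limits available on \<open>C\<close>.\<close>

locale cylinder =
  fixes S :: "'b::complete_space set"
  assumes compact_base: "compact S"
begin

definition C :: "('b \<times> real) set" where "C = S \<times> {0..1}"

text \<open>The inverse is an argument because cut-offs and commutators use it explicitly. Being the
  identity over \<open>[1/2, 1]\<close> allows extension by the identity from the collar to the
  manifold.\<close>

definition cyl_homeo :: "('b \<times> real \<Rightarrow> 'b \<times> real) \<Rightarrow> ('b \<times> real \<Rightarrow> 'b \<times> real) \<Rightarrow> bool" where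
  "cyl_homeo f g \<longleftrightarrow> homeomorphism C C f g \<and> (\<forall>x\<in>S. f (x, 0) = (x, 0)) \<and>
     (\<forall>x\<in>S. \<forall>s\<in>{1/2..1}. f (x, s) = (x, s))"

definition germ_eq :: "('b \<times> real \<Rightarrow> 'b \<times> real) \<Rightarrow> ('b \<times> real \<Rightarrow> 'b \<times> real) \<Rightarrow> bool" where
  "germ_eq f g \<longleftrightarrow> (\<exists>d>0. \<forall>p\<in>C. snd p \<le> d \<longrightarrow> f p = g p)"

lemma compact_C: "compact C"
  unfolding C_def by (intro compact_Times compact_base compact_Icc)

lemma mem_C [simp]: "(x, s) \<in> C \<longleftrightarrow> x \<in> S \<and> 0 \<le> s \<and> s \<le> 1"
  by (auto simp: C_def)

lemma C_snd: "p \<in> C \<Longrightarrow> 0 \<le> snd p \<and> snd p \<le> 1"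
  and C_fst: "p \<in> C \<Longrightarrow> fst p \<in> S"
  by (auto simp: C_def)

lemma cyl_homeoD:
  assumes "cyl_homeo f g"
  shows "homeomorphism C C f g" "continuous_on C f" "continuous_on C g"
    "\<And>p. p \<in> C \<Longrightarrow> f p \<in> C" "\<And>p. p \<in> C \<Longrightarrow> g p \<in> C"
    "\<And>p. p \<in> C \<Longrightarrow> g (f p) = p" "\<And>p. p \<in> C \<Longrightarrow> f (g p) = p"
    "\<And>x. x \<in> S \<Longrightarrow> f (x, 0) = (x, 0)"
    "\<And>x s. x \<in> S \<Longrightarrow> 1/2 \<le> s \<Longrightarrow> s \<le> 1 \<Longrightarrow> f (x, s) = (x, s)"
  using assms by (auto simp: cyl_homeo_def homeomorphism_def)

lemma cyl_homeo_sym: assumes "cyl_homeo f g" shows "cyl_homeo g f"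
proof -
  have "g (x, 0) = (x, 0)" if "x \<in> S" for x
    using cyl_homeoD(6)[OF assms, of "(x, 0)"] cyl_homeoD(8)[OF assms that] that by simp
  moreover have "g (x, s) = (x, s)" if "x \<in> S" "1/2 \<le> s" "s \<le> 1" for x s
    using cyl_homeoD(6)[OF assms, of "(x, s)"] cyl_homeoD(9)[OF assms that] that by simp
  ultimately show ?thesis using cyl_homeoD(1)[OF assms] by (auto simp: cyl_homeo_def intro: homeomorphism_symD)
qed

lemma cyl_homeo_comp: "cyl_homeo f g \<Longrightarrow> cyl_homeo f' g' \<Longrightarrow> cyl_homeo (f \<circ> f') (g' \<circ> g)"
  unfolding cyl_homeo_def by (auto intro: homeomorphism_compose)

text \<open>The bottom is fixed pointwise, so uniform continuity gives one height that works over
  all base points.\<close>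

lemma cyl_homeo_small:
  assumes "cyl_homeo f g" "0 < e"
  shows "\<exists>d>0. \<forall>p\<in>C. snd p \<le> d \<longrightarrow> dist (f p) (fst p, 0) < e"
proof -
  have "uniformly_continuous_on C f"
    by (rule compact_uniformly_continuous[OF cyl_homeoD(2)[OF assms(1)] compact_C])
  then have "\<exists>d>0. \<forall>p\<in>C. \<forall>p'\<in>C. dist p' p < d \<longrightarrow> dist (f p') (f p) < e"
    using assms(2) unfolding uniformly_continuous_on_def by simp
  then obtain d where d: "d > 0" "\<forall>p\<in>C. \<forall>p'\<in>C. dist p' p < d \<longrightarrow> dist (f p') (f p) < e"
    by (elim exE conjE)
  have "dist (f p) (fst p, 0) < e" if "p \<in> C" "snd p \<le> d/2" for p
  proof -
    have "dist p (fst p, 0) < d"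
      using that C_snd[OF that(1)] d(1) by (cases p) (simp add: dist_Pair_Pair dist_real_def)
    then show ?thesis
      using d(2)[rule_format, of "(fst p, 0)" p] that C_fst[OF that(1)] cyl_homeoD(8)[OF assms(1) C_fst[OF that(1)]] by simp
  qed
  then show ?thesis using d(1) by (intro exI[of _ "d/2"]) auto
qed

lemma cyl_homeo_snd_small:
  assumes "cyl_homeo f g" "0 < e"
  shows "\<exists>d>0. \<forall>p\<in>C. snd p \<le> d \<longrightarrow> snd (f p) < e"
proof -
  obtain d where "d > 0" "\<And>p. p \<in> C \<Longrightarrow> snd p \<le> d \<Longrightarrow> dist (f p) (fst p, 0) < e"
    using cyl_homeo_small[OF assms] by blast
  moreover have "snd (f p) \<le> dist (f p) (fst p, 0)" for p
    using dist_snd_le[of "f p" "(fst p, 0)"] by (simp add: dist_real_def)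
  ultimately show ?thesis by (meson le_less_trans)
qed

lemma germ_eq_refl: "germ_eq f f"
  unfolding germ_eq_def by (intro exI[of _ 1]) simp

lemma germ_eq_trans: assumes "germ_eq f g" "germ_eq g h" shows "germ_eq f h"
proof -
  obtain d e where "d > 0" "e > 0" "\<forall>p\<in>C. snd p \<le> d \<longrightarrow> f p = g p" "\<forall>p\<in>C. snd p \<le> e \<longrightarrow> g p = h p"
    using assms unfolding germ_eq_def by auto
  then show ?thesis unfolding germ_eq_def by (intro exI[of _ "min d e"]) auto
qed

text \<open>The inner map has to send low points to low points before the germ of the outer one may
  be used; continuity at the fixed bottom provides this.\<close>

lemma germ_eq_comp:
  assumes "germ_eq f f'" "germ_eq g g'" "cyl_homeo g' h"
  shows "germ_eq (f \<circ> g) (f' \<circ> g')"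
proof -
  obtain d where d: "d > 0" "\<forall>p\<in>C. snd p \<le> d \<longrightarrow> f p = f' p"
    using assms(1) unfolding germ_eq_def by auto
  obtain e where e: "e > 0" "\<forall>p\<in>C. snd p \<le> e \<longrightarrow> g p = g' p"
    using assms(2) unfolding germ_eq_def by auto
  obtain a where a: "a > 0" "\<forall>p\<in>C. snd p \<le> a \<longrightarrow> snd (g' p) < d"
    using cyl_homeo_snd_small[OF assms(3) d(1)] by auto
  have "(f \<circ> g) p = (f' \<circ> g') p" if "p \<in> C" "snd p \<le> min e a" for p
    using that d e a cyl_homeoD(4)[OF assms(3), of p] by (simp add: less_imp_le)
  then show ?thesis unfolding germ_eq_def using e(1) a(1) by (intro exI[of _ "min e a"]) auto
qed

definition level_map :: "(real \<Rightarrow> real) \<Rightarrow> 'b \<times> real \<Rightarrow> 'b \<times> real" where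
  "level_map T p = (fst p, T (snd p))"

lemma cyl_homeo_level_map:
  assumes "homeomorphism {0..1} {0..1} T U" "T 0 = 0" "\<And>s. s \<in> {1/2..1} \<Longrightarrow> T s = s"
  shows "cyl_homeo (level_map T) (level_map U)"
proof -
  have T: "T s \<in> {0..1}" "U (T s) = s" "U s \<in> {0..1}" "T (U s) = s" if "s \<in> {0..1}" for s
    using assms(1) that by (auto simp: homeomorphism_def)
  have "continuous_on C (level_map T)" "continuous_on C (level_map U)"
    unfolding level_map_def using assms(1)
    by (auto simp: homeomorphism_def C_def intro!: continuous_intros
        intro: continuous_on_compose2[of "{0..1}" T] continuous_on_compose2[of "{0..1}" U])
  then have "homeomorphism C C (level_map T) (level_map U)"
    by (intro homeomorphismI) (use T in \<open>auto simp: level_map_def C_def\<close>)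
  then show ?thesis using assms by (auto simp: cyl_homeo_def level_map_def)
qed

end

text \<open>The partial products \<open>G n\<close> converge to a homeomorphism because each factor is small compared with the
  modulus of continuity of the preceding product.\<close>

lemma infinite_product_homeomorphism:
  fixes X :: "'x::complete_space set" and k k' G G' :: "nat \<Rightarrow> 'x \<Rightarrow> 'x"
  assumes X: "compact X" and k: "\<And>n. homeomorphism X X (k n) (k' n)"
    and G: "\<And>x. x \<in> X \<Longrightarrow> G 0 x = x" "\<And>n x. x \<in> X \<Longrightarrow> G (Suc n) x = G n (k n x)"
    and G': "\<And>x. x \<in> X \<Longrightarrow> G' 0 x = x" "\<And>n x. x \<in> X \<Longrightarrow> G' (Suc n) x = k' n (G' n x)"
    and small: "\<And>n x. x \<in> X \<Longrightarrow> dist (G n (k n x)) (G n x) \<le> (1/2)^n"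
      "\<And>n x. x \<in> X \<Longrightarrow> dist (k n x) x \<le> (1/2)^n"
  obtains K K' where "homeomorphism X X K K'" "\<And>n. homeomorphism X X (G n) (G' n)"
    "uniform_limit X (\<lambda>n x. G' n (K x)) (\<lambda>x. x) sequentially" "uniform_limit X G K sequentially"
proof -
  note kD = k[unfolded homeomorphism_def]
  have hG: "homeomorphism X X (G n) (G' n)" for n
  proof (induction n)
    case 0
    show ?case by (rule homeomorphism_cong[OF homeomorphism_ident]) (auto simp: G(1) G'(1))
  next
    case (Suc n)
    have "k n x \<in> X" if "x \<in> X" for x using kD[of n] that by blast
    then show ?case
      by (intro homeomorphism_cong[OF homeomorphism_compose[OF k[of n] Suc]]) (auto simp: G(2) G'(2))
  qed
  have GD: "continuous_on X (G n)" "continuous_on X (G' n)" "x \<in> X \<Longrightarrow> G n x \<in> X" "x \<in> X \<Longrightarrow> G' n x \<in> X"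
    "x \<in> X \<Longrightarrow> G n (G' n x) = x" "x \<in> X \<Longrightarrow> G' n (G n x) = x" for n x
    using hG[of n] by (auto simp: homeomorphism_def)
  have kX: "x \<in> X \<Longrightarrow> k n x \<in> X" "x \<in> X \<Longrightarrow> k' n x \<in> X" "x \<in> X \<Longrightarrow> k n (k' n x) = x" for n x
    using kD[of n] by auto
  have lim: "\<exists>L. uniform_limit X f L sequentially"
    if f: "\<And>n x. x \<in> X \<Longrightarrow> dist (f (Suc n) x) (f n x) \<le> (1/2)^n" for f :: "nat \<Rightarrow> 'x \<Rightarrow> 'x"
  proof -
    have far: "dist (f (n + m) x) (f n x) \<le> 2 * (1/2)^n - 2 * (1/2)^(n + m)" if "x \<in> X" for n m x
    proof (induction m)
      case (Suc m)
      have "dist (f (n + Suc m) x) (f n x) \<le> dist (f (Suc (n + m)) x) (f (n + m) x) + dist (f (n + m) x) (f n x)"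
        by (simp add: dist_triangle)
      also have "\<dots> \<le> (1/2)^(n + m) + (2 * (1/2)^n - 2 * (1/2)^(n + m))"
        using f[OF that, of "n + m"] Suc by simp
      also have "\<dots> = 2 * (1/2)^n - 2 * (1/2)^(n + Suc m)" by simp
      finally show ?case .
    qed simp
    have "\<exists>M. \<forall>x\<in>X. \<forall>m\<ge>M. \<forall>n\<ge>M. dist (f m x) (f n x) < e" if e: "e > 0" for e
    proof -
      obtain M where M: "(1/2::real)^M < e/4" using real_arch_pow_inv[of "e/4" "1/2"] e by auto
      have near: "dist (f m x) (f M x) < e/2" if "x \<in> X" "m \<ge> M" for m x
      proof -
        have "dist (f m x) (f M x) \<le> 2 * (1/2)^M - 2 * (1/2)^m"
          using far[OF that(1), of M "m - M"] that(2) by simp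
        moreover have "(0::real) < (1/2)^m" by simp
        ultimately show ?thesis using M by linarith
      qed
      show ?thesis
      proof (intro exI[of _ M] ballI allI impI)
        fix x m n assume "x \<in> X" "m \<ge> M" "n \<ge> M"
        then show "dist (f m x) (f n x) < e"
          using near[of x m] near[of x n] dist_triangle2[of "f m x" "f n x" "f M x"] by linarith
      qed
    qed
    then have "uniformly_Cauchy_on X f" unfolding uniformly_Cauchy_on_def by blast
    then show ?thesis
      using Cauchy_uniformly_convergent uniformly_convergent_on_def by blast
  qed
  \<comment> \<open>For the inverse products the displacement bound alone suffices:
    \<open>k' n\<close> is applied last, and it displaces no point further than \<open>k n\<close>
    does.\<close>
  have "dist (G' (Suc n) x) (G' n x) \<le> (1/2)^n" if "x \<in> X" for n x
    using small(2)[OF kX(2)[OF GD(4)[OF that]], of n n n] kX(3)[OF GD(4)[OF that], of n n]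
    by (simp add: G'(2)[OF that] dist_commute)
  then obtain K' where K': "uniform_limit X G' K' sequentially" using lim by blast
  have "dist (G (Suc n) x) (G n x) \<le> (1/2)^n" if "x \<in> X" for n x
    using small(1)[OF that] by (simp add: G(2)[OF that])
  then obtain K where K: "uniform_limit X G K sequentially" using lim by blast
  have cont: "continuous_on X K" "continuous_on X K'"
    by (rule uniform_limit_theorem[OF _ K] uniform_limit_theorem[OF _ K'], use GD in auto)+
  have clX: "closed X" using X by (rule compact_imp_closed)
  have KX: "K x \<in> X" "K' x \<in> X" if "x \<in> X" for x
    using closed_sequentially[OF clX, of "\<lambda>n. G n x" "K x"] closed_sequentially[OF clX, of "\<lambda>n. G' n x" "K' x"]
      tendsto_uniform_limitI[OF K that] tendsto_uniform_limitI[OF K' that] GD(3,4)[OF that] by auto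
  \<comment> \<open>The identity \<open>H n (H' n x) = x\<close> passes to the limit:
    \<open>L (H' n x)\<close> tends to \<open>L (L' x)\<close> by continuity of \<open>L\<close>,
    and it is near \<open>H n (H' n x)\<close> because \<open>H\<close> converges uniformly.\<close>
  have inv: "L (L' x) = x"
    if H: "uniform_limit X H L sequentially" and H': "uniform_limit X H' L' sequentially"
      and cL: "continuous_on X L" and xX: "x \<in> X" "L' x \<in> X"
      and HX: "\<And>n. H' n x \<in> X" "\<And>n. H n (H' n x) = x"
    for H H' :: "nat \<Rightarrow> 'x \<Rightarrow> 'x" and L L' x
  proof -
    have 1: "(\<lambda>n. L (H' n x)) \<longlonglongrightarrow> L (L' x)"
      using tendsto_uniform_limitI[OF H' xX(1)] cL xX(2) HX(1)
      by (auto simp: continuous_on_sequentially o_def)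
    have "dist (L (L' x)) x < e" if "e > 0" for e
    proof -
      have "\<forall>\<^sub>F n in sequentially. dist (L (H' n x)) (L (L' x)) < e/2"
        using tendstoD[OF 1, of "e/2"] that by simp
      moreover have "\<forall>\<^sub>F n in sequentially. \<forall>y\<in>X. dist (H n y) (L y) < e/2"
        using uniform_limitD[OF H, of "e/2"] that by simp
      ultimately have "\<forall>\<^sub>F n in sequentially. dist (L (L' x)) x < e"
      proof eventually_elim
        case (elim n)
        then show ?case
          using HX[of n] dist_triangle_less_add[of "L (L' x)" "L (H' n x)" "e/2" x "e/2"]
          by (metis dist_commute field_sum_of_halves)
      qed
      then show ?thesis by simp
    qed
    then show ?thesis by (metis dist_self dist_pos_lt less_irrefl)
  qed
  have "K (K' x) = x" "K' (K x) = x" if "x \<in> X" for x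
    using inv[OF K K' cont(1) that KX(2)[OF that] GD(4)[OF that] GD(5)[OF that]]
      inv[OF K' K cont(2) that KX(1)[OF that] GD(3)[OF that] GD(6)[OF that]] by auto
  then have "homeomorphism X X K K'" by (intro homeomorphismI cont) (use KX in auto)
  moreover have "uniform_limit X (\<lambda>n x. G' n (K x)) (\<lambda>x. x) sequentially"
  proof -
    have "uniform_limit X (\<lambda>n x. G' n (K x)) (\<lambda>x. K' (K x)) sequentially"
      by (rule uniform_limit_compose'[OF K']) (use KX in auto)
    then show ?thesis
      by (rule uniform_limit_cong'[THEN iffD1, rotated -1]) (use \<open>\<And>x. x \<in> X \<Longrightarrow> K' (K x) = x\<close> in auto)
  qed
  ultimately show ?thesis using that hG K by blast
qed

section \<open>Homeomorphisms acting layer by layer\<close>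

context cylinder begin

text \<open>Layer \<open>n\<close> is \<open>[ptop n / 2, ptop n]\<close>. The ratio 4 makes
  multiplication by 4 carry each layer to the preceding one; the ratio 2 within a layer leaves gaps
  in which nothing moves.\<close>

definition ptop :: "nat \<Rightarrow> real" where "ptop n = (1/4)^(n+1)"

definition rescale :: "real \<Rightarrow> real \<Rightarrow> ('b \<times> real \<Rightarrow> 'b \<times> real) \<Rightarrow> 'b \<times> real \<Rightarrow> 'b \<times> real" where
  "rescale a b h p = (let q = h (fst p, (snd p - b) / (a - b)) in (fst q, b + (a - b) * snd q))"

definition layered :: "(nat \<Rightarrow> 'b \<times> real \<Rightarrow> 'b \<times> real) \<Rightarrow> 'b \<times> real \<Rightarrow> 'b \<times> real" where
  "layered h p = (if \<exists>n. ptop n / 2 \<le> snd p \<and> snd p \<le> ptop n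
     then let n = (THE n. ptop n / 2 \<le> snd p \<and> snd p \<le> ptop n) in rescale (ptop n) (ptop n / 2) (h n) p else p)"

text \<open>Fixing both ends makes the transplanted map match the identity on the two faces of a
  layer. Unlike for \<open>cyl_homeo\<close>, all heights strictly between may move.\<close>

definition end_fixing :: "('b \<times> real \<Rightarrow> 'b \<times> real) \<Rightarrow> ('b \<times> real \<Rightarrow> 'b \<times> real) \<Rightarrow> bool" where
  "end_fixing h h' \<longleftrightarrow> homeomorphism C C h h' \<and> (\<forall>x\<in>S. h (x, 0) = (x, 0) \<and> h (x, 1) = (x, 1))"

lemma end_fixingD:
  assumes "end_fixing h h'"
  shows "homeomorphism C C h h'" "continuous_on C h" "\<And>p. p \<in> C \<Longrightarrow> h p \<in> C"
    "\<And>p. p \<in> C \<Longrightarrow> h' (h p) = p" "\<And>p. p \<in> C \<Longrightarrow> h (h' p) = p"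
    "\<And>x. x \<in> S \<Longrightarrow> h (x, 0) = (x, 0)" "\<And>x. x \<in> S \<Longrightarrow> h (x, 1) = (x, 1)"
  using assms by (auto simp: end_fixing_def homeomorphism_def)

lemma end_fixing_sym: assumes "end_fixing h h'" shows "end_fixing h' h"
proof -
  have "h' (x, 0) = (x, 0)" "h' (x, 1) = (x, 1)" if "x \<in> S" for x
    using end_fixingD(4)[OF assms, of "(x, 0)"] end_fixingD(4)[OF assms, of "(x, 1)"]
      end_fixingD(6,7)[OF assms that] that by auto
  then show ?thesis
    using end_fixingD(1)[OF assms] by (auto simp: end_fixing_def intro: homeomorphism_symD)
qed

lemma ptop_pos: "0 < ptop n" by (simp add: ptop_def)

lemma ptop_less: "m < n \<Longrightarrow> ptop n < ptop m / 2"
proof (induction n)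
  case (Suc n)
  have "ptop (Suc n) < ptop n / 2" using ptop_pos[of n] by (simp add: ptop_def)
  then show ?case using Suc ptop_pos[of n] by (cases "m = n") auto
qed simp

lemma ptop_le: "ptop n \<le> 1/4" using ptop_less[of 0 n] by (cases n) (auto simp: ptop_def)

lemma ptop_lim: "ptop \<longlonglongrightarrow> 0"
  unfolding ptop_def using LIMSEQ_Suc[OF LIMSEQ_realpow_zero[of "1/4"]] by simp

lemma ptop_unique:
  assumes "ptop n / 2 \<le> s" "s \<le> ptop n" "ptop m / 2 \<le> s" "s \<le> ptop m"
  shows "m = n"
  using ptop_less[of m n] ptop_less[of n m] assms by (cases m n rule: linorder_cases) auto

lemma layered_in:
  assumes "ptop n / 2 \<le> snd p" "snd p \<le> ptop n"
  shows "layered h p = rescale (ptop n) (ptop n / 2) (h n) p"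
proof -
  have "(THE n. ptop n / 2 \<le> snd p \<and> snd p \<le> ptop n) = n"
    using assms ptop_unique by (intro the_equality) auto
  then show ?thesis using assms by (auto simp: layered_def)
qed

lemma layered_out: "(\<And>n. \<not> (ptop n / 2 \<le> snd p \<and> snd p \<le> ptop n)) \<Longrightarrow> layered h p = p"
  unfolding layered_def by (subst if_not_P) auto

lemma rescale_mem:
  assumes "p \<in> C" "b \<le> snd p" "snd p \<le> a" "b < a"
  shows "(fst p, (snd p - b) / (a - b)) \<in> C"
  using assms C_fst[OF assms(1)] by simp

lemma rescale_range:
  assumes "end_fixing h h'" "p \<in> C" "b \<le> snd p" "snd p \<le> a" "b < a" "0 \<le> b" "a \<le> 1"
  shows "rescale a b h p \<in> C" "b \<le> snd (rescale a b h p)" "snd (rescale a b h p) \<le> a"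
proof -
  let ?q = "h (fst p, (snd p - b) / (a - b))"
  have q: "?q \<in> C" by (rule end_fixingD(3)[OF assms(1) rescale_mem[OF assms(2-5)]])
  have "0 \<le> (a - b) * snd ?q" "(a - b) * snd ?q \<le> (a - b) * 1"
    using C_snd[OF q] assms(5) by (auto simp del: mult_1_right intro!: mult_left_mono)
  then show "rescale a b h p \<in> C" "b \<le> snd (rescale a b h p)" "snd (rescale a b h p) \<le> a"
    using C_fst[OF q] assms(6,7) by (auto simp: rescale_def Let_def)
qed

lemma rescale_rescale:
  assumes "b < a"
  shows "rescale a b h (rescale a b k p) = rescale a b (h \<circ> k) p"
  using assms by (simp add: rescale_def Let_def)

lemma rescale_id: "b < a \<Longrightarrow> rescale a b (\<lambda>p. p) p = p"
  by (cases p) (simp add: rescale_def Let_def)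

lemma layered_comp:
  assumes "\<And>n. end_fixing (k n) (k' n)" "p \<in> C"
  shows "layered h (layered k p) = layered (\<lambda>n. h n \<circ> k n) p"
proof (cases "\<exists>n. ptop n / 2 \<le> snd p \<and> snd p \<le> ptop n")
  case True
  then obtain n where n: "ptop n / 2 \<le> snd p" "snd p \<le> ptop n" by blast
  have "ptop n / 2 < ptop n" "0 \<le> ptop n / 2" "ptop n \<le> 1" using ptop_pos[of n] ptop_le[of n] by auto
  from rescale_range[OF assms(1)[of n] assms(2) n this] rescale_rescale[OF this(1)]
  show ?thesis by (simp add: layered_in[OF n] layered_in[of n "rescale (ptop n) (ptop n / 2) (k n) p"])
qed (simp add: layered_out)

lemma layered_id: "layered (\<lambda>n p. p) p = p"
proof (cases "\<exists>n. ptop n / 2 \<le> snd p \<and> snd p \<le> ptop n")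
  case True
  then obtain n where "ptop n / 2 \<le> snd p" "snd p \<le> ptop n" by blast
  from layered_in[OF this] show ?thesis using rescale_id[of "ptop n / 2" "ptop n" p] ptop_pos[of n] by simp
qed (simp add: layered_out)

lemma layered_cong:
  assumes "\<And>n q. q \<in> C \<Longrightarrow> h n q = k n q" "p \<in> C"
  shows "layered h p = layered k p"
proof (cases "\<exists>n. ptop n / 2 \<le> snd p \<and> snd p \<le> ptop n")
  case True
  then obtain n where n: "ptop n / 2 \<le> snd p" "snd p \<le> ptop n" by blast
  have "(fst p, (snd p - ptop n / 2) / (ptop n - ptop n / 2)) \<in> C"
    using rescale_mem[OF assms(2) n] ptop_pos[of n] by simp
  then show ?thesis by (simp add: layered_in[OF n] rescale_def assms(1))
qed (simp add: layered_out)

lemma layered_mem: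
  assumes "\<And>n. end_fixing (k n) (k' n)" "p \<in> C"
  shows "layered k p \<in> C"
proof (cases "\<exists>n. ptop n / 2 \<le> snd p \<and> snd p \<le> ptop n")
  case True
  then obtain n where n: "ptop n / 2 \<le> snd p" "snd p \<le> ptop n" by blast
  show ?thesis unfolding layered_in[OF n]
    by (rule rescale_range(1)[OF assms n]) (use ptop_pos[of n] ptop_le[of n] in auto)
qed (use assms in \<open>simp add: layered_out\<close>)

lemma continuous_rescale:
  assumes "continuous_on C h" "b < a"
  shows "continuous_on {p \<in> C. b \<le> snd p \<and> snd p \<le> a} (rescale a b h)"
proof -
  have "continuous_on {p \<in> C. b \<le> snd p \<and> snd p \<le> a} (\<lambda>p. h (fst p, (snd p - b) / (a - b)))"
    by (rule continuous_on_compose2[OF assms(1)])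
       (use assms(2) in \<open>auto intro!: continuous_intros rescale_mem simp del: mem_C\<close>)
  then show ?thesis unfolding rescale_def Let_def by (intro continuous_intros)
qed

text \<open>Layers are added one at a time by pasting along closed sets: only the slab of the new
  layer changes, and on its faces the new map is the identity.\<close>

lemma continuous_layered_finite:
  assumes "\<And>n. end_fixing (k n) (k' n)"
  shows "continuous_on C (layered (\<lambda>n. if n < N then k n else (\<lambda>p. p)))"
proof (induction N)
  case 0
  show ?case by (simp add: layered_id[abs_def])
next
  case (Suc N)
  let ?L = "\<lambda>N. layered (\<lambda>n. if n < N then k n else (\<lambda>p. p))"
  let ?A = "{p \<in> C. ptop N / 2 \<le> snd p \<and> snd p \<le> ptop N}"
  let ?B = "{p \<in> C. snd p \<le> ptop N / 2 \<or> ptop N \<le> snd p}"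
  have clC: "closed C" by (rule compact_imp_closed[OF compact_C])
  have cl: "closed ?A" "closed ?B"
  proof -
    have "?A = C \<inter> (snd -` {ptop N / 2..ptop N})" "?B = C \<inter> (snd -` {..ptop N / 2} \<union> snd -` {ptop N..})"
      by auto
    then show "closed ?A" "closed ?B"
      by (auto intro!: clC closed_Int closed_Un closed_vimage_snd simp del: vimage_Collect_eq)
  qed
  have eq: "?L (Suc N) p = ?L N p" if "p \<in> C" "\<not> (ptop N / 2 < snd p \<and> snd p < ptop N)" for p
  proof (cases "\<exists>n. ptop n / 2 \<le> snd p \<and> snd p \<le> ptop n")
    case True
    then obtain n where n: "ptop n / 2 \<le> snd p" "snd p \<le> ptop n" by blast
    show ?thesis
    proof (cases "n = N")
      case True
      then have "snd p = ptop N / 2 \<or> snd p = ptop N" using n that(2) by auto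
      then show ?thesis
        using end_fixingD(6,7)[OF assms C_fst[OF that(1)]] ptop_pos[of N] True
        by (auto simp: layered_in[OF n] rescale_def Let_def prod_eq_iff)
    qed (auto simp: layered_in[OF n])
  qed (simp add: layered_out)
  have "continuous_on ?A (?L (Suc N))"
    by (rule continuous_on_eq[OF continuous_rescale[OF end_fixingD(2)[OF assms[of N]], of "ptop N / 2" "ptop N"]])
       (use ptop_pos[of N] in \<open>auto simp: layered_in[of N]\<close>)
  moreover have "continuous_on ?B (?L (Suc N))"
    by (rule continuous_on_eq[OF continuous_on_subset[OF Suc]]) (use eq in auto)
  ultimately have "continuous_on (?A \<union> ?B) (?L (Suc N))"
    by (rule continuous_on_closed_Un[OF cl])
  moreover have "?A \<union> ?B = C" by auto
  ultimately show ?case by metis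
qed

text \<open>The layers accumulate at the bottom, so the map is taken as a uniform limit of
  truncations. Vertically a point stays in its layer, whose thinness bounds the error; horizontally
  nothing is compressed, which is where \<open>k n\<close> has to tend to the identity.\<close>

lemma continuous_layered:
  assumes k: "\<And>n. end_fixing (k n) (k' n)" and lim: "uniform_limit C k (\<lambda>p. p) sequentially"
  shows "continuous_on C (layered k)"
proof (rule uniform_limit_theorem[where F=sequentially])
  show "\<forall>\<^sub>F N in sequentially. continuous_on C (layered (\<lambda>n. if n < N then k n else (\<lambda>p. p)))"
    using continuous_layered_finite[OF k] by simp
  show "uniform_limit C (\<lambda>N. layered (\<lambda>n. if n < N then k n else (\<lambda>p. p))) (layered k) sequentially"
  proof (rule uniform_limitI)
    fix e :: real assume "e > 0"
    have "\<forall>\<^sub>F n in sequentially. \<forall>p\<in>C. dist (k n p) p < e/2"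
      using uniform_limitD[OF lim, of "e/2"] \<open>e > 0\<close> by simp
    moreover have "\<forall>\<^sub>F n in sequentially. ptop n < e/2"
      using order_tendstoD(2)[OF ptop_lim, of "e/2"] \<open>e > 0\<close> by simp
    ultimately have "\<forall>\<^sub>F n in sequentially. (\<forall>p\<in>C. dist (k n p) p < e/2) \<and> ptop n < e/2"
      by (rule eventually_conj)
    then obtain N0 where N0: "\<And>n. n \<ge> N0 \<Longrightarrow> (\<forall>p\<in>C. dist (k n p) p < e/2) \<and> ptop n < e/2"
      unfolding eventually_sequentially by blast
    have "dist (layered (\<lambda>n. if n < N then k n else (\<lambda>p. p)) p) (layered k p) < e"
      if "N \<ge> N0" "p \<in> C" for N p
    proof (cases "\<exists>n. ptop n / 2 \<le> snd p \<and> snd p \<le> ptop n")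
      case True
      then obtain n where n: "ptop n / 2 \<le> snd p" "snd p \<le> ptop n" by blast
      show ?thesis
      proof (cases "n < N")
        case False
        let ?q = "(fst p, (snd p - ptop n / 2) / (ptop n - ptop n / 2))"
        let ?r = "rescale (ptop n) (ptop n / 2) (k n) p"
        have q: "?q \<in> C" using rescale_mem[OF that(2) n] ptop_pos[of n] by simp
        have "dist (fst (k n ?q)) (fst ?q) < e/2"
          using N0[of n] False that(1) q dist_fst_le[of "k n ?q" ?q] by fastforce
        then have 1: "dist (fst ?r) (fst p) < e/2" by (simp add: rescale_def Let_def)
        have "ptop n / 2 \<le> snd ?r" "snd ?r \<le> ptop n"
          using rescale_range(2,3)[OF k[of n] that(2) n] ptop_pos[of n] ptop_le[of n] by auto
        then have 2: "dist (snd ?r) (snd p) < e/2"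
          using n N0[of n] False that(1) ptop_pos[of n] unfolding dist_real_def by linarith
        have "dist ?r p \<le> dist (fst ?r) (fst p) + dist (snd ?r) (snd p)"
          by (simp add: dist_prod_def sqrt_sum_squares_le_sum)
        then have "dist ?r p < e" using 1 2 by linarith
        moreover have "rescale (ptop n) (ptop n / 2) (\<lambda>p. p) p = p"
          using rescale_id ptop_pos[of n] by simp
        ultimately show ?thesis using False by (simp add: layered_in[OF n] dist_commute)
      qed (use \<open>e > 0\<close> in \<open>simp add: layered_in[OF n]\<close>)
    qed (use \<open>e > 0\<close> in \<open>simp add: layered_out\<close>)
    then show "\<forall>\<^sub>F N in sequentially. \<forall>p\<in>C. dist (layered (\<lambda>n. if n < N then k n else (\<lambda>p. p)) p) (layered k p) < e"
      unfolding eventually_sequentially by blast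
  qed
qed simp

lemma cyl_homeo_layered:
  assumes k: "\<And>n. end_fixing (k n) (k' n)" and lim: "uniform_limit C k (\<lambda>p. p) sequentially"
  shows "cyl_homeo (layered k) (layered k')"
proof -
  have k': "end_fixing (k' n) (k n)" for n by (rule end_fixing_sym[OF k])
  have "uniform_limit C k' (\<lambda>p. p) sequentially"
  proof (rule uniform_limitI)
    fix e :: real assume "e > 0"
    from uniform_limitD[OF lim this]
    show "\<forall>\<^sub>F n in sequentially. \<forall>p\<in>C. dist (k' n p) p < e"
      by (rule eventually_mono) (metis end_fixingD(3,5)[OF k] end_fixingD(3)[OF k'] dist_commute)
  qed
  from continuous_layered[OF k' this] continuous_layered[OF k lim]
  have c: "continuous_on C (layered k)" "continuous_on C (layered k')" by auto
  have inv: "layered k' (layered k p) = p" "layered k (layered k' p) = p" if "p \<in> C" for p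
  proof -
    have "layered k' (layered k p) = layered (\<lambda>n p. p) p" "layered k (layered k' p) = layered (\<lambda>n p. p) p"
      unfolding layered_comp[OF k that] layered_comp[OF k' that]
      by (rule layered_cong[OF _ that], use end_fixingD(4,5)[OF k] in simp)+
    then show "layered k' (layered k p) = p" "layered k (layered k' p) = p" by (simp_all add: layered_id)
  qed
  have "homeomorphism C C (layered k) (layered k')"
    by (intro homeomorphismI c) (use layered_mem[OF k] layered_mem[OF k'] inv in auto)
  moreover have "layered k (x, s) = (x, s)" if "s = 0 \<or> s \<in> {1/2..1}" for x s
  proof (rule layered_out)
    show "\<not> (ptop n / 2 \<le> snd (x, s) \<and> snd (x, s) \<le> ptop n)" for n
      using that ptop_pos[of n] ptop_le[of n] by auto
  qed
  ultimately show ?thesis unfolding cyl_homeo_def by simp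
qed

text \<open>Dividing the total product \<open>K\<close> by the partial product \<open>G n\<close>
  gives the tail \<open>H n\<close> from \<open>k n\<close> on, without a separate limit for each
  tail. Conjugation by \<open>\<phi>\<close> brings the inverse tail of layer \<open>Suc n\<close>
  to layer \<open>n\<close>, where the product of the two leaves \<open>k n\<close>.\<close>

lemma layered_commutator:
  assumes \<phi>: "cyl_homeo \<phi> \<phi>'" "\<And>p. p \<in> C \<Longrightarrow> snd p \<le> 1/16 \<Longrightarrow> \<phi> p = (fst p, 4 * snd p)"
    and k: "\<And>n. end_fixing (k n) (k' n)"
    and G: "\<And>x. x \<in> C \<Longrightarrow> G 0 x = x" "\<And>n x. x \<in> C \<Longrightarrow> G (Suc n) x = G n (k n x)"
    and small: "\<And>n x. x \<in> C \<Longrightarrow> dist (G n (k n x)) (G n x) \<le> (1/2)^n"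
      "\<And>n x. x \<in> C \<Longrightarrow> dist (k n x) x \<le> (1/2)^n"
  shows "\<exists>F F'. cyl_homeo F F' \<and> germ_eq (layered k) (F \<circ> \<phi> \<circ> F' \<circ> \<phi>')"
proof -
  define G' where "G' = rec_nat (\<lambda>x. x) (\<lambda>n g x. k' n (g x))"
  have G': "G' 0 x = x" "G' (Suc n) x = k' n (G' n x)" for n x by (simp_all add: G'_def)
  obtain K K' where K: "homeomorphism C C K K'" and hG: "\<And>n. homeomorphism C C (G n) (G' n)"
    and lim: "uniform_limit C (\<lambda>n x. G' n (K x)) (\<lambda>x. x) sequentially"
    and limK: "uniform_limit C G K sequentially"
    using infinite_product_homeomorphism[OF compact_C end_fixingD(1)[OF k] G G' small] by blast
  have Gend: "G n (x, 0) = (x, 0) \<and> G n (x, 1) = (x, 1)" if "x \<in> S" for n x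
    using that by (induction n) (simp_all add: G end_fixingD(6,7)[OF k])
  have G'D: "p \<in> C \<Longrightarrow> G' n (G n p) = p" "p \<in> C \<Longrightarrow> G n (G' n p) = p" "p \<in> C \<Longrightarrow> G n p \<in> C" for n p
    using hG[of n] by (auto simp: homeomorphism_def)
  have KD: "p \<in> C \<Longrightarrow> K (K' p) = p" "p \<in> C \<Longrightarrow> K' p \<in> C" for p
    using K by (auto simp: homeomorphism_def)
  have Kend: "K (x, 0) = (x, 0)" "K (x, 1) = (x, 1)" if "x \<in> S" for x
    using tendsto_uniform_limitI[OF limK, of "(x, 0)"] tendsto_uniform_limitI[OF limK, of "(x, 1)"]
      Gend[OF that] that by (auto simp: LIMSEQ_const_iff)
  have G'end: "G' n (x, 0) = (x, 0)" "G' n (x, 1) = (x, 1)" if "x \<in> S" for n x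
    using G'D(1)[of "(x, 0)" n] G'D(1)[of "(x, 1)" n] Gend[OF that] that by auto
  define H where "H n = G' n \<circ> K" for n
  define H' where "H' n = K' \<circ> G n" for n
  have ef: "end_fixing (H n) (H' n)" for n
    unfolding H_def H'_def end_fixing_def
    using homeomorphism_compose[OF K homeomorphism_symD[OF hG[of n]]] Kend G'end by auto
  \<comment> \<open>\<open>K\<close> cancels against \<open>K'\<close>, and \<open>G (Suc n)\<close>
    differs from \<open>G n\<close> by the single factor \<open>k n\<close>.\<close>
  have HH': "H n (H' (Suc n) q) = k n q" if "q \<in> C" for n q
    using that G'D[of "k n q" n] end_fixingD(3)[OF k that, of n]
    by (simp add: H_def H'_def KD G G'D)
  have lim': "uniform_limit C H (\<lambda>p. p) sequentially" using lim by (simp add: H_def[abs_def] o_def)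
  have cyl_homeo: "cyl_homeo (layered H) (layered H')" by (rule cyl_homeo_layered[OF ef lim'])
  have "layered k p = (layered H \<circ> \<phi> \<circ> layered H' \<circ> \<phi>') p" if p: "p \<in> C" "snd p \<le> 1/16" for p
  proof -
    obtain x s where ps: "p = (x, s)" by fastforce
    have xs: "x \<in> S" "0 \<le> s" "s \<le> 1/16" using p ps by auto
    have \<phi>': "\<phi>' p = (x, s/4)"
      using \<phi>(2)[of "(x, s/4)"] cyl_homeoD(6)[OF \<phi>(1), of "(x, s/4)"] xs ps by simp
    have quarter: "ptop (Suc n) = ptop n / 4" for n by (simp add: ptop_def)
    show ?thesis
    proof (cases "\<exists>n. ptop n / 2 \<le> s \<and> s \<le> ptop n")
      case True
      then obtain n where n: "ptop n / 2 \<le> s" "s \<le> ptop n" by blast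
      have An: "0 < ptop n" "ptop n \<le> 1/4" using ptop_pos ptop_le by auto
      define q where "q = H' (Suc n) (x, (s - ptop n / 2) / (ptop n - ptop n / 2))"
      have "(s/4 - ptop (Suc n) / 2) / (ptop (Suc n) - ptop (Suc n) / 2) = (s - ptop n / 2) / (ptop n - ptop n / 2)"
        using An by (simp add: quarter field_simps)
      then have 1: "layered H' (x, s/4) = (fst q, (ptop n / 2 + ptop n / 2 * snd q) / 4)"
        using n layered_in[of "Suc n" "(x, s/4)" H'] by (simp add: rescale_def Let_def q_def quarter field_simps)
      have qC: "q \<in> C" unfolding q_def
        by (rule end_fixingD(3)[OF end_fixing_sym[OF ef]]) (use n An xs in \<open>simp add: field_simps\<close>)
      have "0 \<le> ptop n / 2 * snd q" "ptop n / 2 * snd q \<le> ptop n / 2"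
        using C_snd[OF qC] An by (auto simp: mult_left_le)
      moreover have bd: "0 \<le> (A + X) / 4 \<and> (A + X) / 4 \<le> 1/16"
        if "0 \<le> X" "X \<le> A" "A \<le> 1/8" for A X :: real using that by simp
      ultimately have "0 \<le> (ptop n / 2 + ptop n / 2 * snd q) / 4 \<and> (ptop n / 2 + ptop n / 2 * snd q) / 4 \<le> 1/16"
        using An by (intro bd) linarith+
      then have "\<phi> (layered H' (x, s/4)) = (fst q, ptop n / 2 + ptop n / 2 * snd q)"
        using \<phi>(2)[of "layered H' (x, s/4)"] C_fst[OF qC] order_trans[of "(ptop n / 2 + ptop n / 2 * snd q) / 4" "1/16" 1]
        unfolding 1 mem_C fst_conv snd_conv by simp
      also have "\<dots> = rescale (ptop n) (ptop n / 2) (H' (Suc n)) p"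
        unfolding rescale_def Let_def q_def ps by simp
      finally have 2: "\<phi> (layered H' (x, s/4)) = rescale (ptop n) (ptop n / 2) (H' (Suc n)) p" .
      have np: "ptop n / 2 \<le> snd p" "snd p \<le> ptop n" using n ps by auto
      have "layered H (rescale (ptop n) (ptop n / 2) (H' (Suc n)) p)
          = rescale (ptop n) (ptop n / 2) (H n) (rescale (ptop n) (ptop n / 2) (H' (Suc n)) p)"
        by (rule layered_in; rule rescale_range(2,3)[OF end_fixing_sym[OF ef] p(1) np]) (use An in auto)
      also have "\<dots> = rescale (ptop n) (ptop n / 2) (k n) p"
        using HH' rescale_mem[OF p(1) np] An by (simp add: rescale_rescale) (simp add: rescale_def Let_def)
      finally show ?thesis by (simp add: \<phi>' 2 layered_in[OF np])
    next
      case False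
      \<comment> \<open>A point between layers is sent by \<open>\<phi>'\<close> to a point between
        layers. Layer 0 is the shift of no other layer, but it begins at \<open>1/8\<close>, well
        above \<open>s/4\<close>.\<close>
      have "\<not> (ptop m / 2 \<le> s/4 \<and> s/4 \<le> ptop m)" for m
      proof
        assume m: "ptop m / 2 \<le> s/4 \<and> s/4 \<le> ptop m"
        then have "m \<noteq> 0" using xs by (cases m) (auto simp: ptop_def)
        then obtain j where "m = Suc j" using not0_implies_Suc by blast
        then show False using m False by (auto simp: quarter)
      qed
      then have "layered H' (x, s/4) = (x, s/4)" by (intro layered_out) auto
      moreover have "\<phi> (x, s/4) = p" using \<phi>(2)[of "(x, s/4)"] xs ps by simp
      moreover have "layered h p = p" for h using False ps by (intro layered_out) auto
      ultimately show ?thesis by (simp add: \<phi>')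
    qed
  qed
  then have "germ_eq (layered k) (layered H \<circ> \<phi> \<circ> layered H' \<circ> \<phi>')"
    unfolding germ_eq_def by (intro exI[of _ "1/16"]) auto
  then show ?thesis using cyl_homeo by blast
qed

section \<open>Transport of arbitrary slots to the standard layers\<close>

text \<open>This undoes \<open>rescale\<close>: \<open>b\<close> is the bottom and \<open>a\<close>
  the top of the slab that is blown up to the whole cylinder.\<close>

definition unscale :: "real \<Rightarrow> real \<Rightarrow> ('b \<times> real \<Rightarrow> 'b \<times> real) \<Rightarrow> 'b \<times> real \<Rightarrow> 'b \<times> real" where
  "unscale a b h p = (let q = h (fst p, b + (a - b) * snd p) in (fst q, (snd q - b) / (a - b)))"

lemma slot_mem:
  assumes "p \<in> C" "0 \<le> b" "b < a" "a \<le> 1"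
  shows "(fst p, b + (a - b) * snd p) \<in> C" "b \<le> b + (a - b) * snd p" "b + (a - b) * snd p \<le> a"
proof -
  have "0 \<le> (a - b) * snd p" "(a - b) * snd p \<le> a - b"
    using C_snd[OF assms(1)] assms(3) by (auto simp: mult_left_le)
  then have "0 \<le> b + (a - b) * snd p" "b + (a - b) * snd p \<le> a" "b + (a - b) * snd p \<le> 1"
    "b \<le> b + (a - b) * snd p" using assms by linarith+
  then show "(fst p, b + (a - b) * snd p) \<in> C" "b \<le> b + (a - b) * snd p" "b + (a - b) * snd p \<le> a"
    using assms C_fst[OF assms(1)] by auto
qed

text \<open>If the image of \<open>p\<close> lay outside the open slab, that image would be a fixed
  point, and by injectivity \<open>p\<close> itself would be this fixed point.\<close>

lemma slot_invariant:
  assumes "homeomorphism C C h h'" "\<And>p. p \<in> C \<Longrightarrow> snd p \<le> b \<or> a \<le> snd p \<Longrightarrow> h p = p"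
    and "p \<in> C" "b \<le> snd p" "snd p \<le> a"
  shows "b \<le> snd (h p)" "snd (h p) \<le> a"
proof -
  have h: "h p \<in> C" "\<And>q. q \<in> C \<Longrightarrow> h' (h q) = q" using assms(1,3) by (auto simp: homeomorphism_def)
  have "h p = p" if "snd (h p) \<le> b \<or> a \<le> snd (h p)"
    using assms(2)[OF h(1) that] h(2)[OF h(1)] h(2)[OF assms(3)] by simp
  then show "b \<le> snd (h p)" "snd (h p) \<le> a" using assms(4,5) by force+
qed

lemma end_fixing_unscale:
  assumes h: "homeomorphism C C h h'" and ab: "0 \<le> b" "b < a" "a \<le> 1"
    and fxd: "\<And>p. p \<in> C \<Longrightarrow> snd p \<le> b \<or> a \<le> snd p \<Longrightarrow> h p = p"
  shows "end_fixing (unscale a b h) (unscale a b h')"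
proof -
  have fxd': "h' p = p" if "p \<in> C" "snd p \<le> b \<or> a \<le> snd p" for p
    using fxd[OF that] h that(1) by (auto simp: homeomorphism_def)
  have main: "continuous_on C (unscale a b f)" "unscale a b f ` C \<subseteq> C"
      "\<And>p. p \<in> C \<Longrightarrow> unscale a b g (unscale a b f p) = p"
      "\<And>x. x \<in> S \<Longrightarrow> unscale a b f (x, 0) = (x, 0) \<and> unscale a b f (x, 1) = (x, 1)"
    if f: "homeomorphism C C f g" and fixf: "\<And>p. p \<in> C \<Longrightarrow> snd p \<le> b \<or> a \<le> snd p \<Longrightarrow> f p = p"
    for f g
  proof -
    have fD: "continuous_on C f" "\<And>p. p \<in> C \<Longrightarrow> f p \<in> C" "\<And>p. p \<in> C \<Longrightarrow> g (f p) = p"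
      using f by (auto simp: homeomorphism_def)
    have "continuous_on C (\<lambda>p. f (fst p, b + (a - b) * snd p))"
      by (rule continuous_on_compose2[OF fD(1)])
        (use slot_mem(1)[OF _ ab] in \<open>auto intro!: continuous_intros simp del: mem_C\<close>)
    then show "continuous_on C (unscale a b f)"
      unfolding unscale_def Let_def using ab by (intro continuous_intros) auto
    show "unscale a b f ` C \<subseteq> C"
    proof (rule image_subsetI)
      fix p assume p: "p \<in> C"
      let ?p = "(fst p, b + (a - b) * snd p)"
      have "b \<le> snd (f ?p)" "snd (f ?p) \<le> a"
        by (rule slot_invariant[OF f fixf slot_mem(1)[OF p ab]], use slot_mem(2,3)[OF p ab] in auto)+
      then show "unscale a b f p \<in> C"
        using rescale_mem[OF fD(2)[OF slot_mem(1)[OF p ab]] _ _ ab(2)] by (simp add: unscale_def Let_def)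
    qed
    show "unscale a b g (unscale a b f p) = p" if p: "p \<in> C" for p
    proof -
      have "b + (a - b) * ((snd (f (fst p, b + (a - b) * snd p)) - b) / (a - b)) = snd (f (fst p, b + (a - b) * snd p))"
        using ab by simp
      then show ?thesis
        using fD(3)[OF slot_mem(1)[OF p ab]] ab by (simp add: unscale_def Let_def)
    qed
    show "unscale a b f (x, 0) = (x, 0) \<and> unscale a b f (x, 1) = (x, 1)" if "x \<in> S" for x
      using fixf[of "(x, b)"] fixf[of "(x, a)"] that ab by (simp add: unscale_def Let_def)
  qed
  note 1 = main[OF h fxd] and 2 = main[OF homeomorphism_symD[OF h] fxd']
  show ?thesis unfolding end_fixing_def using 1 2 by (auto intro!: homeomorphismI)
qed

lemma sequence_bracket:
  fixes t :: "nat \<Rightarrow> real"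
  assumes "t \<longlonglongrightarrow> 0" "0 < s" "s \<le> t 0"
  obtains j where "t (Suc j) < s" "s \<le> t j"
proof -
  have "\<exists>k. t k < s"
    using order_tendstoD(2)[OF assms(1,2)] by (auto simp: eventually_sequentially)
  then obtain k where k: "t k < s" "\<And>j. j < k \<Longrightarrow> s \<le> t j"
    using LeastI_ex[of "\<lambda>k. t k < s"] not_less_Least[of _ "\<lambda>k. t k < s"] by (meson not_le)
  then have "k \<noteq> 0" using assms(3) by (metis not_less)
  then obtain j where "k = Suc j" using not0_implies_Suc by blast
  then show ?thesis using that k by auto
qed

text \<open>A change of height carries the slots \<open>[b n, a n]\<close> affinely onto the
  standard layers, where \<open>E\<close> becomes \<open>layered k\<close>. Undoing it conjugates
  the whole commutator; the conjugation turns up in \<open>F\<close> and in the conjugator of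
  \<open>\<phi>\<close>, while \<open>\<phi>\<close> itself stays the same.\<close>

lemma slots_commutator:
  fixes a b :: "nat \<Rightarrow> real"
  assumes \<phi>: "cyl_homeo \<phi> \<phi>'" "\<And>p. p \<in> C \<Longrightarrow> snd p \<le> 1/16 \<Longrightarrow> \<phi> p = (fst p, 4 * snd p)"
    and ab: "\<And>n. b n < a n" "\<And>n. a (Suc n) < b n" "a 0 < 1/2" "a \<longlonglongrightarrow> 0"
    and h: "\<And>n. homeomorphism C C (h n) (h' n)"
    and fxd: "\<And>n p. p \<in> C \<Longrightarrow> snd p \<le> b n \<or> a n \<le> snd p \<Longrightarrow> h n p = p"
    and G: "\<And>x. x \<in> C \<Longrightarrow> G 0 x = x"
      "\<And>n x. x \<in> C \<Longrightarrow> G (Suc n) x = G n (unscale (a n) (b n) (h n) x)"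
    and small: "\<And>n x. x \<in> C \<Longrightarrow> dist (G n (unscale (a n) (b n) (h n) x)) (G n x) \<le> (1/2)^n"
      "\<And>n x. x \<in> C \<Longrightarrow> dist (unscale (a n) (b n) (h n) x) x \<le> (1/2)^n"
    and E: "\<And>n p. p \<in> C \<Longrightarrow> b n \<le> snd p \<Longrightarrow> snd p \<le> a n \<Longrightarrow> E p = h n p"
      "\<And>p. p \<in> C \<Longrightarrow> (\<And>n. \<not> (b n \<le> snd p \<and> snd p \<le> a n)) \<Longrightarrow> E p = p"
  shows "\<exists>F F' T U. cyl_homeo F F' \<and> cyl_homeo T U \<and> germ_eq E (F \<circ> (T \<circ> \<phi> \<circ> U) \<circ> F' \<circ> (T \<circ> \<phi>' \<circ> U))"
proof -
  define k where "k n = unscale (a n) (b n) (h n)" for n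
  have dec_a: "decseq a" by (rule decseq_SucI) (use ab in \<open>meson less_imp_le less_trans\<close>)
  have apos: "0 \<le> a n" for n using dec_a ab(4) by (simp add: decseq_ge)
  have bpos: "0 < b n" for n using apos[of "Suc n"] ab(2)[of n] by linarith
  have ale: "a n < 1/2" for n using decseqD[OF dec_a, of 0 n] ab(3) by simp
  have ef: "end_fixing (k n) (unscale (a n) (b n) (h' n))" for n
    unfolding k_def by (rule end_fixing_unscale[OF h _ ab(1) _ fxd]) (use bpos[of n] ale[of n] in auto)
  \<comment> \<open>The ends of the slots in decreasing order:
    \<open>1/2, a 0, b 0, a 1, b 1, ...\<close>.\<close>
  define t where "t j = (if j = 0 then 1/2 else if odd j then a (j div 2) else b (j div 2 - 1))" for j
  have t_odd: "t (Suc (2 * n)) = a n" and t_even: "t (Suc (Suc (2 * n))) = b n" for n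
    by (simp_all add: t_def)
  \<comment> \<open>Powers of \<open>1/2\<close> list the ends of the standard layers in the same
    order: \<open>ptop n\<close> at index \<open>2 * n + 1\<close> and \<open>ptop n / 2\<close>
    right after it.\<close>
  define \<tau> :: "nat \<Rightarrow> real" where "\<tau> j = (1/2)^(j + 1)" for j
  have \<tau>_odd: "\<tau> (Suc (2 * n)) = ptop n" and \<tau>_even: "\<tau> (Suc (Suc (2 * n))) = ptop n / 2" for n
    by (simp_all add: \<tau>_def ptop_def power_mult power2_eq_square power_divide)
  have cs: "j = 0 \<or> (\<exists>n. j = Suc (2 * n)) \<or> (\<exists>n. j = Suc (Suc (2 * n)))" for j :: nat
  proof (cases j)
    case (Suc i)
    then show ?thesis by (cases "even i") (auto elim!: evenE oddE)
  qed simp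
  have tdec: "t (Suc j) < t j" for j
  proof -
    consider "j = 0" | n where "j = Suc (2 * n)" | n where "j = Suc (Suc (2 * n))" using cs[of j] by blast
    then show ?thesis
    proof cases
      case 1 then show ?thesis using t_odd[of 0] ab(3) by (simp add: t_def)
    next
      case (2 n) show ?thesis using ab(1)[of n] by (simp only: 2 t_odd t_even)
    next
      case (3 n) show ?thesis using ab(2)[of n] t_odd[of "Suc n"] by (simp only: 3 t_even mult_Suc_right add_2_eq_Suc)
    qed
  qed
  have t_pos: "0 \<le> t j" for j using apos bpos by (auto simp: t_def less_imp_le)
  have t_lim: "t \<longlonglongrightarrow> 0"
  proof (rule LIMSEQ_I)
    fix r :: real assume "0 < r"
    then obtain n where "a n < r" using order_tendstoD(2)[OF ab(4)] by (auto simp: eventually_sequentially)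
    moreover have "decseq t" by (rule decseq_SucI) (simp add: tdec less_imp_le)
    ultimately have "t j < r" if "j \<ge> Suc (2 * n)" for j
      using decseqD[OF \<open>decseq t\<close> that] t_odd[of n] by simp
    then show "\<exists>no. \<forall>j\<ge>no. norm (t j - 0) < r" using t_pos by auto
  qed
  obtain T U where TU: "homeomorphism {0..1} {0..1} T U" "T 0 = 0" "strict_mono_on {0..1} T"
    "\<And>s. s \<in> {1/2..1} \<Longrightarrow> T s = s"
    and aff: "\<And>k s. s \<in> {t (Suc k)..t k} \<Longrightarrow>
       T s = \<tau> (Suc k) + (\<tau> k - \<tau> (Suc k)) * ((s - t (Suc k)) / (t k - t (Suc k)))"
  proof (rule piecewise_affine_homeomorphism[of t \<tau>])
    show "\<tau> \<longlonglongrightarrow> 0" unfolding \<tau>_def using LIMSEQ_Suc[OF LIMSEQ_realpow_zero[of "1/2"]] by simp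
  qed (use tdec t_lim in \<open>auto simp: t_def \<tau>_def\<close>)
  have UT: "U (T s) = s" if "0 \<le> s" "s \<le> 1" for s
    using TU(1) that by (auto simp: homeomorphism_def)
  have GT: "cyl_homeo (level_map T) (level_map U)" by (rule cyl_homeo_level_map[OF TU(1,2,4)])
  \<comment> \<open>As \<open>T\<close> is affine on each slot, it conjugates the map of slot
    \<open>n\<close> to exactly the rescaled \<open>k n\<close>, without distortion.\<close>
  have lift: "level_map U (layered k (level_map T p)) = E p" if p: "p \<in> C" "snd p < a 0" for p
  proof -
    obtain x s where ps: "p = (x, s)" by fastforce
    have xs: "x \<in> S" "0 \<le> s" "s < a 0" "s \<le> 1" using p ps C_snd[OF p(1)] by auto
    show ?thesis
    proof (cases "\<exists>n. b n \<le> s \<and> s \<le> a n")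
      case True
      then obtain n where n: "b n \<le> s" "s \<le> a n" by blast
      define w where "w = (s - b n) / (a n - b n)"
      have w: "0 \<le> w" "w \<le> 1" "s = b n + (a n - b n) * w" using n ab(1)[of n] by (auto simp: w_def)
      have aff': "T (b n + (a n - b n) * v) = ptop n / 2 + ptop n / 2 * v" if "0 \<le> v" "v \<le> 1" for v
      proof -
        have "0 \<le> (a n - b n) * v" "(a n - b n) * v \<le> a n - b n"
          using ab(1)[of n] that by (auto simp: mult_left_le)
        then have "b n \<le> b n + (a n - b n) * v" "b n + (a n - b n) * v \<le> a n" by linarith+
        then show ?thesis
          using aff[of "b n + (a n - b n) * v" "Suc (2 * n)"] ab(1)[of n]
          by (simp add: t_odd t_even \<tau>_odd \<tau>_even)
      qed
      have Ts: "T s = ptop n / 2 + ptop n / 2 * w" using aff'[OF w(1,2)] w(3) by simp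
      have "0 \<le> ptop n * w" "ptop n * w \<le> ptop n" using w ptop_pos[of n] by (auto simp: mult_left_le)
      then have "layered k (x, T s) = rescale (ptop n) (ptop n / 2) (k n) (x, T s)"
        by (intro layered_in) (auto simp: Ts)
      also have "\<dots> = (fst (k n (x, w)), ptop n / 2 + ptop n / 2 * snd (k n (x, w)))"
        using ptop_pos[of n] by (simp add: rescale_def Let_def Ts)
      finally have 1: "layered k (x, T s) = (fst (k n (x, w)), ptop n / 2 + ptop n / 2 * snd (k n (x, w)))" .
      have kC: "k n (x, w) \<in> C" using end_fixingD(3)[OF ef] xs w by simp
      have kx: "k n (x, w) = (fst (h n p), (snd (h n p) - b n) / (a n - b n))"
        by (simp add: k_def unscale_def Let_def w(3)[symmetric] ps)
      have hs: "snd (h n p) = b n + (a n - b n) * snd (k n (x, w))"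
        unfolding kx using ab(1)[of n] by simp
      have hC: "h n p \<in> C" using h[of n] p(1) by (auto simp: homeomorphism_def)
      have "ptop n / 2 + ptop n / 2 * snd (k n (x, w)) = T (snd (h n p))"
        unfolding hs by (rule aff'[symmetric]) (use C_snd[OF kC] in auto)
      then have "level_map U (layered k (level_map T p)) = (fst (h n p), snd (h n p))"
        using C_snd[OF hC] by (simp add: level_map_def ps 1 UT) (simp add: kx ps)
      then show ?thesis using E(1)[OF p(1), of n] n ps by simp
    next
      case False
      \<comment> \<open>Strict monotonicity of \<open>T\<close> keeps points between slots between
        layers.\<close>
      have out: "layered k (x, T s) = (x, T s)"
      proof (rule layered_out)
        fix m show "\<not> (ptop m / 2 \<le> snd (x, T s) \<and> snd (x, T s) \<le> ptop m)"
        proof (cases "s < b m")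
          case True
          then have "T s < T (b m)"
            using TU(3) xs ale[of m] ab(1)[of m] by (auto simp: strict_mono_on_def)
          also have "T (b m) = ptop m / 2"
            using aff[of "b m" "Suc (2 * m)"] ab(1)[of m] by (simp add: t_odd t_even \<tau>_odd \<tau>_even)
          finally show ?thesis by simp
        next
          case 2: False
          then have "a m < s" using False by (meson not_less)
          then have "T (a m) < T s"
            using TU(3) xs ale[of m] apos[of m] by (auto simp: strict_mono_on_def)
          moreover have "T (a m) = ptop m"
            using aff[of "a m" "Suc (2 * m)"] ab(1)[of m] by (simp add: t_odd t_even \<tau>_odd \<tau>_even)
          ultimately show ?thesis by simp
        qed
      qed
      have "E p = p" using E(2)[OF p(1)] False ps by auto
      then show ?thesis using xs by (simp add: level_map_def ps out UT)
    qed
  qed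
  obtain F F' where F: "cyl_homeo F F'" and Fk: "germ_eq (layered k) (F \<circ> \<phi> \<circ> F' \<circ> \<phi>')"
  proof -
    have "\<exists>F F'. cyl_homeo F F' \<and> germ_eq (layered k) (F \<circ> \<phi> \<circ> F' \<circ> \<phi>')"
      by (rule layered_commutator[OF \<phi> ef, where G=G]) (use G small in \<open>simp_all add: k_def\<close>)
    then show ?thesis using that by blast
  qed
  have "germ_eq E (level_map U \<circ> layered k \<circ> level_map T)"
    unfolding germ_eq_def using lift bpos[of 0] ab(1)[of 0]
    by (intro exI[of _ "a 0 / 2"]) (auto simp: field_simps)
  moreover have "germ_eq (level_map U \<circ> layered k \<circ> level_map T) (level_map U \<circ> (F \<circ> \<phi> \<circ> F' \<circ> \<phi>') \<circ> level_map T)"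
  proof -
    have "cyl_homeo (F \<circ> \<phi> \<circ> F' \<circ> \<phi>') (\<phi> \<circ> (F \<circ> (\<phi>' \<circ> F')))"
      by (intro cyl_homeo_comp F \<phi>(1) cyl_homeo_sym[OF F] cyl_homeo_sym[OF \<phi>(1)])
    from germ_eq_comp[OF germ_eq_refl Fk this] show ?thesis
      by (intro germ_eq_comp[OF _ germ_eq_refl GT])
  qed
  moreover have "germ_eq (level_map U \<circ> (F \<circ> \<phi> \<circ> F' \<circ> \<phi>') \<circ> level_map T)
     ((level_map U \<circ> F \<circ> level_map T) \<circ> (level_map U \<circ> \<phi> \<circ> level_map T) \<circ> (level_map U \<circ> F' \<circ> level_map T) \<circ> (level_map U \<circ> \<phi>' \<circ> level_map T))"
    unfolding germ_eq_def
    by (intro exI[of _ 1])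
       (auto simp: cyl_homeoD(7)[OF GT] cyl_homeoD(4)[OF GT] cyl_homeoD(4,5)[OF \<phi>(1)] cyl_homeoD(5)[OF F])
  moreover have "cyl_homeo (level_map U \<circ> F \<circ> level_map T) (level_map U \<circ> F' \<circ> level_map T)"
    using cyl_homeo_comp[OF cyl_homeo_comp[OF cyl_homeo_sym[OF GT] F] GT] by (simp add: o_assoc)
  ultimately show ?thesis using cyl_homeo_sym[OF GT] germ_eq_trans by blast
qed

end

section \<open>Cutting off and the odd-even decomposition\<close>

context cylinder begin

text \<open>The vertical bound is relative to the height, so that it survives the blow-up of a slot
  lying arbitrarily low.\<close>

definition near :: "real \<Rightarrow> real \<Rightarrow> ('b \<times> real \<Rightarrow> 'b \<times> real) \<Rightarrow> bool" where
  "near \<eta> d f \<longleftrightarrow> (\<forall>p\<in>C. snd p \<le> d \<longrightarrow> dist (fst (f p)) (fst p) \<le> \<eta> \<and> \<bar>snd (f p) - snd p\<bar> \<le> \<eta> * snd p)"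

text \<open>In general a germ acquires this property only after a change of height, see
  \<open>nice_conjugate\<close>.\<close>

definition nice :: "('b \<times> real \<Rightarrow> 'b \<times> real) \<Rightarrow> bool" where
  "nice f \<longleftrightarrow> (\<forall>\<eta>>0. \<exists>d>0. near \<eta> d f)"

text \<open>\<open>raise e\<close> compresses \<open>[0, e]\<close> onto \<open>[e/2, e]\<close>; \<open>sink e\<close> is its left inverse, collapsing \<open>[0, e/2]\<close>.\<close>

definition raise :: "real \<Rightarrow> real \<Rightarrow> real" where "raise e s = max s ((s + e) / 2)"
definition sink :: "real \<Rightarrow> real \<Rightarrow> real" where "sink e s = max 0 (min s (2 * s - e))"

text \<open>The separate branch is there because \<open>sink e\<close> is not injective on
  \<open>[0, e/2]\<close>. The branches agree at height \<open>e/2\<close>, which is collapsed to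
  the bottom, where \<open>f\<close> is the identity.\<close>

definition cut :: "('b \<times> real \<Rightarrow> 'b \<times> real) \<Rightarrow> real \<Rightarrow> 'b \<times> real \<Rightarrow> 'b \<times> real" where
  "cut f e p = (if snd p \<le> e/2 then p
     else let q = f (fst p, sink e (snd p)) in (fst q, raise e (snd q)))"

lemma nearD:
  assumes "near \<eta> d f" "p \<in> C" "snd p \<le> d"
  shows "dist (fst (f p)) (fst p) \<le> \<eta>" "\<bar>snd (f p) - snd p\<bar> \<le> \<eta> * snd p"
  using assms by (auto simp: near_def)

lemma near_mono: "near \<eta> d f \<Longrightarrow> \<eta> \<le> \<eta>' \<Longrightarrow> d' \<le> d \<Longrightarrow> near \<eta>' d' f"
  unfolding near_def by (meson C_snd mult_right_mono order_trans)

text \<open>Since \<open>\<eta>' \<le> 1\<close>, the inner map at most doubles a height; hence the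
  factor 2 in front of \<open>\<eta>\<close> and the halved range \<open>d/2\<close>.\<close>

lemma near_comp:
  assumes f: "near \<eta> d f" and g: "near \<eta>' d' g" and gC: "\<And>p. p \<in> C \<Longrightarrow> g p \<in> C"
    and \<eta>: "0 \<le> \<eta>" "\<eta>' \<le> 1" and d: "e \<le> d/2" "e \<le> d'"
  shows "near (2 * \<eta> + \<eta>') e (f \<circ> g)"
  unfolding near_def
proof (intro ballI impI)
  fix p assume p: "p \<in> C" "snd p \<le> e"
  note s = C_snd[OF p(1)]
  have 1: "dist (fst (g p)) (fst p) \<le> \<eta>'" "\<bar>snd (g p) - snd p\<bar> \<le> \<eta>' * snd p"
    using nearD[OF g p(1)] p(2) d by auto
  have "\<eta>' * snd p \<le> snd p" using s \<eta> by (simp add: mult_left_le_one_le mult_right_le_one_le mult_le_cancel_right2)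
  then have 2: "snd (g p) \<le> 2 * snd p" using 1(2) by linarith
  then have "snd (g p) \<le> d" using p(2) d(1) by linarith
  from nearD[OF f gC[OF p(1)] this]
  have 3: "dist (fst (f (g p))) (fst (g p)) \<le> \<eta>" "\<bar>snd (f (g p)) - snd (g p)\<bar> \<le> \<eta> * snd (g p)" .
  have "\<eta> * snd (g p) \<le> \<eta> * (2 * snd p)" using 2 \<eta>(1) by (rule mult_left_mono)
  then have "\<bar>snd (f (g p)) - snd p\<bar> \<le> (2 * \<eta> + \<eta>') * snd p"
    using 3(2) 1(2) by (simp add: algebra_simps)
  moreover have "dist (fst (f (g p))) (fst p) \<le> 2 * \<eta> + \<eta>'"
    using 3(1) 1(1) \<eta>(1) dist_triangle[of "fst (f (g p))" "fst p" "fst (g p)"] by linarith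
  ultimately show "dist (fst ((f \<circ> g) p)) (fst p) \<le> 2 * \<eta> + \<eta>' \<and>
      \<bar>snd ((f \<circ> g) p) - snd p\<bar> \<le> (2 * \<eta> + \<eta>') * snd p" by simp
qed

lemma raise_sink: "0 \<le> s \<Longrightarrow> e/2 \<le> s \<Longrightarrow> raise e (sink e s) = s"
  and sink_raise: "0 \<le> s \<Longrightarrow> sink e (raise e s) = s"
  and sink_bounds: "0 \<le> s \<Longrightarrow> 0 \<le> e \<Longrightarrow> 0 \<le> sink e s \<and> sink e s \<le> s"
  and sink_pos: "e/2 < s \<Longrightarrow> 0 < s \<Longrightarrow> 0 < sink e s"
  and raise_gt: "0 < s \<Longrightarrow> e/2 < raise e s"
  and raise_le: "s \<le> 1 \<Longrightarrow> e \<le> 1 \<Longrightarrow> raise e s \<le> 1"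
  and raise_nonneg: "0 \<le> s \<Longrightarrow> 0 \<le> raise e s"
  and raise_diff: "\<bar>raise e s - raise e s'\<bar> \<le> \<bar>s - s'\<bar>"
  and sink_id: "e \<le> s \<Longrightarrow> 0 \<le> s \<Longrightarrow> sink e s = s"
  and raise_id: "e \<le> s \<Longrightarrow> raise e s = s"
  by (auto simp: raise_def sink_def max_def min_def field_simps abs_if split: if_splits)

lemma sink_mem: "p \<in> C \<Longrightarrow> 0 \<le> e \<Longrightarrow> (fst p, sink e (snd p)) \<in> C"
  using C_fst[of p] C_snd[of p] sink_bounds[of "snd p" e] by auto

lemma cyl_homeo_snd_pos:
  assumes "cyl_homeo f g" "p \<in> C" "0 < snd p"
  shows "0 < snd (f p)"
proof (rule ccontr)
  assume "\<not> 0 < snd (f p)"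
  then have 0: "f p = (fst (f p), 0)" using C_snd[OF cyl_homeoD(4)[OF assms(1,2)]] by (simp add: prod_eq_iff)
  then have "g (f p) = f p"
    using cyl_homeoD(8)[OF cyl_homeo_sym[OF assms(1)] C_fst[OF cyl_homeoD(4)[OF assms(1,2)]]] by metis
  then show False using cyl_homeoD(6)[OF assms(1,2)] 0 assms(3) by (metis snd_conv less_irrefl)
qed

lemma cut_mem:
  assumes "cyl_homeo f g" "p \<in> C" "0 \<le> e" "e \<le> 1"
  shows "cut f e p \<in> C"
  using cyl_homeoD(4)[OF assms(1) sink_mem[OF assms(2,3)]] assms(2,4)
    C_fst C_snd raise_le raise_nonneg by (simp add: cut_def Let_def)

text \<open>Above \<open>e/2\<close> the lowered point has positive height, so has its image, and
  \<open>raise e\<close> returns it strictly above \<open>e/2\<close>; thus the second cut takes the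
  same branch as the one before.\<close>

lemma cut_cut:
  assumes f: "cyl_homeo f g" and p: "p \<in> C" and e: "0 \<le> e"
  shows "cut g e (cut f e p) = p"
proof (cases "snd p \<le> e/2")
  case False
  let ?q = "f (fst p, sink e (snd p))"
  have d: "(fst p, sink e (snd p)) \<in> C" by (rule sink_mem[OF p e])
  have pos: "0 < snd ?q"
    using cyl_homeo_snd_pos[OF f d] sink_pos[of e "snd p"] False e by simp
  have "cut f e p = (fst ?q, raise e (snd ?q))" using False by (simp add: cut_def Let_def)
  then have "cut g e (cut f e p) = (fst (g ?q), raise e (snd (g ?q)))"
    using raise_gt[OF pos, of e] pos by (simp add: cut_def Let_def sink_raise)
  then show ?thesis using False by (simp add: cyl_homeoD(6)[OF f d] raise_sink C_snd[OF p])
qed (simp add: cut_def)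

lemma continuous_cut:
  assumes f: "cyl_homeo f g" and e: "0 \<le> e"
  shows "continuous_on C (cut f e)"
proof -
  let ?h = "\<lambda>p. let q = f (fst p, sink e (snd p)) in (fst q, raise e (snd q))"
  have cC: "closed C" by (rule compact_imp_closed[OF compact_C])
  have "continuous_on C (\<lambda>p. f (fst p, sink e (snd p)))"
    by (rule continuous_on_compose2[OF cyl_homeoD(2)[OF f]])
      (use sink_mem[OF _ e] in \<open>auto simp: sink_def intro!: continuous_intros simp del: mem_C\<close>)
  then have ch: "continuous_on C ?h" unfolding Let_def raise_def by (intro continuous_intros) auto
  have "continuous_on ({p\<in>C. snd p \<le> e/2} \<union> {p\<in>C. e/2 \<le> snd p}) (\<lambda>p. if snd p \<le> e/2 then p else ?h p)"
  proof (rule continuous_on_If)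
    have "{p\<in>C. snd p \<le> e/2} = C \<inter> snd -` {..e/2}" "{p\<in>C. e/2 \<le> snd p} = C \<inter> snd -` {e/2..}" by auto
    then show "closed {p\<in>C. snd p \<le> e/2}" "closed {p\<in>C. e/2 \<le> snd p}"
      by (auto intro!: closed_Int cC closed_vimage_snd)
    show "continuous_on {p\<in>C. e/2 \<le> snd p} ?h" by (rule continuous_on_subset[OF ch]) auto
    show "p = ?h p" if "p \<in> {p\<in>C. snd p \<le> e/2}" "\<not> snd p \<le> e/2" for p using that by auto
    show "p = ?h p" if p: "p \<in> {p\<in>C. e/2 \<le> snd p}" "snd p \<le> e/2" for p
    proof -
      have "snd p = e/2" "p \<in> C" using p by auto
      then show ?thesis
        using cyl_homeoD(8)[OF f C_fst[of p]] e by (simp add: sink_def raise_def Let_def prod_eq_iff)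
    qed
  qed (auto intro: continuous_intros)
  moreover have "{p\<in>C. snd p \<le> e/2} \<union> {p\<in>C. e/2 \<le> snd p} = C" by auto
  ultimately show ?thesis by (simp add: cut_def[abs_def])
qed

lemma homeomorphism_cut:
  assumes "cyl_homeo f g" "0 \<le> e" "e \<le> 1"
  shows "homeomorphism C C (cut f e) (cut g e)"
  by (intro homeomorphismI continuous_cut[OF assms(1,2)] continuous_cut[OF cyl_homeo_sym[OF assms(1)] assms(2)])
    (use assms cut_mem[OF assms(1)] cut_mem[OF cyl_homeo_sym[OF assms(1)]] cut_cut[OF assms(1)]
      cut_cut[OF cyl_homeo_sym[OF assms(1)]] in auto)

text \<open>No constant is lost: \<open>sink e\<close> never lifts a point, and
  \<open>raise e\<close> is 1-Lipschitz.\<close>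

lemma near_cut:
  assumes "near \<eta> d f" "0 \<le> e" "0 \<le> \<eta>"
  shows "near \<eta> d (cut f e)"
  unfolding near_def
proof (intro ballI impI)
  fix p assume p: "p \<in> C" "snd p \<le> d"
  show "dist (fst (cut f e p)) (fst p) \<le> \<eta> \<and> \<bar>snd (cut f e p) - snd p\<bar> \<le> \<eta> * snd p"
  proof (cases "snd p \<le> e/2")
    case True
    then show ?thesis using assms(3) C_snd[OF p(1)] by (simp add: cut_def)
  next
    case False
    let ?r = "(fst p, sink e (snd p))"
    have r: "sink e (snd p) \<le> snd p" using sink_bounds C_snd[OF p(1)] assms(2) by blast
    have "dist (fst (f ?r)) (fst p) \<le> \<eta>" "\<bar>snd (f ?r) - sink e (snd p)\<bar> \<le> \<eta> * sink e (snd p)"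
      using nearD[OF assms(1) sink_mem[OF p(1) assms(2)]] r p(2) by auto
    moreover have "\<eta> * sink e (snd p) \<le> \<eta> * snd p" using r assms(3) by (rule mult_left_mono)
    moreover have "\<bar>raise e (snd (f ?r)) - snd p\<bar> \<le> \<bar>snd (f ?r) - sink e (snd p)\<bar>"
      using raise_diff[of e "snd (f ?r)" "sink e (snd p)"] raise_sink[of "snd p" e] C_snd[OF p(1)] False by simp
    ultimately show ?thesis using False by (simp add: cut_def Let_def)
  qed
qed

text \<open>The lower bound comes from the inverse: a point below \<open>v/2\<close> is returned by
  \<open>h'\<close> below \<open>v\<close>. It therefore also holds for points above
  \<open>d\<close>, about which \<open>near\<close> says nothing.\<close>

lemma near_half:
  assumes h: "homeomorphism C C h h'" "near (1/2) d h" "near (1/2) d h'" and p: "p \<in> C"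
  shows "snd p \<le> d \<Longrightarrow> snd (h p) \<le> 3/2 * snd p" "v \<le> d \<Longrightarrow> v \<le> snd p \<Longrightarrow> v/2 \<le> snd (h p)"
proof -
  show "snd p \<le> d \<Longrightarrow> snd (h p) \<le> 3/2 * snd p" using nearD(2)[OF h(2) p] by linarith
  assume v: "v \<le> d" "v \<le> snd p"
  have hp: "h p \<in> C" "h' (h p) = p" using h(1) p by (auto simp: homeomorphism_def)
  show "v/2 \<le> snd (h p)"
  proof (rule ccontr)
    assume c: "\<not> v/2 \<le> snd (h p)"
    then have "snd (h p) \<le> d" using v C_snd[OF hp(1)] by linarith
    from nearD(2)[OF h(3) hp(1) this] show False using c v C_snd[OF hp(1)] unfolding hp(2) by linarith
  qed
qed

lemma cut_low: "snd p \<le> e/2 \<Longrightarrow> cut f e p = p"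
  by (simp add: cut_def)

lemma cut_high: "0 \<le> e \<Longrightarrow> e < snd p \<Longrightarrow> e \<le> snd (f p) \<Longrightarrow> cut f e p = f p"
  by (simp add: cut_def Let_def sink_id raise_id)

end

section \<open>Pieces of a homeomorphism between two cuts\<close>

locale cylinder_map = cylinder S for S :: "'b::complete_space set" +
  fixes f g :: "'b \<times> real \<Rightarrow> 'b \<times> real" and d :: real
  assumes fg: "cyl_homeo f g" and nf: "near (1/2) d f" and ng: "near (1/2) d g" and d: "0 < d" "d \<le> 1"
begin

text \<open>Here \<open>c'\<close> lies far below \<open>c\<close>. The lower cut makes the piece
  the identity under \<open>c'/2\<close>, the upper one cancels \<open>f\<close> above
  \<open>2 * c\<close>, and well between the cuts the piece is \<open>f\<close>.\<close>

definition even_piece :: "real \<Rightarrow> real \<Rightarrow> 'b \<times> real \<Rightarrow> 'b \<times> real" where "even_piece c c' = cut f c' \<circ> cut g c"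
definition even_piece' :: "real \<Rightarrow> real \<Rightarrow> 'b \<times> real \<Rightarrow> 'b \<times> real" where "even_piece' c c' = cut f c \<circ> cut g c'"
text \<open>Again \<open>f\<close> between the cuts, but with the lower cut conjugated by
  \<open>f\<close>. The lower cut of an odd piece is the upper cut of an even piece; there the even
  factor, applied before the odd one, is \<open>f \<circ> cut g c\<close>, and
  \<open>f \<circ> cut f c \<circ> g\<close> is the complement that turns it into
  \<open>f\<close>.\<close>

definition odd_piece :: "real \<Rightarrow> real \<Rightarrow> 'b \<times> real \<Rightarrow> 'b \<times> real" where "odd_piece c c' = f \<circ> cut f c' \<circ> g \<circ> cut g c"
definition odd_piece' :: "real \<Rightarrow> real \<Rightarrow> 'b \<times> real \<Rightarrow> 'b \<times> real" where "odd_piece' c c' = cut f c \<circ> f \<circ> cut g c' \<circ> g"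

lemma gf: "cyl_homeo g f" by (rule cyl_homeo_sym[OF fg])
lemmas hf = cyl_homeoD(1)[OF fg] and hg = cyl_homeoD(1)[OF gf]

lemma f_bounds: "p \<in> C \<Longrightarrow> snd p \<le> d \<Longrightarrow> snd (f p) \<le> 3/2 * snd p"
    "p \<in> C \<Longrightarrow> v \<le> d \<Longrightarrow> v \<le> snd p \<Longrightarrow> v/2 \<le> snd (f p)"
  and g_bounds: "p \<in> C \<Longrightarrow> snd p \<le> d \<Longrightarrow> snd (g p) \<le> 3/2 * snd p"
    "p \<in> C \<Longrightarrow> v \<le> d \<Longrightarrow> v \<le> snd p \<Longrightarrow> v/2 \<le> snd (g p)"
  using near_half[OF hf nf ng] near_half[OF hg ng nf] by auto

lemma cut_bounds:
  assumes "0 \<le> e" "e \<le> 1" "p \<in> C"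
  shows "snd p \<le> d \<Longrightarrow> snd (cut f e p) \<le> 3/2 * snd p" "v \<le> d \<Longrightarrow> v \<le> snd p \<Longrightarrow> v/2 \<le> snd (cut f e p)"
    "snd p \<le> d \<Longrightarrow> snd (cut g e p) \<le> 3/2 * snd p" "v \<le> d \<Longrightarrow> v \<le> snd p \<Longrightarrow> v/2 \<le> snd (cut g e p)"
  using near_half[OF homeomorphism_cut[OF fg assms(1,2)] near_cut[OF nf assms(1)] near_cut[OF ng assms(1)] assms(3)]
    near_half[OF homeomorphism_cut[OF gf assms(1,2)] near_cut[OF ng assms(1)] near_cut[OF nf assms(1)] assms(3)]
  by auto

lemma cut_top:
  assumes "0 < e" "2 * e \<le> d" "p \<in> C" "2 * e \<le> snd p"
  shows "cut f e p = f p" "cut g e p = g p"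
  using assms f_bounds(2)[of p "2 * e"] g_bounds(2)[of p "2 * e"] by (auto intro!: cut_high)

lemma mems: "p \<in> C \<Longrightarrow> f p \<in> C" "p \<in> C \<Longrightarrow> g p \<in> C"
   "p \<in> C \<Longrightarrow> 0 \<le> e \<Longrightarrow> e \<le> 1 \<Longrightarrow> cut f e p \<in> C" "p \<in> C \<Longrightarrow> 0 \<le> e \<Longrightarrow> e \<le> 1 \<Longrightarrow> cut g e p \<in> C"
  using cyl_homeoD(4,5)[OF fg] cut_mem[OF fg] cut_mem[OF gf] by auto

text \<open>The factor 1000 leaves room between consecutive cuts for several uses of the bounds by
  \<open>1/2\<close> and \<open>3/2\<close>. With \<open>c \<le> d/16\<close> the heights near the
  cut that occur, at most \<open>9 * c\<close>, stay below \<open>d\<close>.\<close>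

context
  fixes c c' :: real
  assumes c: "0 < c'" "c' \<le> c/1000" "c \<le> d/16"
begin

lemma cs: "0 \<le> c" "c \<le> 1" "0 \<le> c'" "c' \<le> 1" "0 < c" "2 * c \<le> d" "2 * c' \<le> d" "c' < c"
  using c d by auto

lemma homeomorphism_even_piece: "homeomorphism C C (even_piece c c') (even_piece' c c')"
  unfolding even_piece_def even_piece'_def
  by (intro homeomorphism_compose[OF homeomorphism_cut homeomorphism_cut] fg gf cs)

lemma homeomorphism_odd_piece: "homeomorphism C C (odd_piece c c') (odd_piece' c c')"
  unfolding odd_piece_def odd_piece'_def
  using homeomorphism_compose[OF homeomorphism_compose[OF homeomorphism_compose[OF
        homeomorphism_cut[OF gf cs(1,2)] hg] homeomorphism_cut[OF fg cs(3,4)]] hf]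
  by (simp add: o_assoc)

lemma even_piece_high:
  assumes p: "p \<in> C" and "2 * c \<le> snd p" shows "even_piece c c' p = p"
proof -
  have "c \<le> snd (g p)" using g_bounds(2)[OF p, of "2 * c"] assms(2) cs by simp
  then have "cut f c' (g p) = f (g p)" using c by (intro cut_top mems p) auto
  then show ?thesis using cut_top(2)[OF cs(5,6) assms] cyl_homeoD(7)[OF fg p] by (simp add: even_piece_def)
qed

lemma odd_piece_high:
  assumes p: "p \<in> C" and "2 * c \<le> snd p" shows "odd_piece c c' p = p"
proof -
  have "c \<le> snd (g p)" using g_bounds(2)[OF p, of "2 * c"] assms(2) cs by simp
  then have "c/2 \<le> snd (g (g p))" using g_bounds(2)[OF mems(2)[OF p], of c] cs by simp
  then have "cut f c' (g (g p)) = f (g (g p))" using c by (intro cut_top mems p) auto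
  then show ?thesis
    using cut_top(2)[OF cs(5,6) assms] cyl_homeoD(7)[OF fg p] cyl_homeoD(7)[OF fg mems(2)[OF p]] by (simp add: odd_piece_def)
qed

lemma even_piece_lower: "snd p \<le> c/2 \<Longrightarrow> even_piece c c' p = cut f c' p"
  and odd_piece_lower: "snd p \<le> c/2 \<Longrightarrow> odd_piece c c' p = f (cut f c' (g p))"
  by (simp_all add: even_piece_def odd_piece_def cut_low)

lemma even_piece_low: "p \<in> C \<Longrightarrow> snd p \<le> c'/2 \<Longrightarrow> even_piece c c' p = p"
  using c by (simp add: even_piece_lower cut_low)

lemma odd_piece_low:
  assumes "p \<in> C" "snd p \<le> c'/3" shows "odd_piece c c' p = p"
proof -
  have "snd (g p) \<le> c'/2" using g_bounds(1)[OF assms(1)] assms(2) c d by simp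
  then show ?thesis using assms(2) c cyl_homeoD(7)[OF fg assms(1)] by (simp add: odd_piece_lower cut_low)
qed

lemma even_piece_upper:
  assumes p: "p \<in> C" "c/8 \<le> snd p"
  shows "even_piece c c' p = f (cut g c p)"
proof -
  have "c/16 \<le> snd (cut g c p)" using cut_bounds(4)[OF cs(1,2) p(1), of "c/8"] p(2) c by simp
  then have "cut f c' (cut g c p) = f (cut g c p)" using c by (intro cut_top mems p cs) auto
  then show ?thesis by (simp add: even_piece_def)
qed

lemma odd_piece_upper:
  assumes p: "p \<in> C" "c/16 \<le> snd p"
  shows "odd_piece c c' p = f (cut g c p)"
proof -
  have "c/32 \<le> snd (cut g c p)" using cut_bounds(4)[OF cs(1,2) p(1), of "c/16"] p(2) c by simp
  then have "c/64 \<le> snd (g (cut g c p))"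
    using g_bounds(2)[OF mems(4)[OF p(1) cs(1,2)], of "c/32"] c by simp
  then have "cut f c' (g (cut g c p)) = f (g (cut g c p))" using c by (intro cut_top mems p cs) auto
  then show ?thesis using cyl_homeoD(7)[OF fg mems(4)[OF p(1) cs(1,2)]] by (simp add: odd_piece_def)
qed

text \<open>One slot \<open>[c'/8, 8 * c]\<close> serves both kinds. When each cut is at most a
  thousandth of the preceding one, slots of pieces whose indices differ by 2 are disjoint.\<close>

lemma even_piece_slot: "p \<in> C \<Longrightarrow> snd p \<le> c'/8 \<or> 8 * c \<le> snd p \<Longrightarrow> even_piece c c' p = p"
  and odd_piece_slot: "p \<in> C \<Longrightarrow> snd p \<le> c'/8 \<or> 8 * c \<le> snd p \<Longrightarrow> odd_piece c c' p = p"
  using even_piece_low[of p] even_piece_high[of p] odd_piece_low[of p] odd_piece_high[of p] cs C_snd[of p] by auto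

text \<open>The blow-up divides by the length of the slot, which is at least half of its top; this
  gives \<open>2 * \<eta>\<close> vertically, and the horizontal error adds
  \<open>\<eta>\<close>.\<close>

lemma unscale_small:
  assumes h: "near \<eta> (8 * c) h" "\<And>p. p \<in> C \<Longrightarrow> h p \<in> C" and \<eta>: "0 \<le> \<eta>" and p: "p \<in> C"
  shows "dist (unscale (8 * c) (c'/8) h p) p \<le> 3 * \<eta>"
proof -
  define a where "a = 8 * c"
  define b where "b = c'/8"
  have ab: "0 \<le> b" "b < a" "a \<le> 1" "a \<le> 2 * (a - b)" using c d by (auto simp: a_def b_def)
  let ?q = "(fst p, b + (a - b) * snd p)"
  note q = slot_mem[OF p ab(1-3)]
  have 1: "dist (fst (h ?q)) (fst p) \<le> \<eta>" "\<bar>snd (h ?q) - (b + (a - b) * snd p)\<bar> \<le> \<eta> * (b + (a - b) * snd p)"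
    using nearD[OF h(1) q(1)] q(3) by (auto simp: a_def)
  have "(snd (h ?q) - b) / (a - b) - snd p = (snd (h ?q) - (b + (a - b) * snd p)) / (a - b)"
    using ab by (simp add: field_simps)
  also have "\<bar>\<dots>\<bar> \<le> (\<eta> * a) / (a - b)"
  proof -
    have "\<bar>snd (h ?q) - (b + (a - b) * snd p)\<bar> \<le> \<eta> * a"
      using 1(2) mult_left_mono[OF q(3) \<eta>] by linarith
    then show ?thesis using ab by (simp add: divide_right_mono)
  qed
  also have "\<dots> \<le> \<eta> * 2"
    using mult_left_mono[OF ab(4) \<eta>] ab by (simp add: field_simps)
  finally have "\<bar>(snd (h ?q) - b) / (a - b) - snd p\<bar> \<le> \<eta> * 2" .
  moreover have "dist (unscale a b h p) p \<le> dist (fst (unscale a b h p)) (fst p) + dist (snd (unscale a b h p)) (snd p)"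
    by (simp add: dist_prod_def sqrt_sum_squares_le_sum)
  ultimately show ?thesis using 1(1) by (simp add: unscale_def Let_def dist_real_def a_def b_def)
qed

text \<open>By \<open>near_comp\<close> every further factor on the left costs
  \<open>2 * \<eta>\<close>. The odd piece has four factors, whence
  \<open>7 = 1 + 2 + 2 + 2\<close>; the even piece needs only 3.\<close>

lemma near_even_piece:
  assumes "near \<eta> e f" "near \<eta> e g" "0 \<le> \<eta>" "\<eta> \<le> 1/10" "64 * c \<le> e"
  shows "near (7 * \<eta>) (8 * c) (even_piece c c')" "near (7 * \<eta>) (8 * c) (odd_piece c c')"
proof -
  have "near (2 * \<eta> + \<eta>) (32 * c) (g \<circ> cut g c)"
    by (rule near_comp[OF assms(2) near_cut[OF assms(2) cs(1) assms(3)]]) (use assms cs mems in auto)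
  then have "near (2 * \<eta> + (2 * \<eta> + \<eta>)) (16 * c) (cut f c' \<circ> (g \<circ> cut g c))"
    by (intro near_comp[OF near_cut[OF assms(1) cs(3) assms(3)]]) (use assms cs mems in auto)
  then have "near (2 * \<eta> + (2 * \<eta> + (2 * \<eta> + \<eta>))) (8 * c) (f \<circ> (cut f c' \<circ> (g \<circ> cut g c)))"
    by (intro near_comp[OF assms(1)]) (use assms cs mems in auto)
  then show "near (7 * \<eta>) (8 * c) (odd_piece c c')" by (simp add: odd_piece_def o_assoc)
  have "near (2 * \<eta> + \<eta>) (8 * c) (cut f c' \<circ> cut g c)"
    by (rule near_comp[OF near_cut[OF assms(1) cs(3) assms(3)] near_cut[OF assms(2) cs(1) assms(3)]])
      (use assms cs mems in auto)
  then show "near (7 * \<eta>) (8 * c) (even_piece c c')"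
    unfolding even_piece_def by (rule near_mono) (use assms in auto)
qed

end

text \<open>Going up across an even cut \<open>c m\<close>, the even factor changes from \<open>f\<close> to the identity, across an odd cut
  from the identity to \<open>f\<close>; in each case the odd factor supplies the missing part of \<open>f\<close>.\<close>

lemma odd_even_product:
  fixes c :: "nat \<Rightarrow> real"
  assumes c: "\<And>m. 0 < c m" "\<And>m. c (Suc m) \<le> c m / 1000" "c 0 \<le> d/16" "c \<longlonglongrightarrow> 0"
    and E: "\<And>m p. even m \<Longrightarrow> p \<in> C \<Longrightarrow> 8 * c (Suc (Suc m)) \<le> snd p \<Longrightarrow> (m > 0 \<Longrightarrow> snd p \<le> c (m - 1) / 8)
        \<Longrightarrow> E p = even_piece (c m) (c (Suc m)) p"
    and O: "\<And>m p. odd m \<Longrightarrow> p \<in> C \<Longrightarrow> 8 * c (Suc (Suc m)) \<le> snd p \<Longrightarrow> snd p \<le> c (m - 1) / 8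
        \<Longrightarrow> O' p = odd_piece (c m) (c (Suc m)) p"
    and bottom: "\<And>x. x \<in> S \<Longrightarrow> E (x, 0) = (x, 0)" "\<And>x. x \<in> S \<Longrightarrow> O' (x, 0) = (x, 0)"
    and p: "p \<in> C" "snd p \<le> 4 * c (Suc 0)"
  shows "f p = O' (E p)"
proof (cases "snd p = 0")
  case True
  then have "p = (fst p, 0)" "fst p \<in> S" using C_fst[OF p(1)] by (auto simp: prod_eq_iff)
  then show ?thesis using bottom cyl_homeoD(8)[OF fg] by metis
next
  case False
  then have s0: "0 < snd p" using C_snd[OF p(1)] by simp
  have dec: "decseq c"
  proof (rule decseq_SucI)
    fix m show "c (Suc m) \<le> c m" using c(1)[of m] c(2)[of m] by linarith
  qed
  have cd: "c m \<le> d/16" for m using decseqD[OF dec, of 0 m] c(3) by simp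
  have "(\<lambda>m. 4 * c (Suc m)) \<longlonglongrightarrow> 0" using LIMSEQ_Suc[OF tendsto_mult_right_zero[OF c(4), of 4]] by simp
  \<comment> \<open>The cut \<open>c (Suc i)\<close> is the one whose transition can affect
    \<open>p\<close>. Bracketing from index 1 on guarantees a cut \<open>c i\<close> above
    it.\<close>
  from sequence_bracket[OF this s0] p(2)
  obtain i where i: "4 * c (Suc (Suc i)) < snd p" "snd p \<le> 4 * c (Suc i)" by auto
  note a = c(1,2)[of i] c(1,2)[of "Suc i"] c(1,2)[of "Suc (Suc i)"] c(1)[of "Suc (Suc (Suc i))"] c(2)[of "Suc (Suc (Suc i))"]
  let ?c = "c (Suc i)" and ?c' = "c (Suc (Suc i))" and ?c'' = "c (Suc (Suc (Suc i)))" and ?b = "c i"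
  have pc: "0 < ?c'" "?c' \<le> ?c/1000" "?c \<le> d/16" using a cd by auto
  have pb: "0 < ?c" "?c \<le> ?b/1000" "?b \<le> d/16" using a cd by auto
  have pc': "0 < ?c''" "?c'' \<le> ?c'/1000" "?c' \<le> d/16" using a cd by auto
  have ds: "0 \<le> ?c" "?c \<le> 1" "0 \<le> ?c'" "?c' \<le> 1" using pc pc' d by auto
  have sd: "snd p \<le> d" using i(2) pc(3) d by linarith
  show ?thesis
  proof (cases "even (Suc i)")
    case True
    then have i': "0 < i" "odd i" "even (Suc i)" "odd (Suc (Suc i))" by (auto elim: oddE)
    then obtain j where j: "i = Suc j" "even j" by (cases i) auto
    have cj: "?b \<le> c j / 1000" using c(2)[of j] j by simp
    have Ep: "E p = even_piece ?c ?c' p"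
      by (rule E[OF i'(3) p(1)]) (use i a in auto)
    show ?thesis
    proof (cases "snd p < ?c/8")
      case True
      \<comment> \<open>Below \<open>?c/8\<close> the point is well between two cuts, where the even
        factor is already \<open>f\<close>; it remains that the odd factor fixes
        \<open>f p\<close>.\<close>
      have "even_piece ?c ?c' p = cut f ?c' p" using even_piece_lower[OF pc] True a by simp
      also have "\<dots> = f p" using cut_top[OF pc(1) _ p(1)] i pc' by simp
      finally have Ef: "E p = f p" using Ep by simp
      have lo: "2 * ?c' \<le> snd (f p)" using f_bounds(2)[OF p(1), of "4 * ?c'"] i pc' by simp
      have hi: "snd (f p) \<le> 3/16 * ?c" using f_bounds(1)[OF p(1) sd] True by simp
      have "O' (f p) = f p"
      \<comment> \<open>\<open>f p\<close> may fall into the range of either neighbouring odd piece: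
        above the top of the lower one or below the bottom of the upper one.\<close>
      proof (cases "snd (f p) \<le> ?c/8")
        case True
        have "O' (f p) = odd_piece ?c' ?c'' (f p)"
          by (rule O[OF i'(4) mems(1)[OF p(1)]]) (use True lo a in auto)
        then show ?thesis using odd_piece_high[OF pc' mems(1)[OF p(1)] lo] by simp
      next
        case False
        have "O' (f p) = odd_piece ?b ?c (f p)"
          by (rule O[OF i'(2) mems(1)[OF p(1)]]) (use False hi a cj j in auto)
        then show ?thesis using odd_piece_low[OF pb mems(1)[OF p(1)]] hi pc by simp
      qed
      then show ?thesis using Ef by simp
    next
      case False
      let ?q = "cut g ?c p"
      have q: "?q \<in> C" by (rule mems(4)[OF p(1) ds(1,2)])
      have E1: "E p = f ?q" using Ep even_piece_upper[OF pc p(1)] False by simp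
      have q1: "?c/16 \<le> snd ?q" using cut_bounds(4)[OF ds(1,2) p(1), of "?c/8"] False pc by simp
      have q2: "snd ?q \<le> 6 * ?c" using cut_bounds(3)[OF ds(1,2) p(1) sd] i by simp
      have q3: "?c/32 \<le> snd (f ?q)" using f_bounds(2)[OF q, of "?c/16"] q1 pc by simp
      have q4: "snd (f ?q) \<le> 9 * ?c" using f_bounds(1)[OF q] q2 pc by simp
      have "O' (f ?q) = odd_piece ?b ?c (f ?q)"
        by (rule O[OF i'(2) mems(1)[OF q]]) (use q3 q4 a cj j in auto)
      \<comment> \<open>At an even cut the conjugated cut of the odd factor undoes
        \<open>cut g ?c\<close> inside the even factor, and \<open>f\<close> remains.\<close>
      also have "\<dots> = f (cut f ?c (g (f ?q)))" using odd_piece_lower[OF pb] q4 a by simp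
      also have "\<dots> = f p" using cyl_homeoD(6)[OF fg q] cut_cut[OF gf p(1) ds(1)] by simp
      finally show ?thesis using E1 by simp
    qed
  next
    case odd: False
    then have i': "odd (Suc i)" "even i" "even (Suc (Suc i))" by auto
    have cj: "0 < i \<Longrightarrow> ?b \<le> c (i - 1) / 1000" using c(2)[of "i - 1"] by simp
    show ?thesis
    proof (cases "snd p < ?c/8")
      case True
      have "E p = even_piece ?c' ?c'' p"
        by (rule E[OF i'(3) p(1)]) (use True i a in auto)
      \<comment> \<open>Between an odd cut and the even cut below it the roles are exchanged: the
        even factor is the identity and the odd one is \<open>f\<close>.\<close>
      then have Ep: "E p = p" using even_piece_high[OF pc' p(1)] i a by simp
      have "O' p = odd_piece ?c ?c' p"
        by (rule O[OF i'(1) p(1)]) (use True i a in auto)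
      also have "\<dots> = f (cut f ?c' (g p))" using odd_piece_lower[OF pc] True a by simp
      also have "cut f ?c' (g p) = f (g p)"
        using g_bounds(2)[OF p(1), of "4 * ?c'"] i pc' by (intro cut_top mems p) auto
      finally show ?thesis using Ep cyl_homeoD(7)[OF fg p(1)] by simp
    next
      case False
      have "E p = even_piece ?b ?c p"
        by (rule E[OF i'(2) p(1)]) (use False i a cj in auto)
      then have Ep: "E p = cut f ?c p" using even_piece_lower[OF pb] i a by simp
      let ?q = "cut f ?c p"
      have q: "?q \<in> C" by (rule mems(3)[OF p(1) ds(1,2)])
      have q1: "?c/16 \<le> snd ?q" using cut_bounds(2)[OF ds(1,2) p(1), of "?c/8"] False pc by simp
      have q2: "snd ?q \<le> 6 * ?c" using cut_bounds(1)[OF ds(1,2) p(1) sd] i by simp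
      have "O' ?q = odd_piece ?c ?c' ?q"
        by (rule O[OF i'(1) q]) (use q1 q2 a in auto)
      also have "\<dots> = f (cut g ?c ?q)" by (rule odd_piece_upper[OF pc q q1])
      also have "\<dots> = f p" using cut_cut[OF fg p(1) ds(1)] by simp
      finally show ?thesis using Ep by simp
    qed
  qed
qed

end

section \<open>Factoring germs into commutators\<close>

text \<open>With \<open>F'\<close>, \<open>\<phi>'\<close> and \<open>U\<close> inverse to
  \<open>F\<close>, \<open>\<phi>\<close> and \<open>T\<close>, this is the commutator of
  \<open>F\<close> with the conjugate of \<open>\<phi>\<close> by \<open>T\<close>.\<close>

definition comm :: "('x \<Rightarrow> 'x) \<Rightarrow> ('x \<Rightarrow> 'x) \<Rightarrow> ('x \<Rightarrow> 'x) \<Rightarrow> ('x \<Rightarrow> 'x) \<Rightarrow> ('x \<Rightarrow> 'x) \<Rightarrow> ('x \<Rightarrow> 'x) \<Rightarrow> 'x \<Rightarrow> 'x" where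
  "comm \<phi> \<phi>' F F' T U = F \<circ> (T \<circ> \<phi> \<circ> U) \<circ> F' \<circ> (T \<circ> \<phi>' \<circ> U)"

lemma (in cylinder) cyl_homeo_comm:
  assumes "cyl_homeo \<phi> \<phi>'" "cyl_homeo F F'" "cyl_homeo T U"
  shows "\<exists>h. cyl_homeo (comm \<phi> \<phi>' F F' T U) h"
  unfolding comm_def
  using cyl_homeo_comp[OF cyl_homeo_comp[OF cyl_homeo_comp[OF assms(2) cyl_homeo_comp[OF cyl_homeo_comp[OF assms(3,1)] cyl_homeo_sym[OF assms(3)]]]
      cyl_homeo_sym[OF assms(2)]] cyl_homeo_comp[OF cyl_homeo_comp[OF assms(3) cyl_homeo_sym[OF assms(1)]] cyl_homeo_sym[OF assms(3)]]]
  by blast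

context cylinder_map begin

text \<open>The cuts are chosen successively so that the infinite products over the even and over
  the odd pieces both converge. Each family is then a single commutator germ by
  \<open>slots_commutator\<close>, and \<open>odd_even_product\<close> recovers \<open>f\<close>
  from the two.\<close>

lemma nice_germ:
  assumes nice: "nice f" "nice g"
    and \<phi>: "cyl_homeo \<phi> \<phi>'" "\<And>p. p \<in> C \<Longrightarrow> snd p \<le> 1/16 \<Longrightarrow> \<phi> p = (fst p, 4 * snd p)"
  shows "\<exists>F\<^sub>1 F\<^sub>1' T\<^sub>1 U\<^sub>1 F\<^sub>2 F\<^sub>2' T\<^sub>2 U\<^sub>2. cyl_homeo F\<^sub>1 F\<^sub>1' \<and> cyl_homeo T\<^sub>1 U\<^sub>1 \<and> cyl_homeo F\<^sub>2 F\<^sub>2' \<and> cyl_homeo T\<^sub>2 U\<^sub>2 \<and>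
    germ_eq f (comm \<phi> \<phi>' F\<^sub>1 F\<^sub>1' T\<^sub>1 U\<^sub>1 \<circ> comm \<phi> \<phi>' F\<^sub>2 F\<^sub>2' T\<^sub>2 U\<^sub>2)"
proof -
  define piece where "piece m c c' = (if even m then even_piece c c' else odd_piece c c')" for m :: nat and c c'
  define piece' where "piece' m c c' = (if even m then even_piece' c c' else odd_piece' c c')" for m :: nat and c c'
  define \<kappa> where "\<kappa> m c c' = unscale (8 * c) (c'/8) (piece m c c')" for m :: nat and c c'
  have hom: "homeomorphism C C (piece m c c') (piece' m c c')" if "0 < c'" "c' \<le> c/1000" "c \<le> d/16" for m c c'
    using homeomorphism_even_piece[OF that] homeomorphism_odd_piece[OF that] by (simp add: piece_def piece'_def)
  have slot: "piece m c c' p = p"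
    if "0 < c'" "c' \<le> c/1000" "c \<le> d/16" "p \<in> C" "snd p \<le> c'/8 \<or> 8 * c \<le> snd p" for m c c' p
    using even_piece_slot[OF that] odd_piece_slot[OF that] by (simp add: piece_def)
  have \<kappa>C: "continuous_on C (\<kappa> m c c')" "p \<in> C \<Longrightarrow> \<kappa> m c c' p \<in> C"
    if "0 < c'" "c' \<le> c/1000" "c \<le> d/16" for m c c' p
  proof -
    have "end_fixing (\<kappa> m c c') (unscale (8 * c) (c'/8) (piece' m c c'))"
      unfolding \<kappa>_def by (rule end_fixing_unscale[OF hom[OF that] _ _ _ slot[OF that]]) (use that d in auto)
    then show "continuous_on C (\<kappa> m c c')" "p \<in> C \<Longrightarrow> \<kappa> m c c' p \<in> C" by (auto dest: end_fixingD)
  qed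
  have tiny: "\<exists>e>0. \<forall>c c'. 0 < c' \<and> c' \<le> c/1000 \<and> c \<le> e \<longrightarrow> (\<forall>m. \<forall>p\<in>C. dist (\<kappa> m c c' p) p \<le> \<eta>)"
    if \<eta>: "\<eta> > 0" for \<eta>
  proof -
    \<comment> \<open>\<open>21 = 3 * 7\<close>, with 7 from \<open>near_even_piece\<close> and 3
      from \<open>unscale_small\<close>.\<close>
    define \<mu> where "\<mu> = min (1/10) (\<eta>/21)"
    have \<mu>: "0 < \<mu>" "\<mu> \<le> 1/10" "21 * \<mu> \<le> \<eta>" using \<eta> by (auto simp: \<mu>_def)
    obtain e1 e2 where e: "e1 > 0" "near \<mu> e1 f" "e2 > 0" "near \<mu> e2 g"
      using nice \<mu>(1) unfolding nice_def by metis
    define e where "e = min (d/16) (min e1 e2 / 64)"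
    show ?thesis
    proof (intro exI[of _ e] conjI allI impI ballI)
      show "e > 0" using e d by (simp add: e_def)
      fix c c' m p assume c: "0 < c' \<and> c' \<le> c/1000 \<and> c \<le> e" and p: "p \<in> C"
      have c1: "0 < c'" "c' \<le> c/1000" "c \<le> d/16" and c2: "64 * c \<le> min e1 e2" using c by (auto simp: e_def)
      have "near \<mu> (min e1 e2) f" "near \<mu> (min e1 e2) g" using e by (auto intro: near_mono)
      from near_even_piece[OF c1 this _ \<mu>(2) c2] \<mu>(1)
      have "near (7 * \<mu>) (8 * c) (piece m c c')" by (simp add: piece_def)
      moreover have "piece m c c' q \<in> C" if "q \<in> C" for q
        using hom[OF c1, of m] that by (auto simp: homeomorphism_def)
      ultimately have "dist (\<kappa> m c c' p) p \<le> 3 * (7 * \<mu>)"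
        unfolding \<kappa>_def by (intro unscale_small[OF c1]) (use \<mu> p in auto)
      then show "dist (\<kappa> m c c' p) p \<le> \<eta>" using \<mu>(3) by linarith
    qed
  qed
  \<comment> \<open>Piece \<open>m\<close> also depends on the next cut \<open>c'\<close>, which is
    unknown when \<open>c\<close> is chosen; so smallness is required for every admissible
    \<open>c'\<close>.\<close>
  define good where "good m c G \<longleftrightarrow> (\<forall>c'. 0 < c' \<and> c' \<le> c/1000 \<longrightarrow> (\<forall>p\<in>C. dist (G (\<kappa> m c c' p)) (G p) \<le> (1/2)^m
      \<and> dist (\<kappa> m c c' p) p \<le> (1/2)^m))" for m c and G :: "'b \<times> real \<Rightarrow> 'b \<times> real"
  have ex: "\<exists>c>0. c \<le> l \<and> c \<le> min (1/32) (d/16) \<and> good m c G"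
    if "continuous_on C G" "l > 0" for m l and G :: "'b \<times> real \<Rightarrow> 'b \<times> real"
  proof -
    have "uniformly_continuous_on C G" by (rule compact_uniformly_continuous[OF that(1) compact_C])
    then have "\<exists>\<delta>>0. \<forall>p\<in>C. \<forall>q\<in>C. dist q p < \<delta> \<longrightarrow> dist (G q) (G p) < (1/2)^m"
      unfolding uniformly_continuous_on_def by simp
    then obtain \<delta> where \<delta>: "\<delta> > 0" "\<forall>p\<in>C. \<forall>q\<in>C. dist q p < \<delta> \<longrightarrow> dist (G q) (G p) < (1/2)^m"
      by (elim exE conjE)
    have "0 < min (\<delta>/2) ((1/2)^m)" using \<delta>(1) by simp
    from tiny[OF this] obtain e where e: "e > 0"
      "\<And>c c' m' p. 0 < c' \<and> c' \<le> c/1000 \<and> c \<le> e \<Longrightarrow> p \<in> C \<Longrightarrow> dist (\<kappa> m' c c' p) p \<le> min (\<delta>/2) ((1/2)^m)"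
      by metis
    \<comment> \<open>The bound \<open>1/32\<close> keeps the tops \<open>8 * c\<close> of the slots
      below \<open>1/2\<close>; \<open>d/16\<close> is the condition on cuts from the estimates for
      pieces.\<close>
    define c where "c = min l (min e (min (1/32) (d/16)))"
    have "good m c G" unfolding good_def
    proof (intro allI impI ballI conjI)
      fix c' p assume c': "0 < c' \<and> c' \<le> c / 1000" and p: "p \<in> C"
      have 1: "dist (\<kappa> m c c' p) p \<le> min (\<delta>/2) ((1/2)^m)" by (rule e(2)) (use c' p in \<open>auto simp: c_def\<close>)
      then show "dist (\<kappa> m c c' p) p \<le> (1/2)^m" by simp
      have "\<kappa> m c c' p \<in> C" by (rule \<kappa>C(2)) (use c' p in \<open>auto simp: c_def\<close>)
      then have "dist (G (\<kappa> m c c' p)) (G p) < (1/2)^m" using \<delta> p 1 by auto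
      then show "dist (G (\<kappa> m c c' p)) (G p) \<le> (1/2)^m" by simp
    qed
    then show ?thesis using e(1) that(2) d by (intro exI[of _ c]) (auto simp: c_def)
  qed
  \<comment> \<open>A state holds the cut \<open>c\<close>, the partial product \<open>G\<close> for
    the parity of \<open>m\<close> and the partial product \<open>H\<close> for the other parity;
    both start as the identity.\<close>
  define P where "P m z \<longleftrightarrow> (case z of (c, G, H) \<Rightarrow> 0 < c \<and> c \<le> min (1/32) (d/16) \<and> good m c G \<and>
     continuous_on C G \<and> continuous_on C H \<and> (m = 0 \<longrightarrow> G = (\<lambda>p. p) \<and> H = (\<lambda>p. p)))" for m and z :: "real \<times> ('b \<times> real \<Rightarrow> 'b \<times> real) \<times> ('b \<times> real \<Rightarrow> 'b \<times> real)"
  \<comment> \<open>The parities alternate: \<open>H\<close> is used next, while \<open>G\<close>,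
    multiplied by the blown-up piece \<open>m\<close>, waits for index \<open>m + 2\<close>.\<close>
  define Q where "Q m z z' \<longleftrightarrow> (case (z, z') of ((c, G, H), (c', G', H')) \<Rightarrow> c' \<le> c/1000 \<and> G' = H \<and> H' = G \<circ> \<kappa> m c c')"
    for m and z z' :: "real \<times> ('b \<times> real \<Rightarrow> 'b \<times> real) \<times> ('b \<times> real \<Rightarrow> 'b \<times> real)"
  have "\<exists>z. \<forall>m. P m (z m) \<and> Q m (z m) (z (Suc m))"
  proof (rule dependent_nat_choice)
    obtain c where "c > 0" "c \<le> min (1/32) (d/16)" "good 0 c (\<lambda>p. p)" using ex[of "\<lambda>p. p" 1 0] by auto
    then show "\<exists>z. P 0 z" unfolding P_def by (intro exI[of _ "(c, (\<lambda>p. p), (\<lambda>p. p))"]) auto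
    fix z m assume "P m z"
    moreover obtain c G H where z: "z = (c, G, H)" by (cases z) auto
    ultimately have c: "0 < c" "c \<le> min (1/32) (d/16)" "continuous_on C G" "continuous_on C H" by (auto simp: P_def)
    obtain c' where c': "c' > 0" "c' \<le> c/1000" "c' \<le> min (1/32) (d/16)" "good (Suc m) c' H"
      using ex[OF c(4), of "c/1000" "Suc m"] c(1) by auto
    have "c \<le> d/16" using c(2) by simp
    note k = \<kappa>C[OF c'(1,2) this]
    have "continuous_on C (G \<circ> \<kappa> m c c')"
      by (rule continuous_on_compose[OF k(1) continuous_on_subset[OF c(3)]]) (use k(2) in auto)
    then show "\<exists>z'. P (Suc m) z' \<and> Q m z z'"
      using c c' unfolding P_def Q_def z by (intro exI[of _ "(c', H, G \<circ> \<kappa> m c c')"]) auto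
  qed
  then obtain z where z: "\<And>m. P m (z m)" "\<And>m. Q m (z m) (z (Suc m))" by blast
  define c where "c m = fst (z m)" for m
  define G where "G m = fst (snd (z m))" for m
  have c: "0 < c m" "c m \<le> 1/32" "c m \<le> d/16" "good m (c m) (G m)" for m
    using z(1)[of m] by (auto simp: P_def c_def G_def case_prod_unfold)
  have cS: "c (Suc m) \<le> c m / 1000" and GSS: "G (Suc (Suc m)) = G m \<circ> \<kappa> m (c m) (c (Suc m))" for m
    using z(2)[of m] z(2)[of "Suc m"] by (auto simp: Q_def c_def G_def case_prod_unfold)
  have cSS: "c (Suc (Suc m)) \<le> c m / 1000" for m using cS[of m] cS[of "Suc m"] c(1)[of m] by linarith
  have "c m \<le> (1/2)^m" for m
  proof (induction m)
    case (Suc m)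
    then show ?case using cS[of m] c(1)[of m] by simp
  qed (use c(2)[of 0] in simp)
  then have clim: "c \<longlonglongrightarrow> 0"
    by (intro tendsto_sandwich[OF _ _ tendsto_const LIMSEQ_realpow_zero[of "1/2"]] always_eventually allI)
       (auto intro: less_imp_le[OF c(1)])
  have small: "p \<in> C \<Longrightarrow> dist (G m (\<kappa> m (c m) (c (Suc m)) p)) (G m p) \<le> (1/2)^m"
     "p \<in> C \<Longrightarrow> dist (\<kappa> m (c m) (c (Suc m)) p) p \<le> (1/2)^m" for m p
    using c(4)[of m] c(1)[of "Suc m"] cS[of m] by (auto simp: good_def)
  \<comment> \<open>\<open>E 0\<close> collects the even pieces and \<open>E 1\<close> the odd ones.
    Slots of one parity are disjoint, so the chosen index is unique.\<close>
  define E where "E i p = (if \<exists>n. c (Suc (2 * n + i)) / 8 \<le> snd p \<and> snd p \<le> 8 * c (2 * n + i)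
    then let m = 2 * (SOME n. c (Suc (2 * n + i)) / 8 \<le> snd p \<and> snd p \<le> 8 * c (2 * n + i)) + i
      in piece m (c m) (c (Suc m)) p else p)" for i :: nat and p
  have dec: "decseq c"
  proof (rule decseq_SucI)
    fix m show "c (Suc m) \<le> c m" using c(1)[of m] cS[of m] by linarith
  qed
  have uniq: "n = n'" if "c (Suc (2 * n + i)) / 8 \<le> s" "s \<le> 8 * c (2 * n + i)"
    "c (Suc (2 * n' + i)) / 8 \<le> s" "s \<le> 8 * c (2 * n' + i)" for n n' i s
  proof -
    have "\<not> n < n'" if "c (Suc (2 * n + i)) / 8 \<le> s" "s \<le> 8 * c (2 * n' + i)" for n n'
    proof
      assume "n < n'"
      then have "c (2 * n' + i) \<le> c (Suc (Suc (2 * n + i)))" by (intro decseqD[OF dec]) simp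
      then show False using cS[of "Suc (2 * n + i)"] c(1)[of "Suc (2 * n + i)"] that by linarith
    qed
    then show ?thesis using that by (metis nat_neq_iff)
  qed
  have E1: "E i p = piece (2 * n + i) (c (2 * n + i)) (c (Suc (2 * n + i))) p"
    if "c (Suc (2 * n + i)) / 8 \<le> snd p" "snd p \<le> 8 * c (2 * n + i)" for i n p
  proof -
    have s: "(SOME n. c (Suc (2 * n + i)) / 8 \<le> snd p \<and> snd p \<le> 8 * c (2 * n + i)) = n"
      by (rule some_equality) (use that uniq in blast)+
    have ex: "\<exists>n. c (Suc (2 * n + i)) / 8 \<le> snd p \<and> snd p \<le> 8 * c (2 * n + i)" using that by blast
    show ?thesis by (simp only: E_def if_P[OF ex] Let_def s)
  qed
  have E2: "E i p = p" if "\<And>n. \<not> (c (Suc (2 * n + i)) / 8 \<le> snd p \<and> snd p \<le> 8 * c (2 * n + i))" for i p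
    using that unfolding E_def by (subst if_not_P) auto
  \<comment> \<open>Beyond its own slot, up to the neighbouring slots of the same parity, piece
    \<open>m\<close> still agrees with \<open>E i\<close>: both are the identity there. This
    supplies the wide ranges that \<open>odd_even_product\<close> works with.\<close>
  have E3: "E i p = piece m (c m) (c (Suc m)) p"
    if m: "m = 2 * n + i" and p: "p \<in> C" "8 * c (Suc (Suc m)) \<le> snd p" "n > 0 \<Longrightarrow> snd p \<le> c (m - 1) / 8" for i n m p
  proof (cases "c (Suc m) / 8 \<le> snd p \<and> snd p \<le> 8 * c m")
    case False
    then have "piece m (c m) (c (Suc m)) p = p"
      by (intro slot c cS p) auto
    moreover have "E i p = p"
    proof (cases "\<exists>n. c (Suc (2 * n + i)) / 8 \<le> snd p \<and> snd p \<le> 8 * c (2 * n + i)")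
      case True
      then obtain n' where n': "c (Suc (2 * n' + i)) / 8 \<le> snd p" "snd p \<le> 8 * c (2 * n' + i)" by blast
      have "snd p \<le> c (Suc (2 * n' + i)) / 8 \<or> 8 * c (2 * n' + i) \<le> snd p"
      proof (cases n n' rule: linorder_cases)
        case less
        then have "c (2 * n' + i) \<le> c (Suc (Suc m))" unfolding m by (intro decseqD[OF dec]) simp
        then show ?thesis using p(2) by linarith
      next
        case equal
        then show ?thesis using False n' m by simp
      next
        case greater
        then have "c (m - 1) \<le> c (Suc (2 * n' + i))" unfolding m by (intro decseqD[OF dec]) simp
        then show ?thesis using p(3) greater by simp
      qed
      then have "piece (2 * n' + i) (c (2 * n' + i)) (c (Suc (2 * n' + i))) p = p"
        by (intro slot c cS p)
      then show ?thesis using E1[OF n'] by simp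
    qed (use E2 in blast)
    ultimately show ?thesis by simp
  qed (use E1[of n i p] m in auto)
  have Gid: "G 0 p = p" "G (Suc 0) p = p" for p
    using z(1)[of 0] z(2)[of 0] by (auto simp: P_def Q_def G_def case_prod_unfold)
  have comms: "\<exists>F F' T U. cyl_homeo F F' \<and> cyl_homeo T U \<and> germ_eq (E i) (comm \<phi> \<phi>' F F' T U)" if i: "i \<le> 1" for i
    unfolding comm_def
  proof (rule slots_commutator[OF \<phi>, where a="\<lambda>n. 8 * c (2 * n + i)" and b="\<lambda>n. c (Suc (2 * n + i)) / 8"
        and h="\<lambda>n. piece (2 * n + i) (c (2 * n + i)) (c (Suc (2 * n + i)))"
        and h'="\<lambda>n. piece' (2 * n + i) (c (2 * n + i)) (c (Suc (2 * n + i)))"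
        and G="\<lambda>n. G (2 * n + i)"])
    fix n
    show "c (Suc (2 * n + i)) / 8 < 8 * c (2 * n + i)" using cS[of "2 * n + i"] c(1)[of "2 * n + i"] by linarith
    show "8 * c (2 * Suc n + i) < c (Suc (2 * n + i)) / 8"
      using cS[of "Suc (2 * n + i)"] c(1)[of "Suc (2 * n + i)"] by simp
    show "homeomorphism C C (piece (2 * n + i) (c (2 * n + i)) (c (Suc (2 * n + i))))
        (piece' (2 * n + i) (c (2 * n + i)) (c (Suc (2 * n + i))))"
      by (intro hom c cS)
    fix p assume p: "p \<in> C"
    show "piece (2 * n + i) (c (2 * n + i)) (c (Suc (2 * n + i))) p = p"
      if "snd p \<le> c (Suc (2 * n + i)) / 8 \<or> 8 * c (2 * n + i) \<le> snd p"
      by (intro slot c cS p that)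
    let ?u = "unscale (8 * c (2 * n + i)) (c (Suc (2 * n + i)) / 8) (piece (2 * n + i) (c (2 * n + i)) (c (Suc (2 * n + i))))"
    have u: "?u = \<kappa> (2 * n + i) (c (2 * n + i)) (c (Suc (2 * n + i)))" by (simp add: \<kappa>_def)
    show "G (2 * Suc n + i) p = G (2 * n + i) (?u p)" unfolding u using GSS[of "2 * n + i"] by simp
    \<comment> \<open>Each family uses every second index, so the bounds of the joint construction
      are stronger than those asked for a single family.\<close>
    have "(1/2::real)^(2 * n + i) \<le> (1/2)^n" by (rule power_decreasing) auto
    then show "dist (G (2 * n + i) (?u p)) (G (2 * n + i) p) \<le> (1/2)^n" "dist (?u p) p \<le> (1/2)^n"
      unfolding u using small[OF p, of "2 * n + i"] by linarith+
    show "E i p = piece (2 * n + i) (c (2 * n + i)) (c (Suc (2 * n + i))) p"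
      if "c (Suc (2 * n + i)) / 8 \<le> snd p" "snd p \<le> 8 * c (2 * n + i)" by (rule E1[OF that])
  next
    show "(\<lambda>n. 8 * c (2 * n + i)) \<longlonglongrightarrow> 0"
    proof -
      have "strict_mono (\<lambda>n. 2 * n + i)" by (rule strict_monoI) simp
      from LIMSEQ_subseq_LIMSEQ[OF clim this] have "(\<lambda>n. c (2 * n + i)) \<longlonglongrightarrow> 0" by (simp add: o_def)
      then show ?thesis using tendsto_mult_right_zero by blast
    qed
    show "8 * c (2 * 0 + i) < 1/2" using c(2)[of i] by simp
    show "G (2 * 0 + i) p = p" for p using i Gid by (cases i) auto
    show "E i p = p" if "\<And>n. \<not> (c (Suc (2 * n + i)) / 8 \<le> snd p \<and> snd p \<le> 8 * c (2 * n + i))" for p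
      by (rule E2[OF that])
  qed
  have bot: "E i (x, 0) = (x, 0)" for i x
    using c(1) by (intro E2) (auto simp: not_le)
  have prod: "f p = E 1 (E 0 p)" if p: "p \<in> C" "snd p \<le> 4 * c (Suc 0)" for p
  proof (rule odd_even_product[OF c(1) cS c(3) clim _ _ bot bot p])
    fix m q assume m: "even m" "q \<in> C" "8 * c (Suc (Suc m)) \<le> snd q" "m > 0 \<Longrightarrow> snd q \<le> c (m - 1) / 8"
    then obtain n where n: "m = 2 * n + 0" by (auto elim: evenE)
    show "E 0 q = even_piece (c m) (c (Suc m)) q"
      using E3[OF n m(2,3)] m(1,4) n by (simp add: piece_def)
  next
    fix m q assume m: "odd m" "q \<in> C" "8 * c (Suc (Suc m)) \<le> snd q" "snd q \<le> c (m - 1) / 8"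
    then obtain n where n: "m = 2 * n + 1" by (auto elim: oddE)
    show "E 1 q = odd_piece (c m) (c (Suc m)) q"
      using E3[OF n m(2,3)] m(1,4) by (simp add: piece_def)
  qed
  have f: "germ_eq f (E 1 \<circ> E 0)"
    unfolding germ_eq_def using prod c(1)[of "Suc 0"] by (intro exI[of _ "4 * c (Suc 0)"]) auto
  obtain F1 F1' T1 U1 where 1: "cyl_homeo F1 F1'" "cyl_homeo T1 U1" "germ_eq (E 1) (comm \<phi> \<phi>' F1 F1' T1 U1)"
    using comms[of 1] by auto
  obtain F2 F2' T2 U2 where 2: "cyl_homeo F2 F2'" "cyl_homeo T2 U2" "germ_eq (E 0) (comm \<phi> \<phi>' F2 F2' T2 U2)"
    using comms[of 0] by auto
  obtain h where "cyl_homeo (comm \<phi> \<phi>' F2 F2' T2 U2) h" using cyl_homeo_comm[OF \<phi>(1) 2(1,2)] by blast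
  from germ_eq_trans[OF f germ_eq_comp[OF 1(3) 2(3) this]] 1 2 show ?thesis by blast
qed

end

section \<open>Reduction of arbitrary germs by a change of height\<close>

context cylinder begin

text \<open>Heights \<open>t n\<close> are chosen so that \<open>f\<close> and \<open>g\<close>
  shift a point by a bounded number of the intervals between them. Sending \<open>t n\<close> to
  \<open>\<tau> n = 1 / (n + 2)\<close> makes a bounded shift of the index a vanishing relative
  change of height. The horizontal bound comes from continuity at the bottom, as a change of height
  leaves the base coordinate alone.\<close>

lemma nice_conjugate:
  assumes fg: "cyl_homeo f g"
  obtains T U where "cyl_homeo (level_map T) (level_map U)" "nice (level_map T \<circ> f \<circ> level_map U)" "nice (level_map T \<circ> g \<circ> level_map U)"
proof -
  have step: "\<exists>t'. (0 < t' \<and> t' \<le> (1/2)^(Suc (Suc n)) \<and> t' < 1) \<and> t' < t \<and> (\<forall>p\<in>C. snd p \<le> t' \<longrightarrow> snd (f p) < t \<and> snd (g p) < t)"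
    if t0: "0 < t" for t n
  proof -
    obtain d1 d2 where d: "d1 > 0" "\<forall>p\<in>C. snd p \<le> d1 \<longrightarrow> snd (f p) < t" "d2 > 0" "\<forall>p\<in>C. snd p \<le> d2 \<longrightarrow> snd (g p) < t"
      using cyl_homeo_snd_small[OF fg t0] cyl_homeo_snd_small[OF cyl_homeo_sym[OF fg] t0] by blast
    have "(1/2::real)^(Suc (Suc n)) < 1" by (rule power_Suc_less_one) auto
    then show ?thesis
      using d t0 by (intro exI[of _ "min (t/2) (min ((1/2)^(Suc (Suc n))) (min d1 d2))"]) auto
  qed
  have "\<exists>t. \<forall>n. (0 < t n \<and> t n \<le> (1/2)^(Suc n) \<and> t n < 1 \<and> (n = 0 \<longrightarrow> t n = 1/2)) \<and>
      (t (Suc n) < t n \<and> (\<forall>p\<in>C. snd p \<le> t (Suc n) \<longrightarrow> snd (f p) < t n \<and> snd (g p) < t n))"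
  proof (rule dependent_nat_choice)
    show "\<exists>x::real. 0 < x \<and> x \<le> (1/2)^(Suc 0) \<and> x < 1 \<and> (0 = (0::nat) \<longrightarrow> x = 1/2)" by (intro exI[of _ "1/2"]) auto
    fix x :: real and n :: nat assume "0 < x \<and> x \<le> (1/2)^(Suc n) \<and> x < 1 \<and> (n = 0 \<longrightarrow> x = 1/2)"
    then show "\<exists>y. (0 < y \<and> y \<le> (1/2)^(Suc (Suc n)) \<and> y < 1 \<and> (Suc n = 0 \<longrightarrow> y = 1/2)) \<and>
       (y < x \<and> (\<forall>p\<in>C. snd p \<le> y \<longrightarrow> snd (f p) < x \<and> snd (g p) < x))"
      using step[of x n] by auto
  qed
  then obtain t where t: "\<And>n. 0 < t n" "\<And>n. t n \<le> (1/2)^(Suc n)" "t 0 = 1/2" "\<And>n. t n < 1" "\<And>n. t (Suc n) < t n"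
    and tf: "\<And>n p. p \<in> C \<Longrightarrow> snd p \<le> t (Suc n) \<Longrightarrow> snd (f p) < t n"
    and tg: "\<And>n p. p \<in> C \<Longrightarrow> snd p \<le> t (Suc n) \<Longrightarrow> snd (g p) < t n"
    by metis
  have tlim: "t \<longlonglongrightarrow> 0"
    by (rule tendsto_sandwich[OF _ _ tendsto_const LIMSEQ_Suc[OF LIMSEQ_realpow_zero[of "1/2"]]])
       (use t in \<open>auto intro!: always_eventually less_imp_le\<close>)
  define \<tau> where "\<tau> n = 1 / (real n + 2)" for n
  have \<tau>lim: "\<tau> \<longlonglongrightarrow> 0"
    unfolding \<tau>_def using LIMSEQ_ignore_initial_segment[OF lim_inverse_n', of 2] by (simp add: add_ac)
  obtain T U where TU: "homeomorphism {0..1} {0..1} T U" "T 0 = 0" "strict_mono_on {0..1} T"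
    "\<And>s. s \<in> {1/2..1} \<Longrightarrow> T s = s"
    and aff: "\<And>k s. s \<in> {t (Suc k)..t k} \<Longrightarrow>
       T s = \<tau> (Suc k) + (\<tau> k - \<tau> (Suc k)) * ((s - t (Suc k)) / (t k - t (Suc k)))"
  proof (rule piecewise_affine_homeomorphism[of t \<tau>])
  qed (use t tlim \<tau>lim in \<open>auto simp: \<tau>_def field_simps\<close>)
  have GT: "cyl_homeo (level_map T) (level_map U)" by (rule cyl_homeo_level_map[OF TU(1,2,4)])
  have UT: "U (T s) = s" "T (U s) = s" "0 \<le> U s" "U s \<le> 1" "0 \<le> T s" "T s \<le> 1" if "0 \<le> s" "s \<le> 1" for s
    using TU(1) that by (auto simp: homeomorphism_def)
  have Tt: "T (t k) = \<tau> k" for k using aff[of "t k" k] t(5)[of k] by simp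
  have Tless: "T s < T s'" if "0 \<le> s" "s < s'" "s' \<le> 1" for s s'
    using TU(3) that by (auto simp: strict_mono_on_def)
  have Tle: "T s \<le> T s'" if "0 \<le> s" "s \<le> s'" "s' \<le> 1" for s s'
    using Tless[of s s'] that by (cases "s = s'") auto
  have main: "nice (level_map T \<circ> h \<circ> level_map U)"
    if h: "cyl_homeo h h'" and th: "\<And>n p. p \<in> C \<Longrightarrow> snd p \<le> t (Suc n) \<Longrightarrow> snd (h p) < t n"
      "\<And>n p. p \<in> C \<Longrightarrow> snd p \<le> t (Suc n) \<Longrightarrow> snd (h' p) < t n" for h h'
    unfolding nice_def
  proof (intro allI impI)
    fix \<eta> :: real assume \<eta>: "\<eta> > 0"
    obtain d1 where d1: "d1 > 0" "\<And>p. p \<in> C \<Longrightarrow> snd p \<le> d1 \<Longrightarrow> dist (h p) (fst p, 0) < \<eta>"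
      using cyl_homeo_small[OF h \<eta>] by blast
    obtain d2 where d2: "d2 > 0" "\<And>p. p \<in> C \<Longrightarrow> snd p \<le> d2 \<Longrightarrow> snd (level_map U p) < d1"
      using cyl_homeo_snd_small[OF cyl_homeo_sym[OF GT] d1(1)] by blast
    \<comment> \<open>If \<open>1 / (k + 3) < s \<le> d\<close>, then \<open>k > 3/\<eta>\<close>:
      the height \<open>d\<close> is chosen to make the index of the interval this large.\<close>
    define d where "d = min d2 (1 / (3/\<eta> + 3))"
    show "\<exists>d>0. near \<eta> d (level_map T \<circ> h \<circ> level_map U)"
      unfolding near_def
    proof (intro exI[of _ d] conjI ballI impI)
      show "0 < d" using d2 \<eta> by (simp add: d_def add_pos_pos)
      fix p assume p: "p \<in> C" "snd p \<le> d"
      obtain x s where ps: "p = (x, s)" by fastforce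
      have xs: "x \<in> S" "0 \<le> s" "s \<le> 1" "s \<le> d" using p ps by auto
      define s' where "s' = U s"
      have s': "0 \<le> s'" "s' \<le> 1" "T s' = s" using UT[OF xs(2,3)] by (auto simp: s'_def)
      have pC: "(x, s') \<in> C" using xs s' by simp
      define q where "q = h (x, s')"
      have q: "q \<in> C" unfolding q_def by (rule cyl_homeoD(4)[OF h pC])
      have "s' < d1" using d2(2)[OF p(1)] p(2) by (simp add: d_def level_map_def ps s'_def)
      then have "dist q (x, 0) < \<eta>" using d1(2)[OF pC] by (simp add: q_def)
      then show "dist (fst ((level_map T \<circ> h \<circ> level_map U) p)) (fst p) \<le> \<eta>"
        using dist_fst_le[of q "(x, 0)"] by (simp add: level_map_def ps q_def s'_def)
      show "\<bar>snd ((level_map T \<circ> h \<circ> level_map U) p) - snd p\<bar> \<le> \<eta> * snd p"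
      proof (cases "s' = 0")
        case True
        then have "q = (x, 0)" using cyl_homeoD(8)[OF h xs(1)] by (simp add: q_def)
        moreover have "s = 0" using s' True TU(2) by simp
        ultimately show ?thesis using True TU(2) by (simp add: level_map_def ps q_def s'_def)
      next
        case False
        have "s < 1/3"
        proof -
          have "1 / (3/\<eta> + 3) < 1/3" by (rule frac_less2) (use \<eta> in auto)
          then show ?thesis using xs(4) by (simp add: d_def)
        qed
        then have "s' < t 0" using s' t(3) TU(4)[of s'] by (cases "s' < 1/2") auto
        with False s'(1) obtain k where k: "t (Suc k) < s'" "s' \<le> t k"
          using sequence_bracket[OF tlim, of s'] by auto
        have sb: "\<tau> (Suc k) < s" "s \<le> \<tau> k"
          using Tless[of "t (Suc k)" s'] Tle[of s' "t k"] k s' t(1)[of "Suc k"] t(4)[of k]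
          by (simp_all add: Tt less_imp_le)
        have kb: "3/\<eta> < real k"
        proof -
          have "1 / (real k + 3) < 1 / (3/\<eta> + 3)" using sb(1) xs(4) by (simp add: \<tau>_def d_def add_ac)
          then have "3/\<eta> + 3 < real k + 3" using \<eta> by (simp add: divide_less_cancel frac_less2 field_simps)
          then show ?thesis by simp
        qed
        then have "0 < real k" using \<eta> by (meson divide_pos_pos less_trans zero_less_numeral)
        then obtain j where j: "k = Suc j" by (cases k) auto
        have up: "snd q < t j" using th(1)[OF pC, of j] k j by (simp add: q_def)
        \<comment> \<open>The inverse bounds the descent: from below \<open>t (Suc (Suc k))\<close>
          the map \<open>h'\<close> could not climb back above \<open>t (Suc k)\<close>.\<close>
        have low: "t (Suc (Suc k)) < snd q"
        proof (rule ccontr)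
          assume "\<not> t (Suc (Suc k)) < snd q"
          then have "snd (h' q) < t (Suc k)" using th(2)[OF q, of "Suc k"] by simp
          then show False using cyl_homeoD(6)[OF h pC] k by (simp add: q_def)
        qed
        have Tq: "\<tau> (Suc (Suc k)) \<le> T (snd q)" "T (snd q) \<le> \<tau> j"
          using Tle[of "t (Suc (Suc k))" "snd q"] Tle[of "snd q" "t j"] up low C_snd[OF q] t(1)[of "Suc (Suc k)"] t(4)[of j]
          by (simp_all add: Tt less_imp_le)
        \<comment> \<open>The old and the new height lie within three consecutive intervals; their
          total length \<open>3 / ((K + 1) * (K + 4))\<close> is compared with
          \<open>\<eta> / (K + 3)\<close>.\<close>
        have "\<bar>T (snd q) - s\<bar> \<le> \<tau> j - \<tau> (Suc (Suc k))"
        proof -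
          have "\<tau> (Suc (Suc k)) \<le> s" "s \<le> \<tau> j" using sb by (auto simp: \<tau>_def j field_simps)
          then show ?thesis using Tq by linarith
        qed
        also have "\<dots> \<le> \<eta> * \<tau> (Suc k)"
        proof -
          define K where "K = real k"
          have K: "3 < \<eta> * K" "K > 0" using kb \<eta> \<open>0 < real k\<close> by (simp_all add: K_def field_simps)
          have e1: "\<tau> j = 1 / (K + 1)" "\<tau> (Suc (Suc k)) = 1 / (K + 4)" "\<tau> (Suc k) = 1 / (K + 3)"
            by (simp_all add: \<tau>_def j K_def add_ac)
          have "1 / (K + 1) - 1 / (K + 4) = 3 / ((K + 1) * (K + 4))"
            using K by (simp add: field_simps)
          also have "\<dots> \<le> (\<eta> * K) / ((K + 1) * (K + 4))"
            using K by (intro divide_right_mono) auto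
          also have "\<dots> \<le> (\<eta> * (K + 1)) / ((K + 1) * (K + 3))"
            using K \<eta> by (intro frac_le) auto
          also have "\<dots> = \<eta> * (1 / (K + 3))" using K by simp
          finally show ?thesis unfolding e1 .
        qed
        also have "\<dots> \<le> \<eta> * s" using sb \<eta> by (intro mult_left_mono) auto
        finally show ?thesis by (simp add: level_map_def ps q_def s'_def)
      qed
    qed
  qed
  from that[OF GT main[OF fg tf tg] main[OF cyl_homeo_sym[OF fg] tg tf]] show ?thesis by blast
qed

lemma comm_conjugate:
  assumes "cyl_homeo T U" "cyl_homeo \<phi> \<phi>'" "cyl_homeo F F'" "cyl_homeo P Q" "p \<in> C"
  shows "U (comm \<phi> \<phi>' F F' P Q (T p)) = comm \<phi> \<phi>' (U \<circ> F \<circ> T) (U \<circ> F' \<circ> T) (U \<circ> P) (Q \<circ> T) p"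
  by (simp add: comm_def cyl_homeoD(4-7)[OF assms(1)] cyl_homeoD(4,5)[OF assms(2)] cyl_homeoD(5)[OF assms(3)]
      cyl_homeoD(4,5)[OF assms(4)] assms(5))

text \<open>\<open>\<phi>\<close> is fixed before \<open>f\<close>, which is the source of a uniform
  norm bound. The change of height that makes \<open>f\<close> nice is undone inside the
  commutators, where it is absorbed into \<open>F\<close> and \<open>T\<close>.\<close>

theorem germ_commutators:
  "\<exists>\<phi> \<phi>'. cyl_homeo \<phi> \<phi>' \<and> (\<forall>f g. cyl_homeo f g \<longrightarrow> (\<exists>F\<^sub>1 F\<^sub>1' T\<^sub>1 U\<^sub>1 F\<^sub>2 F\<^sub>2' T\<^sub>2 U\<^sub>2.
     cyl_homeo F\<^sub>1 F\<^sub>1' \<and> cyl_homeo T\<^sub>1 U\<^sub>1 \<and> cyl_homeo F\<^sub>2 F\<^sub>2' \<and> cyl_homeo T\<^sub>2 U\<^sub>2 \<and>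
     germ_eq f (comm \<phi> \<phi>' F\<^sub>1 F\<^sub>1' T\<^sub>1 U\<^sub>1 \<circ> comm \<phi> \<phi>' F\<^sub>2 F\<^sub>2' T\<^sub>2 U\<^sub>2)))"
proof -
  \<comment> \<open>\<open>t\<close> is \<open>1/2, 1/16, 1/64, ...\<close> and
    \<open>\<tau>\<close> is \<open>1/2, 1/4, 1/16, ...\<close>. Apart from the common starting
    point \<open>\<tau> k = 4 * t k\<close>, so the map multiplies heights up to \<open>1/16\<close>
    by 4.\<close>
  define t :: "nat \<Rightarrow> real" where "t k = (if k = 0 then 1/2 else (1/4)^(k + 1))" for k
  define \<tau> :: "nat \<Rightarrow> real" where "\<tau> k = (if k = 0 then 1/2 else (1/4)^k)" for k
  have lim4: "(\<lambda>k. (1/4)^k) \<longlonglongrightarrow> (0::real)" by (rule LIMSEQ_realpow_zero) auto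
  have tlim: "t \<longlonglongrightarrow> 0"
    using LIMSEQ_Suc[OF lim4] by (rule Lim_transform_eventually) (auto simp: t_def eventually_sequentially intro!: exI[of _ 1])
  have \<tau>lim: "\<tau> \<longlonglongrightarrow> 0"
    using lim4 by (rule Lim_transform_eventually) (auto simp: \<tau>_def eventually_sequentially intro!: exI[of _ 1])
  obtain A B where AB: "homeomorphism {0..1} {0..1} A B" "A 0 = 0" "\<And>s. s \<in> {1/2..1} \<Longrightarrow> A s = s"
    and aff: "\<And>k s. s \<in> {t (Suc k)..t k} \<Longrightarrow>
       A s = \<tau> (Suc k) + (\<tau> k - \<tau> (Suc k)) * ((s - t (Suc k)) / (t k - t (Suc k)))"
  proof (rule piecewise_affine_homeomorphism[of t \<tau>])
  qed (use tlim \<tau>lim in \<open>auto simp: t_def \<tau>_def\<close>)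
  have A4: "A s = 4 * s" if s: "0 \<le> s" "s \<le> 1/16" for s
  proof (cases "s = 0")
    case False
    have "s \<le> t (Suc 0)" using s by (simp add: t_def power2_eq_square)
    with LIMSEQ_Suc[OF tlim] False s(1) obtain k where k: "t (Suc (Suc k)) < s" "s \<le> t (Suc k)"
      using sequence_bracket[of "\<lambda>k. t (Suc k)" s] by auto
    have "\<tau> (Suc k) = 4 * t (Suc k)" "\<tau> (Suc (Suc k)) = 4 * t (Suc (Suc k))" "t (Suc k) = 4 * t (Suc (Suc k))"
      "0 < t (Suc (Suc k))" by (simp_all add: t_def \<tau>_def)
    then show ?thesis using aff[of s "Suc k"] k by (simp add: field_simps)
  qed (simp add: AB)
  have \<phi>: "cyl_homeo (level_map A) (level_map B)" by (rule cyl_homeo_level_map[OF AB])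
  have \<phi>4: "level_map A p = (fst p, 4 * snd p)" if "p \<in> C" "snd p \<le> 1/16" for p
    using A4[of "snd p"] C_snd[OF that(1)] that(2) by (simp add: level_map_def)
  show ?thesis
  proof (rule exI[of _ "level_map A"], rule exI[of _ "level_map B"], rule conjI[OF \<phi>], intro allI impI)
    fix f g assume fg: "cyl_homeo f g"
    obtain T U where TU: "cyl_homeo (level_map T) (level_map U)" "nice (level_map T \<circ> f \<circ> level_map U)" "nice (level_map T \<circ> g \<circ> level_map U)"
      using nice_conjugate[OF fg] by blast
    let ?f = "level_map T \<circ> f \<circ> level_map U" and ?g = "level_map T \<circ> g \<circ> level_map U"
    have Gf: "cyl_homeo ?f ?g" using cyl_homeo_comp[OF cyl_homeo_comp[OF TU(1) fg] cyl_homeo_sym[OF TU(1)]] by (simp add: o_assoc)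
    obtain d1 d2 where "d1 > 0" "near (1/2) d1 ?f" "d2 > 0" "near (1/2) d2 ?g"
      using TU(2,3) unfolding nice_def by (meson half_gt_zero_iff zero_less_one)
    then have "cylinder_map S ?f ?g (min 1 (min d1 d2))"
      using Gf by unfold_locales (auto intro: near_mono)
    from cylinder_map.nice_germ[OF this TU(2,3) \<phi> \<phi>4]
    obtain F1 F1' T1 U1 F2 F2' T2 U2 where
      G: "cyl_homeo F1 F1'" "cyl_homeo T1 U1" "cyl_homeo F2 F2'" "cyl_homeo T2 U2" and
      eq: "germ_eq ?f (comm (level_map A) (level_map B) F1 F1' T1 U1 \<circ> comm (level_map A) (level_map B) F2 F2' T2 U2)"
      by blast
    let ?c1 = "comm (level_map A) (level_map B) F1 F1' T1 U1" and ?c2 = "comm (level_map A) (level_map B) F2 F2' T2 U2"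
    let ?d1 = "comm (level_map A) (level_map B) (level_map U \<circ> F1 \<circ> level_map T) (level_map U \<circ> F1' \<circ> level_map T) (level_map U \<circ> T1) (U1 \<circ> level_map T)"
    let ?d2 = "comm (level_map A) (level_map B) (level_map U \<circ> F2 \<circ> level_map T) (level_map U \<circ> F2' \<circ> level_map T) (level_map U \<circ> T2) (U2 \<circ> level_map T)"
    obtain h1 h2 where h: "cyl_homeo ?c1 h1" "cyl_homeo ?c2 h2" using cyl_homeo_comm[OF \<phi>] G by meson
    have e2: "germ_eq (level_map U \<circ> ?f \<circ> level_map T) (level_map U \<circ> (?c1 \<circ> ?c2) \<circ> level_map T)"
      by (intro germ_eq_comp[OF germ_eq_comp[OF germ_eq_refl eq cyl_homeo_comp[OF h]] germ_eq_refl TU(1)])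
    have e1: "germ_eq f (level_map U \<circ> ?f \<circ> level_map T)"
      unfolding germ_eq_def
      by (intro exI[of _ 1]) (auto simp: cyl_homeoD(6)[OF TU(1)] cyl_homeoD(4)[OF fg])
    have e3: "germ_eq (level_map U \<circ> (?c1 \<circ> ?c2) \<circ> level_map T) (?d1 \<circ> ?d2)"
      unfolding germ_eq_def
    proof (intro exI[of _ 1] conjI ballI impI)
      fix p assume p: "p \<in> C"
      have "?d1 (?d2 p) = ?d1 (level_map U (?c2 (level_map T p)))"
        by (simp only: comm_conjugate[OF TU(1) \<phi> G(3,4) p])
      also have "\<dots> = level_map U (?c1 (level_map T (level_map U (?c2 (level_map T p)))))"
        by (intro comm_conjugate[OF TU(1) \<phi> G(1,2), symmetric] cyl_homeoD(5)[OF TU(1)] cyl_homeoD(4)[OF h(2)] cyl_homeoD(4)[OF TU(1)] p)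
      also have "\<dots> = level_map U (?c1 (?c2 (level_map T p)))"
        by (simp add: cyl_homeoD(7)[OF TU(1)] cyl_homeoD(4)[OF h(2)] cyl_homeoD(4)[OF TU(1)] p)
      finally show "(level_map U \<circ> (?c1 \<circ> ?c2) \<circ> level_map T) p = (?d1 \<circ> ?d2) p" by simp
    qed simp
    have e: "germ_eq f (?d1 \<circ> ?d2)" by (rule germ_eq_trans[OF e1 germ_eq_trans[OF e2 e3]])
    have "cyl_homeo (level_map U \<circ> F1 \<circ> level_map T) (level_map U \<circ> F1' \<circ> level_map T)" "cyl_homeo (level_map U \<circ> F2 \<circ> level_map T) (level_map U \<circ> F2' \<circ> level_map T)"
      "cyl_homeo (level_map U \<circ> T1) (U1 \<circ> level_map T)" "cyl_homeo (level_map U \<circ> T2) (U2 \<circ> level_map T)"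
      using cyl_homeo_comp[OF cyl_homeo_comp[OF cyl_homeo_sym[OF TU(1)] G(1)] TU(1)] cyl_homeo_comp[OF cyl_homeo_comp[OF cyl_homeo_sym[OF TU(1)] G(3)] TU(1)]
        cyl_homeo_comp[OF cyl_homeo_sym[OF TU(1)] G(2)] cyl_homeo_comp[OF cyl_homeo_sym[OF TU(1)] G(4)] by (simp_all add: o_assoc)
    with e show "\<exists>F1 F1' T1 U1 F2 F2' T2 U2. cyl_homeo F1 F1' \<and> cyl_homeo T1 U1 \<and> cyl_homeo F2 F2' \<and> cyl_homeo T2 U2 \<and>
        germ_eq f (comm (level_map A) (level_map B) F1 F1' T1 U1 \<circ> comm (level_map A) (level_map B) F2 F2' T2 U2)"
      by blast
  qed
qed

end

section \<open>Homeomorphisms near a collar\<close>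

lemma continuous_map_open_cover:
  assumes "openin X U" "openin X V" "topspace X \<subseteq> U \<union> V"
    and "continuous_map (subtopology X U) Y f" "continuous_map (subtopology X V) Y f"
  shows "continuous_map X Y f"
  by (rule pasting_lemma[of "{U, V}" X id Y "\<lambda>_. f"]) (use assms in auto)

lemma continuous_map_closed_cover:
  assumes "closedin X U" "closedin X V" "topspace X \<subseteq> U \<union> V"
    and "continuous_map (subtopology X U) Y f" "continuous_map (subtopology X V) Y f"
  shows "continuous_map X Y f"
  by (rule pasting_lemma_closed[of "{U, V}" X id Y "\<lambda>_. f"]) (use assms in auto)

abbreviation unit_interval :: "real topology" where "unit_interval \<equiv> top_of_set {0..1}"

lemma continuous_map_slice:
  assumes "continuous_map (prod_topology X unit_interval) Y (\<lambda>(z, t). h t z)" "t \<in> {0..1}"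
  shows "continuous_map X Y (h t)"
proof -
  have "continuous_map X (prod_topology X unit_interval) (\<lambda>z. (z, t))"
    using assms(2) by (simp add: continuous_map_pairwise o_def)
  from continuous_map_compose[OF this assms(1)] show ?thesis by (simp add: o_def)
qed

lemma isotopyD:
  assumes "compactly_supported_isotopy N h" "t \<in> {0..1}"
  shows "h t \<in> homeos N"
  using assms by (auto simp: compactly_supported_isotopy_def isotopy_def)

lemma homeosD:
  assumes "g \<in> homeos N"
  shows "g \<in> extensional (topspace N)" "continuous_map N N g" "z \<in> topspace N \<Longrightarrow> g z \<in> topspace N"
    "inj_on g (topspace N)" "g ` topspace N = topspace N"
  using assms homeos_Bij[OF assms]
  by (auto simp: homeos_def homeomorphic_imp_continuous_map Bij_def bij_betw_def
      dest!: homeomorphic_imp_continuous_map continuous_map_image_subset_topspace)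

lemma homeosI:
  assumes "g \<in> extensional (topspace N)" "continuous_map N N g" "continuous_map N N g'"
    and "\<And>z. z \<in> topspace N \<Longrightarrow> g' (g z) = z" "\<And>z. z \<in> topspace N \<Longrightarrow> g (g' z) = z"
  shows "g \<in> homeos N"
  unfolding homeos_def using assms
  by (auto intro!: homeomorphic_maps_imp_map[of N N g g'] simp: homeomorphic_maps_def)

text \<open>The setting is purely topological: the image of the bottom stands in for the manifold
  boundary. Openness of the lower parts of the collar ties it to \<open>M\<close> and makes
  \<open>level\<close> continuous.\<close>

locale collar = cylinder S for S :: "'b::complete_space set" +
  fixes M :: "'a topology" and c :: "'b \<times> real \<Rightarrow> 'a"
  assumes Hausdorff: "Hausdorff_space M"
    and continuous_c: "continuous_map (top_of_set C) M c"
    and inj_c: "inj_on c C"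
    and open_c: "\<And>r. 0 < r \<Longrightarrow> r \<le> 1 \<Longrightarrow> openin M (c ` (S \<times> {0..<r}))"
begin

definition bd :: "'a set" where "bd = c ` (S \<times> {0})"
definition ci :: "'a \<Rightarrow> 'b \<times> real" where "ci = inv_into C c"
text \<open>The default 1 continues the height continuously beyond the collar, and
  \<open>level z < 1\<close> means lying in its half-open part.\<close>

definition level :: "'a \<Rightarrow> real" where "level z = (if z \<in> c ` C then snd (ci z) else 1)"
definition ext :: "('b \<times> real \<Rightarrow> 'b \<times> real) \<Rightarrow> 'a \<Rightarrow> 'a" where
  "ext f = (\<lambda>z \<in> topspace M. if z \<in> c ` C then c (f (ci z)) else z)"

lemma c_top: "p \<in> C \<Longrightarrow> c p \<in> topspace M"
  using continuous_map_image_subset_topspace[OF continuous_c] by auto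

lemma ci_c [simp]: "p \<in> C \<Longrightarrow> ci (c p) = p"
  by (simp add: ci_def inj_c inv_into_f_f)

lemma c_ci: "z \<in> c ` C \<Longrightarrow> c (ci z) = z" "z \<in> c ` C \<Longrightarrow> ci z \<in> C"
  by (auto simp: ci_def f_inv_into_f inv_into_into)

lemma level_c [simp]: "p \<in> C \<Longrightarrow> level (c p) = snd p"
  by (simp add: level_def)

lemma ext_c [simp]: "p \<in> C \<Longrightarrow> ext f (c p) = c (f p)"
  by (simp add: ext_def c_top)

lemma ext_out: "z \<in> topspace M \<Longrightarrow> z \<notin> c ` C \<Longrightarrow> ext f z = z"
  by (simp add: ext_def)

lemma ext_extensional: "ext f \<in> extensional (topspace M)"
  by (simp add: ext_def)

lemma level_bounds: "0 \<le> level z" "level z \<le> 1"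
  using C_snd[OF c_ci(2)] by (auto simp: level_def)

lemma level_less_1: "level z < 1 \<Longrightarrow> z \<in> c ` C"
  by (auto simp: level_def split: if_splits)

lemma closed_c: "closed D \<Longrightarrow> D \<subseteq> C \<Longrightarrow> closedin M (c ` D)"
  and compact_c: "closed D \<Longrightarrow> D \<subseteq> C \<Longrightarrow> compactin M (c ` D)"
proof -
  assume "closed D" "D \<subseteq> C"
  then have "compactin (top_of_set C) D"
    using compact_Int_closed[OF compact_C, of D] by (simp add: compactin_subtopology Int_absorb1)
  then show "compactin M (c ` D)" by (rule image_compactin[OF _ continuous_c])
  then show "closedin M (c ` D)" by (rule compactin_imp_closedin[OF Hausdorff])
qed

lemma closed_cC: "closedin M (c ` C)" "compactin M (c ` C)"
  by (auto intro!: closed_c compact_c compact_imp_closed compact_C)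

lemma continuous_ci: "continuous_map (subtopology M (c ` C)) (top_of_set C) ci"
proof -
  have "closed_map (top_of_set C) M c"
    by (rule continuous_imp_closed_map_gen[OF _ Hausdorff_imp_kc_space[OF Hausdorff] continuous_c])
       (simp add: compact_space_subtopology compact_C)
  then have "homeomorphic_map (top_of_set C) (subtopology M (c ` C)) c"
    using injective_closed_imp_embedding_map[OF continuous_c] inj_c by (simp add: embedding_map_def)
  then obtain g where g: "homeomorphic_maps (top_of_set C) (subtopology M (c ` C)) c g"
    using homeomorphic_map_maps by blast
  then have "continuous_map (subtopology M (c ` C)) (top_of_set C) g" by (simp add: homeomorphic_maps_def)
  then show ?thesis
  proof (rule continuous_map_eq)
    fix z assume "z \<in> topspace (subtopology M (c ` C))"
    then obtain p where "p \<in> C" "z = c p" by auto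
    then show "g z = ci z" using g by (simp add: homeomorphic_maps_def)
  qed
qed

lemma continuous_level: "continuous_map M euclideanreal level"
proof (rule continuous_map_closed_cover)
  show "closedin M (c ` C)" by (rule closed_cC)
  have "openin M (c ` (S \<times> {0..<1}))" by (rule open_c) auto
  then show "closedin M (topspace M - c ` (S \<times> {0..<1}))" by blast
  show "topspace M \<subseteq> c ` C \<union> (topspace M - c ` (S \<times> {0..<1}))" by (auto simp: C_def)
  have "continuous_map (top_of_set C) euclideanreal snd" by (simp add: continuous_on_snd continuous_on_id)
  from continuous_map_compose[OF continuous_ci this]
  show "continuous_map (subtopology M (c ` C)) euclideanreal level"
    by (rule continuous_map_eq) (auto simp: level_def)
  show "continuous_map (subtopology M (topspace M - c ` (S \<times> {0..<1}))) euclideanreal level"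
  proof (rule continuous_map_eq)
    show "continuous_map (subtopology M (topspace M - c ` (S \<times> {0..<1}))) euclideanreal (\<lambda>_. 1)" by simp
    fix z assume z: "z \<in> topspace (subtopology M (topspace M - c ` (S \<times> {0..<1})))"
    show "1 = level z"
    proof (cases "z \<in> c ` C")
      case True
      then obtain x s where "z = c (x, s)" "(x, s) \<in> C" by auto
      then show ?thesis using z by force
    qed (simp add: level_def)
  qed
qed

lemma level_0: "z \<in> bd \<longleftrightarrow> z \<in> topspace M \<and> level z = 0"
proof
  show "z \<in> bd \<Longrightarrow> z \<in> topspace M \<and> level z = 0"
    using c_top by (auto simp: bd_def)
  assume "z \<in> topspace M \<and> level z = 0"
  then have "z \<in> c ` C" "level z = 0" using level_less_1[of z] by auto
  then obtain x s where "z = c (x, s)" "(x, s) \<in> C" "s = 0" by auto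
  then show "z \<in> bd" by (auto simp: bd_def)
qed

lemma closed_bd: "closedin M bd"
  unfolding bd_def by (rule closed_c) (auto simp: C_def compact_base compact_imp_closed closed_Times)

lemma bd_sub: "bd \<subseteq> topspace M" using level_0 by blast

text \<open>The family is glued over two open sets: the half-open collar and the complement of the
  part up to height \<open>1/2\<close>, on which it is the identity. Joint continuity in
  \<open>t\<close> serves isotopies; single maps are constant families.\<close>

lemma continuous_ext:
  assumes "continuous_on (C \<times> {0..1}) (\<lambda>(p, t). \<Phi> t p)" "\<And>t p. t \<in> {0..1} \<Longrightarrow> p \<in> C \<Longrightarrow> \<Phi> t p \<in> C"
    and "\<And>t x s. t \<in> {0..1::real} \<Longrightarrow> x \<in> S \<Longrightarrow> 1/2 \<le> s \<Longrightarrow> s \<le> 1 \<Longrightarrow> \<Phi> t (x, s) = (x, s)"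
  shows "continuous_map (prod_topology M unit_interval) M (\<lambda>(z, t). ext (\<Phi> t) z)"
proof (rule continuous_map_open_cover)
  let ?P = "prod_topology M unit_interval"
  let ?U = "c ` (S \<times> {0..<1}) \<times> {0..1::real}" and ?V = "(topspace M - c ` (S \<times> {0..1/2})) \<times> {0..1::real}"
  have I: "openin unit_interval {0..1}" by simp
  show "openin ?P ?U" by (simp add: openin_prod_Times_iff open_c I)
  have "closedin M (c ` (S \<times> {0..1/2}))"
    by (rule closed_c) (auto intro: closed_Times compact_imp_closed compact_base)
  then have "openin M (topspace M - c ` (S \<times> {0..1/2}))" by blast
  then show "openin ?P ?V" by (simp add: openin_prod_Times_iff I)
  have "inj_on c (S \<times> {0..1})" using inj_c by (simp add: C_def)
  then show "topspace ?P \<subseteq> ?U \<union> ?V" by (auto simp: inj_on_def)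
  show "continuous_map (subtopology ?P ?V) M (\<lambda>(z, t). ext (\<Phi> t) z)"
  proof (rule continuous_map_eq)
    show "continuous_map (subtopology ?P ?V) M fst" by (intro continuous_map_from_subtopology continuous_map_fst)
    fix w assume "w \<in> topspace (subtopology ?P ?V)"
    then obtain z t where w: "w = (z, t)" "z \<in> topspace M" "t \<in> {0..1}" "z \<notin> c ` (S \<times> {0..1/2})" by auto
    show "fst w = (\<lambda>(z, t). ext (\<Phi> t) z) w"
    proof (cases "z \<in> c ` C")
      case True
      then obtain x s where xs: "z = c (x, s)" "(x, s) \<in> C" by auto
      then have "1/2 \<le> s" using w(4) by force
      then show ?thesis using w xs assms(3)[OF w(3), of x s] by simp
    qed (use w in \<open>simp add: ext_out\<close>)
  qed
  have sub: "c ` (S \<times> {0..<1}) \<subseteq> c ` C" by (auto simp: C_def)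
  have "continuous_map (subtopology ?P ?U) (top_of_set (C \<times> {0..1})) (\<lambda>w. (ci (fst w), snd w))"
  proof -
    have "continuous_map (subtopology ?P ?U) (subtopology M (c ` C)) fst"
      using sub by (auto simp: continuous_map_in_subtopology intro!: continuous_map_from_subtopology continuous_map_fst)
    from continuous_map_compose[OF this continuous_ci]
    have "continuous_map (subtopology ?P ?U) (top_of_set C) (\<lambda>w. ci (fst w))" by (simp add: o_def)
    moreover have "continuous_map (subtopology ?P ?U) unit_interval snd"
      by (intro continuous_map_from_subtopology continuous_map_snd)
    ultimately have "continuous_map (subtopology ?P ?U) (prod_topology (top_of_set C) unit_interval) (\<lambda>w. (ci (fst w), snd w))"
      unfolding continuous_map_pairwise o_def by simp
    then show ?thesis by simp
  qed
  moreover have "continuous_map (top_of_set (C \<times> {0..1})) (top_of_set C) (\<lambda>(p, t). \<Phi> t p)"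
    using assms(1,2) by (auto simp: continuous_map_in_subtopology)
  ultimately have "continuous_map (subtopology ?P ?U) (top_of_set C) ((\<lambda>(p, t). \<Phi> t p) \<circ> (\<lambda>w. (ci (fst w), snd w)))"
    by (rule continuous_map_compose)
  from continuous_map_compose[OF this continuous_c]
  show "continuous_map (subtopology ?P ?U) M (\<lambda>(z, t). ext (\<Phi> t) z)"
    by (rule continuous_map_eq) (use sub in \<open>auto simp: ext_def C_def\<close>)
qed

lemma continuous_ext1:
  assumes "continuous_on C f" "\<And>p. p \<in> C \<Longrightarrow> f p \<in> C"
    and "\<And>x s. x \<in> S \<Longrightarrow> 1/2 \<le> s \<Longrightarrow> s \<le> 1 \<Longrightarrow> f (x, s) = (x, s)"
  shows "continuous_map M M (ext f)"
proof -
  have "continuous_on (C \<times> {0..1::real}) (\<lambda>(p, t). f p)"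
    unfolding case_prod_unfold by (rule continuous_on_compose2[OF assms(1)]) (auto intro: continuous_intros)
  from continuous_ext[OF this assms(2,3)]
  have "continuous_map (prod_topology M unit_interval) M (\<lambda>(z, t). ext f z)" by simp
  from continuous_map_slice[OF this, of 0] show ?thesis by simp
qed

lemma ext_ext:
  assumes "\<And>p. p \<in> C \<Longrightarrow> g p \<in> C" "z \<in> topspace M"
  shows "ext f (ext g z) = ext (f \<circ> g) z"
  using assms by (cases "z \<in> c ` C") (auto simp: ext_out)

lemma ext_id: "(\<And>p. p \<in> C \<Longrightarrow> f p = p) \<Longrightarrow> z \<in> topspace M \<Longrightarrow> ext f z = z"
  by (cases "z \<in> c ` C") (auto simp: ext_out)

text \<open>Unlike for \<open>cyl_homeo\<close> the bottom may move, as it does for extended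
  isotopies of the boundary.\<close>

definition top_fixing :: "('b \<times> real \<Rightarrow> 'b \<times> real) \<Rightarrow> bool" where
  "top_fixing f \<longleftrightarrow> (\<exists>g. homeomorphism C C f g) \<and> (\<forall>x\<in>S. \<forall>s\<in>{1/2..1}. f (x, s) = (x, s))"

lemma cyl_homeo_top_fixing: "cyl_homeo f g \<Longrightarrow> top_fixing f"
  by (auto simp: cyl_homeo_def top_fixing_def)

lemma top_fixing_mem: "top_fixing f \<Longrightarrow> p \<in> C \<Longrightarrow> f p \<in> C"
  unfolding top_fixing_def homeomorphism_def by blast

lemma ext_homeos:
  assumes "top_fixing f"
  shows "ext f \<in> homeos M"
proof -
  obtain g where g: "homeomorphism C C f g" and ff: "\<And>x s. x \<in> S \<Longrightarrow> 1/2 \<le> s \<Longrightarrow> s \<le> 1 \<Longrightarrow> f (x, s) = (x, s)"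
    using assms by (auto simp: top_fixing_def)
  note D = g[unfolded homeomorphism_def]
  have gg: "g (x, s) = (x, s)" if "x \<in> S" "1/2 \<le> s" "s \<le> 1" for x s
    using D ff[OF that] that by (metis mem_C order_trans[of 0 "1/2" s] zero_le_divide_1_iff zero_le_numeral)
  have fg: "p \<in> C \<Longrightarrow> f p \<in> C" "p \<in> C \<Longrightarrow> g p \<in> C" "p \<in> C \<Longrightarrow> g (f p) = p" "p \<in> C \<Longrightarrow> f (g p) = p" for p
    using D by auto
  show ?thesis
  proof (rule homeosI[OF ext_extensional continuous_ext1 continuous_ext1])
    show "ext g (ext f z) = z" if "z \<in> topspace M" for z
      using that by (subst ext_ext) (auto simp: fg intro: ext_id)
    show "ext f (ext g z) = z" if "z \<in> topspace M" for z
      using that by (subst ext_ext) (auto simp: fg intro: ext_id)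
  qed (use D fg ff gg in auto)
qed

lemma ext_supp: "supp M (ext f) \<subseteq> c ` C"
proof -
  have "{z \<in> topspace M. ext f z \<noteq> z} \<subseteq> c ` C" using ext_out by auto
  then show ?thesis unfolding supp_def using closed_cC(1) by (rule closure_of_minimal)
qed

lemma ext_isotopy:
  assumes "continuous_on (C \<times> {0..1}) (\<lambda>(p, t). \<Phi> t p)" "\<And>t. t \<in> {0..1} \<Longrightarrow> top_fixing (\<Phi> t)"
  shows "compactly_supported_isotopy M (\<lambda>t. ext (\<Phi> t))"
proof (rule compactly_supported_isotopyI[OF ext_homeos[OF assms(2)] _ closed_cC(2) ext_supp])
  show "continuous_map (prod_topology M unit_interval) M (\<lambda>(z, t). ext (\<Phi> t) z)"
    by (rule continuous_ext[OF assms(1) top_fixing_mem[OF assms(2)]]) (use assms(2) in \<open>auto simp: top_fixing_def\<close>)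
qed

section \<open>Cutting off homeomorphisms of the manifold\<close>

abbreviation cylinder_topology :: "('a \<times> real) topology" where
  "cylinder_topology \<equiv> prod_topology M unit_interval"

definition up :: "real \<Rightarrow> 'a \<Rightarrow> 'a" where "up e = ext (\<lambda>p. (fst p, raise e (snd p)))"
definition dn :: "real \<Rightarrow> 'a \<Rightarrow> 'a" where "dn e = ext (\<lambda>p. (fst p, sink e (snd p)))"

text \<open>The analogue of \<open>cut\<close> for homeomorphisms of \<open>M\<close>. These may
  leave the collar, so the height maps are extended to \<open>M\<close> instead of reading
  \<open>g\<close> in collar coordinates.\<close>

definition mcut :: "('a \<Rightarrow> 'a) \<Rightarrow> real \<Rightarrow> 'a \<Rightarrow> 'a" where
  "mcut g e = (\<lambda>z \<in> topspace M. if level z \<le> e/2 then z else up e (g (dn e z)))"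

definition fixes_bd :: "('a \<Rightarrow> 'a) \<Rightarrow> bool" where
  "fixes_bd g \<longleftrightarrow> g \<in> homeos M \<and> (\<forall>z\<in>bd. g z = z)"

definition isotopic_rel :: "('a \<Rightarrow> 'a) \<Rightarrow> bool" where
  "isotopic_rel g \<longleftrightarrow> g \<in> homeos M \<and> (\<exists>h. compactly_supported_isotopy M h \<and> h 0 = (\<lambda>z \<in> topspace M. z) \<and> h 1 = g \<and>
     (\<forall>t\<in>{0..1}. \<forall>z\<in>bd. h t z = z))"

definition germ :: "('a \<Rightarrow> 'a) \<Rightarrow> ('a \<Rightarrow> 'a) \<Rightarrow> bool" where
  "germ g h \<longleftrightarrow> (\<exists>d>0. \<forall>z\<in>topspace M. level z \<le> d \<longrightarrow> g z = h z)"

context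
  fixes e :: real
  assumes e: "0 \<le> e" "e \<le> 1/2"
begin

lemma level_maps:
  "p \<in> C \<Longrightarrow> (fst p, raise e (snd p)) \<in> C" "p \<in> C \<Longrightarrow> (fst p, sink e (snd p)) \<in> C"
  using e C_fst[of p] C_snd[of p] raise_nonneg[of "snd p" e] raise_le[of "snd p" e] sink_bounds[of "snd p" e] by auto

lemma up_mem: "z \<in> topspace M \<Longrightarrow> up e z \<in> topspace M"
  and dn_mem: "z \<in> topspace M \<Longrightarrow> dn e z \<in> topspace M"
  using level_maps by (cases "z \<in> c ` C"; auto simp: up_def dn_def ext_out simp del: mem_C intro!: c_top)+

lemma level_up: "z \<in> topspace M \<Longrightarrow> level (up e z) = raise e (level z)"
  and level_dn: "z \<in> topspace M \<Longrightarrow> level (dn e z) = sink e (level z)"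
proof -
  \<comment> \<open>The default level 1 outside the collar is a fixed point of both height
    maps.\<close>
  have 1: "raise e 1 = 1" "sink e 1 = 1" using e by (auto simp: raise_def sink_def)
  assume z: "z \<in> topspace M"
  have "level (up e z) = raise e (level z) \<and> level (dn e z) = sink e (level z)"
  proof (cases "z \<in> c ` C")
    case True
    then obtain p where p: "p \<in> C" "z = c p" by auto
    then show ?thesis using level_c[OF level_maps(1)[OF p(1)]] level_c[OF level_maps(2)[OF p(1)]]
      by (simp only: up_def dn_def ext_c level_c) simp
  next
    case False
    then show ?thesis using 1 by (simp add: up_def dn_def ext_out[OF z False] level_def)
  qed
  then show "level (up e z) = raise e (level z)" "level (dn e z) = sink e (level z)" by auto
qed

lemma up_dn: "z \<in> topspace M \<Longrightarrow> e/2 \<le> level z \<Longrightarrow> up e (dn e z) = z"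
  and dn_up: "z \<in> topspace M \<Longrightarrow> dn e (up e z) = z"
  and up_id: "z \<in> topspace M \<Longrightarrow> e \<le> level z \<Longrightarrow> up e z = z"
  and dn_id: "z \<in> topspace M \<Longrightarrow> e \<le> level z \<Longrightarrow> dn e z = z"
proof -
  assume z: "z \<in> topspace M"
  have "(e/2 \<le> level z \<longrightarrow> up e (dn e z) = z) \<and> dn e (up e z) = z \<and> (e \<le> level z \<longrightarrow> up e z = z \<and> dn e z = z)"
  proof (cases "z \<in> c ` C")
    case True
    then obtain p where p: "p \<in> C" "z = c p" by auto
    note s = C_snd[OF p(1)]
    have "ext f (c p) = c (f p)" for f by (rule ext_c[OF p(1)])
    moreover have "ext f (c (fst p, raise e (snd p))) = c (f (fst p, raise e (snd p)))"
      "ext f (c (fst p, sink e (snd p))) = c (f (fst p, sink e (snd p)))" for f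
      using level_maps[OF p(1)] by (simp_all only: ext_c)
    moreover have "level z = snd p" using p by simp
    ultimately show ?thesis unfolding up_def dn_def p(2)
      using s e by (simp add: raise_sink sink_raise raise_id sink_id)
  qed (use z in \<open>simp add: up_def dn_def ext_out\<close>)
  then show "e/2 \<le> level z \<Longrightarrow> up e (dn e z) = z" "dn e (up e z) = z"
    "e \<le> level z \<Longrightarrow> up e z = z" "e \<le> level z \<Longrightarrow> dn e z = z" by auto
qed

end

lemma fixes_bdD:
  assumes "fixes_bd g"
  shows "g \<in> homeos M" "z \<in> bd \<Longrightarrow> g z = z" "z \<in> topspace M \<Longrightarrow> g z \<in> topspace M"
    "continuous_map M M g" "inj_on g (topspace M)" "g ` topspace M = topspace M" "g \<in> extensional (topspace M)"
  using assms homeosD[of g M] by (auto simp: fixes_bd_def)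

lemma fixes_bd_ext: "cyl_homeo f f' \<Longrightarrow> fixes_bd (ext f)"
  unfolding fixes_bd_def by (auto intro!: ext_homeos cyl_homeo_top_fixing simp: bd_def cyl_homeoD(8))

definition hinv :: "('a \<Rightarrow> 'a) \<Rightarrow> 'a \<Rightarrow> 'a" where
  "hinv g = (\<lambda>z \<in> topspace M. inv_into (topspace M) g z)"

lemma hinv:
  assumes "g \<in> homeos M" "z \<in> topspace M"
  shows "g (hinv g z) = z" "hinv g (g z) = z" "hinv g z \<in> topspace M"
  using homeosD[OF assms(1)] assms(2) by (auto simp: hinv_def f_inv_into_f inv_into_into)

lemma fixes_bd_hinv: assumes "fixes_bd g" shows "fixes_bd (hinv g)"
proof -
  have "hinv g z = z" if "z \<in> bd" for z
    using hinv(2)[OF fixes_bdD(1)[OF assms], of z] fixes_bdD(2)[OF assms that] that bd_sub by auto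
  then show ?thesis using homeos_inv[OF fixes_bdD(1)[OF assms]] by (simp add: fixes_bd_def hinv_def)
qed

lemma fixes_bd_compose: "fixes_bd f \<Longrightarrow> fixes_bd g \<Longrightarrow> fixes_bd (compose (topspace M) f g)"
  using homeos_compose[of f M g] bd_sub by (auto simp: fixes_bd_def compose_eq subset_iff)

lemma fixes_bd_level_pos:
  assumes "fixes_bd g" "z \<in> topspace M" "0 < level z"
  shows "0 < level (g z)"
proof (rule ccontr)
  assume "\<not> 0 < level (g z)"
  then have "g z \<in> bd" using level_bounds[of "g z"] fixes_bdD(3)[OF assms(1,2)] by (simp add: level_0)
  then have "g (g z) = g z" by (rule fixes_bdD(2)[OF assms(1)])
  then have "g z = z" using fixes_bdD(3,5)[OF assms(1)] assms(2) by (auto simp: inj_on_def)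
  then show False using \<open>g z \<in> bd\<close> assms(3) by (simp add: level_0)
qed

lemma mcut_mcut:
  assumes g: "fixes_bd g" "\<And>z. z \<in> topspace M \<Longrightarrow> g' (g z) = z" and e: "0 \<le> e" "e \<le> 1/2" and z: "z \<in> topspace M"
  shows "mcut g' e (mcut g e z) = z"
proof (cases "level z \<le> e/2")
  case False
  let ?y = "g (dn e z)"
  have y: "?y \<in> topspace M" by (intro fixes_bdD(3)[OF g(1)] dn_mem e z)
  have "0 < level ?y"
    using fixes_bd_level_pos[OF g(1) dn_mem[OF e z]] sink_pos[of e "level z"] False e by (simp add: level_dn[OF e z])
  then have "e/2 < level (up e ?y)" using raise_gt by (simp add: level_up[OF e y])
  then show ?thesis
    using False up_dn[OF e z] by (simp add: mcut_def z up_mem[OF e y] dn_up[OF e y] g(2) dn_mem[OF e z])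
qed (simp add: mcut_def z)

text \<open>The cutting level may vary with \<open>t\<close> and may reach 0, where for maps fixing
  the base nothing is cut off. This makes a cut at a level tending to 0 part of an isotopy.\<close>

lemma continuous_mcut:
  assumes h: "continuous_map cylinder_topology M (\<lambda>(z, t). h t z)" "\<And>t. t \<in> {0..1} \<Longrightarrow> fixes_bd (h t)"
    and e: "continuous_on {0..1} e" "\<And>t. t \<in> {0..1} \<Longrightarrow> 0 \<le> e t \<and> e t \<le> 1/2"
  shows "continuous_map cylinder_topology M (\<lambda>(z, t). mcut (h t) (e t) z)"
proof -
  have e2: "continuous_on (C \<times> {0..1::real}) (\<lambda>w. e (snd w))"
    by (rule continuous_on_compose2[OF e(1)]) (auto intro: continuous_intros)
  have dnc: "continuous_map cylinder_topology M (\<lambda>(z, t). dn (e t) z)"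
    unfolding dn_def
  proof (rule continuous_ext)
    show "continuous_on (C \<times> {0..1}) (\<lambda>(p, t). (fst p, sink (e t) (snd p)))"
      unfolding case_prod_unfold sink_def using e2 by (intro continuous_intros) auto
    show "(fst p, sink (e t) (snd p)) \<in> C" if "t \<in> {0..1}" "p \<in> C" for t p
      using e(2)[OF that(1)] level_maps(2)[of "e t"] that by blast
    show "(fst (x, s), sink (e t) (snd (x, s))) = (x, s)" if "t \<in> {0..1}" "1/2 \<le> s" for t x s
      using e(2)[OF that(1)] that by (simp add: sink_id)
  qed
  have upc: "continuous_map cylinder_topology M (\<lambda>(z, t). up (e t) z)"
    unfolding up_def
  proof (rule continuous_ext)
    show "continuous_on (C \<times> {0..1}) (\<lambda>(p, t). (fst p, raise (e t) (snd p)))"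
      unfolding case_prod_unfold raise_def using e2 by (intro continuous_intros) auto
    show "(fst p, raise (e t) (snd p)) \<in> C" if "t \<in> {0..1}" "p \<in> C" for t p
      using e(2)[OF that(1)] level_maps(1)[of "e t"] that by blast
    show "(fst (x, s), raise (e t) (snd (x, s))) = (x, s)" if "t \<in> {0..1}" "1/2 \<le> s" for t x s
      using e(2)[OF that(1)] that by (simp add: raise_id)
  qed
  have comp: "continuous_map cylinder_topology M (\<lambda>(z, t). b t (a t z))"
    if "continuous_map cylinder_topology M (\<lambda>(z, t). a t z)" "continuous_map cylinder_topology M (\<lambda>(z, t). b t z)"
    for a b :: "real \<Rightarrow> 'a \<Rightarrow> 'a"
  proof -
    have "continuous_map cylinder_topology cylinder_topology (\<lambda>(z, t). (a t z, t))"
      using that(1) by (simp add: continuous_map_pairwise o_def case_prod_unfold continuous_map_snd)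
    from continuous_map_compose[OF this that(2)] show ?thesis by (simp add: o_def case_prod_unfold)
  qed
  have main: "continuous_map cylinder_topology M (\<lambda>(z, t). up (e t) (h t (dn (e t) z)))"
    by (rule comp[OF comp[OF dnc h(1)] upc])
  have "continuous_map cylinder_topology M
     (\<lambda>w. if level (fst w) \<le> e (snd w) / 2 then fst w else (\<lambda>(z, t). up (e t) (h t (dn (e t) z))) w)"
  proof (rule continuous_map_cases_le)
    show "continuous_map cylinder_topology euclideanreal (\<lambda>w. level (fst w))"
      using continuous_map_compose[OF continuous_map_fst continuous_level] by (simp add: o_def)
    have "continuous_map unit_interval euclideanreal (\<lambda>t. e t / 2)"
      using e(1) by (simp add: continuous_intros)
    from continuous_map_compose[OF continuous_map_snd this]
    show "continuous_map cylinder_topology euclideanreal (\<lambda>w. e (snd w) / 2)" by (simp add: o_def)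
    fix w assume w: "w \<in> topspace cylinder_topology" "level (fst w) = e (snd w) / 2"
    obtain z t where zt: "w = (z, t)" "z \<in> topspace M" "t \<in> {0..1}" "level z = e t / 2" using w by (cases w) auto
    note et = conjunct1[OF e(2)[OF zt(3)]] conjunct2[OF e(2)[OF zt(3)]]
    \<comment> \<open>On the seam \<open>level z = e t / 2\<close> the point is collapsed to the
      base, which \<open>h t\<close> fixes, so both branches give \<open>z\<close>.\<close>
    have "dn (e t) z \<in> bd" using dn_mem[OF et zt(2)] level_dn[OF et zt(2)] zt(4) et by (simp add: level_0 sink_def)
    then have "h t (dn (e t) z) = dn (e t) z" by (rule fixes_bdD(2)[OF h(2)[OF zt(3)]])
    then show "fst w = (\<lambda>(z, t). up (e t) (h t (dn (e t) z))) w" using up_dn[OF et zt(2)] zt by simp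
  qed (auto intro: continuous_map_from_subtopology continuous_map_fst main)
  then show ?thesis by (rule continuous_map_eq) (auto simp: mcut_def)
qed

lemma fixes_bd_mcut:
  assumes g: "fixes_bd g" and e: "0 \<le> e" "e \<le> 1/2"
  shows "fixes_bd (mcut g e)"
proof -
  have cont: "continuous_map M M (mcut g' e)" if g': "fixes_bd g'" for g'
  proof -
    have "continuous_map cylinder_topology M (\<lambda>(z, t). g' z)"
      using continuous_map_compose[OF continuous_map_fst fixes_bdD(4)[OF g']] by (simp add: o_def case_prod_unfold)
    from continuous_mcut[OF this g' _ , of "\<lambda>_. e"] e
    have "continuous_map cylinder_topology M (\<lambda>(z, t::real). mcut g' e z)" by simp
    from continuous_map_slice[OF this, of 0] show ?thesis by simp
  qed
  note h = hinv[OF fixes_bdD(1)[OF g]]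
  have "mcut g e \<in> homeos M"
    by (rule homeosI[OF _ cont[OF g] cont[OF fixes_bd_hinv[OF g]]])
       (use mcut_mcut[OF g h(2) e] mcut_mcut[OF fixes_bd_hinv[OF g] h(1) e] in \<open>auto simp: mcut_def\<close>)
  moreover have "mcut g e z = z" if "z \<in> bd" for z
    using that e by (simp add: mcut_def level_0)
  ultimately show ?thesis by (simp add: fixes_bd_def)
qed

lemma mcut_out:
  assumes "z \<in> topspace M" "z \<notin> c ` C" "g z = z"
  shows "mcut g e z = z"
  using assms by (simp add: mcut_def up_def dn_def ext_out)

text \<open>The conjugating maps are the identity off the compact collar, so cutting enlarges the
  support at most by the collar.\<close>

lemma mcut_isotopy:
  assumes h: "compactly_supported_isotopy M h" "\<And>t. t \<in> {0..1} \<Longrightarrow> fixes_bd (h t)"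
    and e: "continuous_on {0..1} e" "\<And>t. t \<in> {0..1} \<Longrightarrow> 0 \<le> e t \<and> e t \<le> 1/2"
  shows "compactly_supported_isotopy M (\<lambda>t. mcut (h t) (e t))"
proof -
  obtain K where K: "compactin M K" "\<And>t. t \<in> {0..1} \<Longrightarrow> supp M (h t) \<subseteq> K"
    and ch: "continuous_map cylinder_topology M (\<lambda>(z, t). h t z)"
    using h(1) by (auto simp: compactly_supported_isotopy_def isotopy_def)
  show ?thesis
  proof (rule compactly_supported_isotopyI)
    show "mcut (h t) (e t) \<in> homeos M" if "t \<in> {0..1}" for t
      using fixes_bd_mcut[OF h(2)] e(2) that fixes_bdD(1) by blast
    show "continuous_map cylinder_topology M (\<lambda>(z, t). mcut (h t) (e t) z)"
      by (rule continuous_mcut[OF ch h(2) e])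
    show cK: "compactin M (c ` C \<union> K)" using closed_cC K by (simp add: compactin_Un)
    show "supp M (mcut (h t) (e t)) \<subseteq> c ` C \<union> K" if t: "t \<in> {0..1}" for t
    proof -
      have "{z \<in> topspace M. mcut (h t) (e t) z \<noteq> z} \<subseteq> c ` C \<union> K"
      proof safe
        fix z assume z: "z \<in> topspace M" "mcut (h t) (e t) z \<noteq> z" "z \<notin> K"
        then have "h t z = z" using supp_subset[OF z(1)] K(2)[OF t] by blast
        then show "z \<in> c ` C" using mcut_out[OF z(1)] z(2) by blast
      qed
      then show ?thesis unfolding supp_def
        by (rule closure_of_minimal[OF _ compactin_imp_closedin[OF Hausdorff cK]])
    qed
  qed
qed

lemma fixes_bd_small:
  assumes g: "fixes_bd g" and \<eta>: "0 < \<eta>"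
  shows "\<exists>d>0. d < 1 \<and> (\<forall>z\<in>topspace M. level z \<le> d \<longrightarrow> level (g z) < \<eta>)"
proof -
  have "continuous_map (top_of_set C) euclideanreal (level \<circ> (g \<circ> c))"
    by (intro continuous_map_compose[OF continuous_map_compose[OF continuous_c fixes_bdD(4)[OF g]] continuous_level])
  then have "continuous_on C (\<lambda>p. level (g (c p)))" by (simp add: o_def)
  then have "uniformly_continuous_on C (\<lambda>p. level (g (c p)))"
    by (rule compact_uniformly_continuous[OF _ compact_C])
  then have "\<exists>d>0. \<forall>p\<in>C. \<forall>p'\<in>C. dist p' p < d \<longrightarrow> dist (level (g (c p'))) (level (g (c p))) < \<eta>"
    using \<eta> unfolding uniformly_continuous_on_def by simp
  then obtain d where d: "d > 0" "\<forall>p\<in>C. \<forall>p'\<in>C. dist p' p < d \<longrightarrow> dist (level (g (c p'))) (level (g (c p))) < \<eta>"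
    by (elim exE conjE)
  have "level (g z) < \<eta>" if z: "z \<in> topspace M" "level z \<le> min (d/2) (1/2)" for z
  proof -
    have "z \<in> c ` C" using level_less_1[of z] z(2) by simp
    then obtain x s where p: "z = c (x, s)" "(x, s) \<in> C" by auto
    have "dist (x, s) (x, 0) < d" using z(2) p d(1) by (simp add: dist_Pair_Pair dist_real_def)
    moreover have "g (c (x, 0)) = c (x, 0)" using p(2) by (intro fixes_bdD(2)[OF g]) (simp add: bd_def)
    ultimately show ?thesis using d(2)[rule_format, of "(x, 0)" "(x, s)"] p by simp
  qed
  then show ?thesis using d(1) by (intro exI[of _ "min (d/2) (1/2)"]) auto
qed

section \<open>Germs at the base of the collar\<close>

lemma germ_refl: "germ g g" unfolding germ_def by (intro exI[of _ 1]) simp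

lemma germ_sym: "germ g h \<Longrightarrow> germ h g" unfolding germ_def by metis

lemma germ_trans: assumes "germ f g" "germ g h" shows "germ f h"
proof -
  obtain d e where "d > 0" "e > 0" "\<forall>z\<in>topspace M. level z \<le> d \<longrightarrow> f z = g z" "\<forall>z\<in>topspace M. level z \<le> e \<longrightarrow> g z = h z"
    using assms unfolding germ_def by auto
  then show ?thesis unfolding germ_def by (intro exI[of _ "min d e"]) auto
qed

lemma germ_compose:
  assumes "germ f f'" "germ g g'" "fixes_bd g'"
  shows "germ (compose (topspace M) f g) (compose (topspace M) f' g')"
proof -
  obtain d where d: "d > 0" "\<forall>z\<in>topspace M. level z \<le> d \<longrightarrow> f z = f' z" using assms(1) unfolding germ_def by auto
  obtain e where e: "e > 0" "\<forall>z\<in>topspace M. level z \<le> e \<longrightarrow> g z = g' z" using assms(2) unfolding germ_def by auto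
  obtain a where a: "a > 0" "\<forall>z\<in>topspace M. level z \<le> a \<longrightarrow> level (g' z) < d"
    using fixes_bd_small[OF assms(3) d(1)] by auto
  have "compose (topspace M) f g z = compose (topspace M) f' g' z"
    if "z \<in> topspace M" "level z \<le> min e a" for z
    using that d e a fixes_bdD(3)[OF assms(3), of z] by (simp add: compose_eq less_imp_le)
  then show ?thesis unfolding germ_def using e(1) a(1) by (intro exI[of _ "min e a"]) auto
qed

lemma germ_hinv:
  assumes g: "fixes_bd g" "fixes_bd g'" "germ g g'"
  shows "germ (hinv g) (hinv g')"
proof -
  obtain d where d: "d > 0" "\<forall>z\<in>topspace M. level z \<le> d \<longrightarrow> g z = g' z" using g(3) unfolding germ_def by auto
  obtain a where a: "a > 0" "\<forall>z\<in>topspace M. level z \<le> a \<longrightarrow> level (hinv g z) < d"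
    using fixes_bd_small[OF fixes_bd_hinv[OF g(1)] d(1)] by auto
  have "hinv g z = hinv g' z" if z: "z \<in> topspace M" "level z \<le> a" for z
  proof -
    note h = hinv[OF fixes_bdD(1)[OF g(1)] z(1)]
    have "level (hinv g z) \<le> d" using a(2) z by (simp add: less_imp_le)
    then have "g' (hinv g z) = z" using d(2) h(1,3) by force
    then show ?thesis using hinv(2)[OF fixes_bdD(1)[OF g(2)] h(3)] by simp
  qed
  then show ?thesis unfolding germ_def using a(1) by blast
qed

lemma germ_ext: assumes "germ_eq f g" shows "germ (ext f) (ext g)"
proof -
  obtain d where d: "d > 0" "\<forall>p\<in>C. snd p \<le> d \<longrightarrow> f p = g p" using assms unfolding germ_eq_def by auto
  have "ext f z = ext g z" if "z \<in> topspace M" "level z \<le> d" for z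
    using that d(2) by (cases "z \<in> c ` C") (auto simp: ext_out)
  then show ?thesis unfolding germ_def using d(1) by blast
qed

lemma isotopic_rel_rel: "isotopic_rel g \<Longrightarrow> fixes_bd g"
  unfolding isotopic_rel_def fixes_bd_def by fastforce

text \<open>Cutting off the inverse at a level tending to \<open>0\<close> is an isotopy from the identity: hence every germ is
  represented in the group.\<close>

lemma realise_germ:
  assumes F: "cyl_homeo F F'"
  shows "\<exists>g. isotopic_rel g \<and> germ g (ext F)"
proof -
  \<comment> \<open>At \<open>t = 0\<close> nothing is cut off and the inverse cancels
    \<open>F\<close>. At \<open>t = 1\<close> the inverse is cut at level \<open>1/2\<close>, hence
    is the identity up to \<open>1/4\<close>, and the germ of \<open>F\<close> remains.\<close>
  define h where "h t = compose (topspace M) (ext F) (mcut (ext F') (t/2))" for t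
  have c0: "compactly_supported_isotopy M (\<lambda>t. ext f)" if "cyl_homeo f f'" for f f'
  proof (rule ext_isotopy[OF _ cyl_homeo_top_fixing[OF that]])
    show "continuous_on (C \<times> {0..1}) (\<lambda>(p, t::real). f p)"
      unfolding case_prod_unfold by (rule continuous_on_compose2[OF cyl_homeoD(2)[OF that]]) (auto intro: continuous_intros)
  qed
  have F': "cyl_homeo F' F" by (rule cyl_homeo_sym[OF F])
  have "compactly_supported_isotopy M (\<lambda>t. mcut (ext F') (t/2))"
    by (rule mcut_isotopy[OF c0[OF F'] fixes_bd_ext[OF F']]) (auto intro!: continuous_intros)
  from isotopy_compose[OF c0[OF F] this] have iso: "compactly_supported_isotopy M h" by (simp add: h_def[abs_def])
  have FF': "ext F (ext F' z) = z" if "z \<in> topspace M" for z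
    using that by (subst ext_ext) (auto intro: ext_id simp: cyl_homeoD(4-7)[OF F])
  have "h 0 = (\<lambda>z \<in> topspace M. z)"
  proof
    fix z show "h 0 z = (\<lambda>z \<in> topspace M. z) z"
    proof (cases "z \<in> topspace M")
      case z: True
      show ?thesis
      proof (cases "level z \<le> 0")
        case True
        then have "z \<in> bd" using z level_bounds[of z] by (simp add: level_0)
        then show ?thesis using fixes_bdD(2)[OF fixes_bd_ext[OF F]] z True by (simp add: h_def compose_eq mcut_def)
      next
        case False
        have "dn 0 z = z" using z False by (intro dn_id) auto
        moreover have "up 0 (ext F' z) = ext F' z"
          using z level_bounds(1) fixes_bdD(3)[OF fixes_bd_ext[OF F']] by (intro up_id) auto
        ultimately show ?thesis using False z by (simp add: h_def compose_eq mcut_def FF')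
      qed
    qed (simp add: h_def compose_def)
  qed
  moreover have r: "fixes_bd (h t)" if "t \<in> {0..1}" for t
    unfolding h_def by (intro fixes_bd_compose fixes_bd_ext[OF F] fixes_bd_mcut fixes_bd_ext[OF F']) (use that in auto)
  moreover have "h 1 \<in> homeos M" using fixes_bdD(1)[OF r[of 1]] by simp
  ultimately have "isotopic_rel (h 1)" unfolding isotopic_rel_def using iso fixes_bdD(2)[OF r] by blast
  moreover have "germ (h 1) (ext F)"
    unfolding germ_def by (intro exI[of _ "1/4"]) (auto simp: h_def compose_eq mcut_def)
  ultimately show ?thesis by blast
qed

text \<open>A homeomorphism fixing the base need not preserve the collar. Multiplying
  \<open>g\<close> by its inverse cut at a small level \<open>e\<close> keeps the germ of
  \<open>g\<close> below \<open>e/2\<close> and gives the identity from level \<open>1/2\<close> on,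
  so the product can be read in the collar.\<close>

lemma collar_representative:
  assumes g: "fixes_bd g"
  shows "\<exists>f f'. cyl_homeo f f' \<and> germ g (ext f)"
proof -
  note h = hinv[OF fixes_bdD(1)[OF g]]
  obtain e0 where e0: "e0 > 0" "\<forall>z\<in>topspace M. level z \<le> e0 \<longrightarrow> level (g z) < 1/2"
    using fixes_bd_small[OF g, of "1/2"] by auto
  define e where "e = min e0 (1/2)"
  have e: "0 < e" "0 \<le> e" "e \<le> 1/2" using e0 by (auto simp: e_def)
  let ?k = "mcut (hinv g) e"
  define f where "f = compose (topspace M) g ?k"
  have relf: "fixes_bd f" unfolding f_def by (intro fixes_bd_compose g fixes_bd_mcut fixes_bd_hinv e)
  have fid: "f z = z" if z: "z \<in> topspace M" "1/2 \<le> level z" for z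
  proof -
    let ?y = "hinv g z"
    \<comment> \<open>By the choice of \<open>e0\<close>, a point below \<open>e\<close> is mapped
      by \<open>g\<close> below \<open>1/2\<close>, but \<open>g\<close> maps \<open>?y\<close> to
      \<open>z\<close>. So the cut does not alter the inverse at \<open>z\<close>.\<close>
    have "e \<le> level ?y"
      using e0(2) h(1)[OF z(1)] h(3)[OF z(1)] z(2) by (force simp: e_def)
    moreover have "dn e z = z" using dn_id[OF e(2,3) z(1)] z(2) e by simp
    ultimately have "?k z = ?y" using z e up_id[OF e(2,3) h(3)[OF z(1)]] by (simp add: mcut_def)
    then show ?thesis using h(1)[OF z(1)] z(1) by (simp add: f_def compose_eq)
  qed
  have inv: "\<exists>f'. cyl_homeo f0 f'"
    if f0: "f0 = (\<lambda>p. ci (f (c p)))" for f0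
  proof -
    have fix1: "g' z = z" if "fixes_bd g'" "\<And>z. z \<in> topspace M \<Longrightarrow> 1/2 \<le> level z \<Longrightarrow> g' z = z"
        "z \<in> topspace M" "1/2 \<le> level z" for g' z using that by blast
    \<comment> \<open>A point leaving the collar would land on a fixed point, which injectivity
      forbids.\<close>
    have stay: "g' (c p) \<in> c ` C" if g': "fixes_bd g'" "\<And>z. z \<in> topspace M \<Longrightarrow> 1/2 \<le> level z \<Longrightarrow> g' z = z" and p: "p \<in> C" for g' p
    proof (rule ccontr)
      assume n: "g' (c p) \<notin> c ` C"
      have t: "g' (c p) \<in> topspace M" by (rule fixes_bdD(3)[OF g'(1) c_top[OF p]])
      have "g' (g' (c p)) = g' (c p)" using g'(2)[OF t] n by (simp add: level_def)
      then have "g' (c p) = c p" using fixes_bdD(5)[OF g'(1)] t c_top[OF p] by (auto simp: inj_on_def)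
      then show False using n p by auto
    qed
    have hid: "hinv f z = z" if "z \<in> topspace M" "1/2 \<le> level z" for z
      using fid[OF that] hinv(2)[OF fixes_bdD(1)[OF relf] that(1)] by simp
    let ?f' = "\<lambda>p. ci (hinv f (c p))"
    note s1 = stay[OF relf fid] and s2 = stay[OF fixes_bd_hinv[OF relf] hid]
    have cont: "continuous_on C (\<lambda>p. ci (g' (c p)))" if "fixes_bd g'" "\<And>p. p \<in> C \<Longrightarrow> g' (c p) \<in> c ` C" for g'
    proof -
      have "continuous_map (top_of_set C) (subtopology M (c ` C)) (g' \<circ> c)"
        using continuous_map_compose[OF continuous_c fixes_bdD(4)[OF that(1)]] that(2)
        by (auto simp: continuous_map_in_subtopology)
      from continuous_map_compose[OF this continuous_ci] show ?thesis
        by (auto simp: continuous_map_in_subtopology o_def)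
    qed
    have "homeomorphism C C f0 ?f'"
    proof (rule homeomorphismI)
      show "continuous_on C f0" unfolding f0 by (rule cont[OF relf s1])
      show "continuous_on C ?f'" by (rule cont[OF fixes_bd_hinv[OF relf] s2])
      show "f0 ` C \<subseteq> C" "?f' ` C \<subseteq> C" unfolding f0 using c_ci(2) s1 s2 by blast+
      show "?f' (f0 p) = p" if "p \<in> C" for p
        using that by (simp add: f0 c_ci s1 hinv[OF fixes_bdD(1)[OF relf] c_top])
      show "f0 (?f' p) = p" if "p \<in> C" for p
        using that by (simp add: f0 c_ci s2 hinv[OF fixes_bdD(1)[OF relf] c_top])
    qed
    moreover have "f0 (x, 0) = (x, 0)" if "x \<in> S" for x
      using that fixes_bdD(2)[OF relf, of "c (x, 0)"] by (simp add: f0 bd_def)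
    moreover have "f0 (x, s) = (x, s)" if "x \<in> S" "1/2 \<le> s" "s \<le> 1" for x s
      using that fid[of "c (x, s)"] c_top[of "(x, s)"] by (simp add: f0)
    ultimately have "cyl_homeo f0 ?f'" by (auto simp: cyl_homeo_def)
    then show ?thesis by blast
  qed
  have "germ g (ext (\<lambda>p. ci (f (c p))))"
    unfolding germ_def
  proof (intro exI[of _ "e/2"] conjI ballI impI)
    fix z assume z: "z \<in> topspace M" "level z \<le> e/2"
    then have "f z = g z" by (simp add: f_def compose_eq mcut_def)
    moreover obtain p where p: "p \<in> C" "z = c p" using level_less_1[of z] z(2) e by auto
    moreover obtain f' where G: "cyl_homeo (\<lambda>p. ci (f (c p))) f'" using inv by blast
    moreover have "f z \<in> c ` C"
    proof (rule ccontr)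
      assume n: "f z \<notin> c ` C"
      have "f (f z) = f z" using n by (intro fid fixes_bdD(3)[OF relf z(1)]) (simp add: level_def)
      then have "f z = z" using fixes_bdD(3,5)[OF relf] z(1) by (auto simp: inj_on_def)
      then show False using n p by auto
    qed
    ultimately show "g z = ext (\<lambda>p. ci (f (c p))) z" by (simp add: c_ci)
  qed (use e in simp)
  then show ?thesis using inv by blast
qed

text \<open>Cutting all stages of the given isotopy at one level keeps it away from the base. Its
  endpoints survive: conjugation preserves the identity, and \<open>g\<close> is already the
  identity where the cut acts.\<close>

lemma germ_id_isotopy:
  assumes g: "isotopic_rel g" "germ g (\<lambda>z. z)"
  shows "\<exists>h e. e > 0 \<and> compactly_supported_isotopy M h \<and> h 0 = (\<lambda>z \<in> topspace M. z) \<and> h 1 = g \<and>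
     (\<forall>t\<in>{0..1}. \<forall>z\<in>topspace M. level z \<le> e \<longrightarrow> h t z = z)"
proof -
  obtain k where k: "compactly_supported_isotopy M k" "k 0 = (\<lambda>z \<in> topspace M. z)" "k 1 = g"
    "\<And>t z. t \<in> {0..1} \<Longrightarrow> z \<in> bd \<Longrightarrow> k t z = z" using g(1) unfolding isotopic_rel_def by blast
  have rk: "fixes_bd (k t)" if "t \<in> {0..1}" for t
    using isotopyD[OF k(1) that] k(4)[OF that] by (simp add: fixes_bd_def)
  note rg = isotopic_rel_rel[OF g(1)]
  obtain d where d: "d > 0" "\<forall>z\<in>topspace M. level z \<le> d \<longrightarrow> g z = z" using g(2) unfolding germ_def by auto
  define e where "e = min d (1/2)"
  have e: "0 < e" "0 \<le> e" "e \<le> 1/2" "e \<le> d" using d by (auto simp: e_def)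
  define h where "h t = mcut (k t) e" for t
  have "compactly_supported_isotopy M h"
    unfolding h_def by (rule mcut_isotopy[OF k(1) rk]) (use e in auto)
  moreover have "h 0 = (\<lambda>z \<in> topspace M. z)"
    using up_dn[OF e(2,3)] dn_mem[OF e(2,3)] by (auto simp: h_def mcut_def k(2) fun_eq_iff)
  moreover have "h 1 z = g z" for z
  proof (cases "z \<in> topspace M")
    case z: True
    consider "level z \<le> e/2" | "e/2 < level z" "level z \<le> e" | "e < level z" by linarith
    then show ?thesis
    proof cases
      case 1
      then show ?thesis using d(2) e z by (simp add: h_def mcut_def)
    next
      case 2
      have "level (dn e z) \<le> e"
        using level_dn[OF e(2,3) z] sink_bounds[of "level z" e] level_bounds[of z] 2 e by simp
      then have "g (dn e z) = dn e z" using d(2) dn_mem[OF e(2,3) z] e by simp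
      then show ?thesis using 2 z d(2) e up_dn[OF e(2,3) z] by (simp add: h_def mcut_def k(3))
    next
      case 3
      have gz: "g z \<in> topspace M" by (rule fixes_bdD(3)[OF rg z])
      \<comment> \<open>\<open>g\<close> fixes the low points and is injective, so high points stay
        high, where \<open>up e\<close> and \<open>dn e\<close> do nothing.\<close>
      have "e < level (g z)"
      proof (rule ccontr)
        assume n: "\<not> e < level (g z)"
        then have "g (g z) = g z" using d(2) gz e by simp
        then have "g z = z" using fixes_bdD(5)[OF rg] gz z by (auto simp: inj_on_def)
        then show False using n 3 by simp
      qed
      then show ?thesis
        using 3 z e dn_id[OF e(2,3) z] up_id[OF e(2,3) gz] by (simp add: h_def mcut_def k(3))
    qed
  qed (use fixes_bdD(7)[OF rg] in \<open>auto simp: h_def mcut_def extensional_def\<close>)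
  moreover have "\<forall>t\<in>{0..1}. \<forall>z\<in>topspace M. level z \<le> e/2 \<longrightarrow> h t z = z" by (simp add: h_def mcut_def)
  ultimately show ?thesis using e(1) by (intro exI[of _ h] exI[of _ "e/2"]) auto
qed

end

section \<open>Norms and conjugation\<close>

text \<open>The pulled-back norm vanishes on the kernel; adding 1 off the identity restores
  positivity and preserves the other norm axioms, since the added term is itself a
  conjugation-invariant norm.\<close>

lemma norm_bounded_on_image:
  assumes b: "bounded_group G" and H: "group H" and \<phi>: "\<phi> \<in> hom G H" and \<nu>: "conj_invariant_norm H \<nu>"
  shows "\<exists>B. \<forall>g\<in>carrier G. \<nu> (\<phi> g) \<le> B"
proof -
  interpret G: group G using b by (simp add: bounded_group_def)
  interpret \<phi>: group_hom G H \<phi> by (intro group_hom.intro group_hom_axioms.intro H \<phi>) unfold_locales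
  define \<mu> where "\<mu> g = \<nu> (\<phi> g) + (if g = \<one>\<^bsub>G\<^esub> then 0 else 1)" for g
  have N: "0 \<le> \<nu> a" "(0 < \<nu> a) = (a \<noteq> \<one>\<^bsub>H\<^esub>)" "\<nu> (inv\<^bsub>H\<^esub> a) = \<nu> a"
    "\<nu> (a \<otimes>\<^bsub>H\<^esub> b) \<le> \<nu> a + \<nu> b" "\<nu> (b \<otimes>\<^bsub>H\<^esub> a \<otimes>\<^bsub>H\<^esub> inv\<^bsub>H\<^esub> b) = \<nu> a"
    if "a \<in> carrier H" "b \<in> carrier H" for a b
    using \<nu> that by (auto simp: conj_invariant_norm_def)
  have "\<nu> \<one>\<^bsub>H\<^esub> = 0" using N(1,2)[of "\<one>\<^bsub>H\<^esub>" "\<one>\<^bsub>H\<^esub>"] by simp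
  have "conj_invariant_norm G \<mu>"
    unfolding conj_invariant_norm_def
  proof (intro conjI ballI)
    fix g assume g: "g \<in> carrier G"
    note [simp] = \<phi>.hom_closed
    show "0 \<le> \<mu> g" using N(1)[of "\<phi> g" "\<phi> g"] g by (simp add: \<mu>_def)
    show "(0 < \<mu> g) = (g \<noteq> \<one>\<^bsub>G\<^esub>)"
      using N(1)[of "\<phi> g" "\<phi> g"] g \<open>\<nu> \<one>\<^bsub>H\<^esub> = 0\<close> by (auto simp: \<mu>_def)
    show "\<mu> (inv\<^bsub>G\<^esub> g) = \<mu> g" using N(3)[of "\<phi> g" "\<phi> g"] g by (simp add: \<mu>_def)
    fix h assume h: "h \<in> carrier G"
    show "\<mu> (g \<otimes>\<^bsub>G\<^esub> h) \<le> \<mu> g + \<mu> h" using N(4)[of "\<phi> g" "\<phi> h"] g h by (auto simp: \<mu>_def)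
    have "h \<otimes>\<^bsub>G\<^esub> g \<otimes>\<^bsub>G\<^esub> inv\<^bsub>G\<^esub> h = \<one>\<^bsub>G\<^esub> \<longleftrightarrow> g = \<one>\<^bsub>G\<^esub>"
    proof
      assume "h \<otimes>\<^bsub>G\<^esub> g \<otimes>\<^bsub>G\<^esub> inv\<^bsub>G\<^esub> h = \<one>\<^bsub>G\<^esub>"
      then have "h \<otimes>\<^bsub>G\<^esub> g \<otimes>\<^bsub>G\<^esub> inv\<^bsub>G\<^esub> h \<otimes>\<^bsub>G\<^esub> h = h" using h by simp
      then have "h \<otimes>\<^bsub>G\<^esub> g = h \<otimes>\<^bsub>G\<^esub> \<one>\<^bsub>G\<^esub>" using g h by (simp add: G.m_assoc)
      then show "g = \<one>\<^bsub>G\<^esub>" using g h by simp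
    qed (use h in simp)
    then show "\<mu> (h \<otimes>\<^bsub>G\<^esub> g \<otimes>\<^bsub>G\<^esub> inv\<^bsub>G\<^esub> h) = \<mu> g" using N(5)[of "\<phi> g" "\<phi> h"] g h by (simp add: \<mu>_def)
  qed
  then obtain B where "\<forall>g\<in>carrier G. \<mu> g \<le> B" using b by (auto simp: bounded_group_def)
  then have "\<nu> (\<phi> g) \<le> B" if "g \<in> carrier G" for g
    using that by (auto simp: \<mu>_def dest!: bspec[of _ _ g] split: if_splits)
  then show ?thesis by blast
qed

lemma bounded_group_image:
  assumes "bounded_group G" "group H" "\<phi> \<in> hom G H" "carrier H \<subseteq> \<phi> ` carrier G"
  shows "bounded_group H"
  unfolding bounded_group_def
proof (intro conjI assms(2) allI impI)
  fix \<nu> assume "conj_invariant_norm H \<nu>"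
  from norm_bounded_on_image[OF assms(1-3) this]
  obtain B where "\<forall>g\<in>carrier G. \<nu> (\<phi> g) \<le> B" by blast
  then have "\<nu> h \<le> B" if "h \<in> carrier H" for h using that assms(4) by blast
  then show "\<exists>B. \<forall>g\<in>carrier H. \<nu> g \<le> B" by blast
qed

section \<open>The group relative to the base and the interior group\<close>

context collar begin

definition rel_group :: "('a \<Rightarrow> 'a) monoid" where
  "rel_group = (BijGroup (topspace M)) \<lparr>carrier := {g. isotopic_rel g}\<rparr>"

abbreviation N :: "'a topology" where "N \<equiv> subtopology M (topspace M - bd)"

definition iota :: "('a \<Rightarrow> 'a) \<Rightarrow> 'a \<Rightarrow> 'a" where
  "iota g = (\<lambda>z \<in> topspace M. if z \<in> bd then z else g z)"

lemma rel_group_subgroup: "subgroup {g. isotopic_rel g} (BijGroup (topspace M))"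
  using subgroup_isotopies[OF Hausdorff bd_sub] by (simp add: isotopic_rel_def)

lemma group_rel_group: "group rel_group"
  unfolding rel_group_def by (rule subgroup.subgroup_is_group[OF rel_group_subgroup group_BijGroup])

lemma rel_group_simps:
  "x \<in> carrier rel_group \<longleftrightarrow> isotopic_rel x"
  "isotopic_rel x \<Longrightarrow> isotopic_rel y \<Longrightarrow> x \<otimes>\<^bsub>rel_group\<^esub> y = compose (topspace M) x y"
  "\<one>\<^bsub>rel_group\<^esub> = (\<lambda>z \<in> topspace M. z)"
  by (auto simp: rel_group_def BijGroup_def dest!: isotopic_rel_rel fixes_bdD(1) homeos_Bij)

lemma rel_group_inv: "isotopic_rel x \<Longrightarrow> inv\<^bsub>rel_group\<^esub> x = hinv x"
  using group.m_inv_consistent[OF group_BijGroup rel_group_subgroup, of x] inv_BijGroup[OF homeos_Bij[OF fixes_bdD(1)[OF isotopic_rel_rel]], of x]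
  by (simp add: rel_group_def hinv_def)

lemma open_N: "openin M (topspace M - bd)" using closed_bd by blast

lemma Hausdorff_N: "Hausdorff_space N" by (simp add: Hausdorff Hausdorff_space_subtopology)

text \<open>A common compact support inside the open set is closed in \<open>M\<close>, so the
  extended isotopy is the identity near the base. The complement of \<open>bd\<close> and the
  complement of the support form an open cover.\<close>

lemma continuous_iota:
  assumes h: "compactly_supported_isotopy N h"
  shows "continuous_map cylinder_topology M (\<lambda>(z, t). iota (h t) z)"
proof -
  obtain K where K: "compactin N K" "\<And>t. t \<in> {0..1} \<Longrightarrow> supp N (h t) \<subseteq> K"
    and ch: "continuous_map (prod_topology N unit_interval) N (\<lambda>(z, t). h t z)"
    using h by (auto simp: compactly_supported_isotopy_def isotopy_def)
  have cK: "closedin M K" using K(1) Hausdorff by (auto simp: compactin_subtopology intro: compactin_imp_closedin)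
  show ?thesis
  proof (rule continuous_map_open_cover)
    let ?U = "(topspace M - bd) \<times> {0..1::real}" and ?V = "(topspace M - K) \<times> {0..1::real}"
    have I: "openin unit_interval {0..1}" by simp
    show "openin cylinder_topology ?U" "openin cylinder_topology ?V"
      using open_N cK by (auto simp: openin_prod_Times_iff I)
    show "topspace cylinder_topology \<subseteq> ?U \<union> ?V" using K(1) by (auto simp: compactin_subtopology)
    have eq: "subtopology cylinder_topology ?U = prod_topology N unit_interval"
      using subtopology_Times[of M unit_interval "topspace M - bd" "{0..1}"] by (simp add: subtopology_subtopology)
    have "continuous_map (prod_topology N unit_interval) M (\<lambda>(z, t). h t z)"
      using ch continuous_map_into_fulltopology by blast
    then show "continuous_map (subtopology cylinder_topology ?U) M (\<lambda>(z, t). iota (h t) z)"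
      unfolding eq by (rule continuous_map_eq) (auto simp: iota_def)
    have "continuous_map (subtopology cylinder_topology ?V) M fst"
      by (intro continuous_map_from_subtopology continuous_map_fst)
    then show "continuous_map (subtopology cylinder_topology ?V) M (\<lambda>(z, t). iota (h t) z)"
    proof (rule continuous_map_eq)
      fix w assume "w \<in> topspace (subtopology cylinder_topology ?V)"
      then obtain z t where w: "w = (z, t)" "z \<in> topspace M" "t \<in> {0..1}" "z \<notin> K" by auto
      have "h t z = z" if "z \<notin> bd"
        by (rule supp_subset[of z N]) (use that w K(2)[OF w(3)] in auto)
      then show "fst w = (\<lambda>(z, t). iota (h t) z) w" using w by (simp add: iota_def)
    qed
  qed
qed

lemma iota_isotopy:
  assumes h: "compactly_supported_isotopy N h"
  shows "compactly_supported_isotopy M (\<lambda>t. iota (h t))"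
proof -
  obtain K where K: "compactin N K" "\<And>t. t \<in> {0..1} \<Longrightarrow> supp N (h t) \<subseteq> K"
    using h by (auto simp: compactly_supported_isotopy_def)
  have KM: "compactin M K" using K(1) by (simp add: compactin_subtopology)
  show ?thesis
  proof (rule compactly_supported_isotopyI[OF _ continuous_iota[OF h] KM])
    fix t :: real assume t: "t \<in> {0..1}"
    \<comment> \<open>The inverse is again the extension of a compactly supported isotopy, so its
      continuity follows from the same lemma.\<close>
    let ?k = "\<lambda>t. \<lambda>x \<in> topspace N. inv_into (topspace N) (h t) x"
    note hD = homeosD[OF isotopyD[OF h t]]
    have bij: "h t (inv_into (topspace N) (h t) z) = z" "inv_into (topspace N) (h t) (h t z) = z"
       "inv_into (topspace N) (h t) z \<in> topspace N" if "z \<in> topspace N" for z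
      using hD(4,5) that f_inv_into_f[of z "h t" "topspace N"] inv_into_into[of z "h t" "topspace N"] by auto
    show "iota (h t) \<in> homeos M"
    proof (rule homeosI)
      show "iota (h t) \<in> extensional (topspace M)" by (simp add: iota_def)
      show "continuous_map M M (iota (h t))" by (rule continuous_map_slice[OF continuous_iota[OF h] t])
      show "continuous_map M M (iota (?k t))"
        by (rule continuous_map_slice[OF continuous_iota[OF isotopy_inverse[OF Hausdorff_N h]] t])
      fix z assume z: "z \<in> topspace M"
      show "iota (?k t) (iota (h t) z) = z"
        using z bij[of z] hD(3)[of z] by (simp add: iota_def)
      show "iota (h t) (iota (?k t) z) = z"
        using z bij[of z] by (simp add: iota_def)
    qed
    have "{z \<in> topspace M. iota (h t) z \<noteq> z} \<subseteq> K"
    proof safe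
      fix z assume z: "z \<in> topspace M" "iota (h t) z \<noteq> z"
      then have "z \<in> topspace N" "h t z \<noteq> z" by (auto simp: iota_def split: if_splits)
      then show "z \<in> K" using supp_subset[of z N "h t"] K(2)[OF t] by blast
    qed
    then show "supp M (iota (h t)) \<subseteq> K"
      unfolding supp_def by (rule closure_of_minimal[OF _ compactin_imp_closedin[OF Hausdorff KM]])
  qed
qed

lemma iota_hom: "iota \<in> hom (Hc_group N) rel_group"
proof (rule homI)
  have mem: "isotopic_rel (iota g)" if g: "g \<in> carrier (Hc_group N)" for g
  proof -
    obtain h where h: "compactly_supported_isotopy N h" "h 0 = (\<lambda>x \<in> topspace N. x)" "h 1 = g"
      using g by (auto simp: Hc_group_def)
    have "iota (h 0) = (\<lambda>z \<in> topspace M. z)" by (auto simp: h(2) iota_def fun_eq_iff)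
    moreover have "\<forall>t\<in>{0..1::real}. \<forall>z\<in>bd. iota (h t) z = z" using bd_sub by (auto simp: iota_def)
    moreover have "iota g \<in> homeos M" using isotopyD[OF iota_isotopy[OF h(1)], of 1] h(3) by simp
    ultimately show ?thesis
      unfolding isotopic_rel_def using iota_isotopy[OF h(1)] h(3) by (intro conjI exI[of _ "\<lambda>t. iota (h t)"]) auto
  qed
  then show "iota g \<in> carrier rel_group" if "g \<in> carrier (Hc_group N)" for g using that by (simp add: rel_group_simps)
  fix f g assume fg: "f \<in> carrier (Hc_group N)" "g \<in> carrier (Hc_group N)"
  have hom: "f \<in> homeos N" "g \<in> homeos N" using fg by (auto simp: Hc_group_def)
  have "f \<otimes>\<^bsub>Hc_group N\<^esub> g = compose (topspace N) f g"
    using homeos_Bij[OF hom(1)] homeos_Bij[OF hom(2)] by (simp add: Hc_group_def BijGroup_def)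
  moreover have "iota (compose (topspace N) f g) = compose (topspace M) (iota f) (iota g)"
    using homeosD(3)[OF hom(2)] by (auto simp: iota_def compose_def fun_eq_iff)
  ultimately show "iota (f \<otimes>\<^bsub>Hc_group N\<^esub> g) = iota f \<otimes>\<^bsub>rel_group\<^esub> iota g"
    by (simp add: rel_group_simps mem fg)
qed

text \<open>Together with the germ calculus this is exactness: an element with trivial germ comes
  from the interior group. The isotopy cut off by \<open>germ_id_isotopy\<close> restricts to the
  complement of the base with compact support.\<close>

lemma germ_id_iota:
  assumes g: "isotopic_rel g" "germ g (\<lambda>z. z)"
  shows "g \<in> iota ` carrier (Hc_group N)"
proof -
  obtain h e where h: "e > 0" "compactly_supported_isotopy M h" "h 0 = (\<lambda>z \<in> topspace M. z)" "h 1 = g"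
    and low: "\<And>t z. t \<in> {0..1} \<Longrightarrow> z \<in> topspace M \<Longrightarrow> level z \<le> e \<Longrightarrow> h t z = z"
    using germ_id_isotopy[OF g] by blast
  obtain K where K: "compactin M K" "\<And>t. t \<in> {0..1} \<Longrightarrow> supp M (h t) \<subseteq> K"
    and ch: "continuous_map cylinder_topology M (\<lambda>(z, t). h t z)"
    using h(2) by (auto simp: compactly_supported_isotopy_def isotopy_def)
  have fixes_bd: "fixes_bd (h t)" if "t \<in> {0..1}" for t
    using isotopyD[OF h(2) that] low[OF that] h(1) by (auto simp: fixes_bd_def level_0)
  have keep: "k z \<in> topspace N" if "fixes_bd k" "z \<in> topspace N" for k z
    using fixes_bd_level_pos[OF that(1), of z] fixes_bdD(3)[OF that(1), of z] that(2) level_bounds[of z] level_bounds[of "k z"]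
    by (auto simp: level_0 less_le)
  define r where "r k = (\<lambda>z \<in> topspace N. k z)" for k :: "'a \<Rightarrow> 'a"
  have rc: "continuous_map N N (r k)" if k: "fixes_bd k" for k
  proof -
    have "continuous_map N M k" by (rule continuous_map_from_subtopology[OF fixes_bdD(4)[OF k]])
    then have "continuous_map N N k" using keep[OF k] by (auto simp: continuous_map_in_subtopology)
    then show ?thesis by (rule continuous_map_eq) (simp add: r_def)
  qed
  \<comment> \<open>Nothing moves up to level \<open>e\<close>, so the support may be intersected
    with the closed set of levels at least \<open>e\<close>; this keeps it compact and off the
    base.\<close>
  define K' where "K' = K \<inter> {z \<in> topspace M. level z \<in> {e..}}"
  have "closedin M {z \<in> topspace M. level z \<in> {e..}}"
    by (rule closedin_continuous_map_preimage[OF continuous_level]) simp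
  then have "compactin M K'" unfolding K'_def by (rule compact_Int_closedin[OF K(1)])
  then have K'N: "compactin N K'" using h(1) by (auto simp: compactin_subtopology K'_def level_0)
  have "compactly_supported_isotopy N (\<lambda>t. r (h t))"
  proof (rule compactly_supported_isotopyI[OF _ _ K'N])
    fix t :: real assume t: "t \<in> {0..1}"
    note hi = hinv[OF fixes_bdD(1)[OF fixes_bd[OF t]]]
    show "r (h t) \<in> homeos N"
      by (rule homeosI[OF _ rc[OF fixes_bd[OF t]] rc[OF fixes_bd_hinv[OF fixes_bd[OF t]]]])
         (use keep[OF fixes_bd[OF t]] keep[OF fixes_bd_hinv[OF fixes_bd[OF t]]] hi in \<open>auto simp: r_def\<close>)
    have "{z \<in> topspace N. r (h t) z \<noteq> z} \<subseteq> K'"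
    proof safe
      fix z assume z: "z \<in> topspace N" "r (h t) z \<noteq> z"
      then have z': "z \<in> topspace M" "h t z \<noteq> z" by (auto simp: r_def)
      then have "z \<in> K" using supp_subset[of z M "h t"] K(2)[OF t] by blast
      moreover have "e \<le> level z" using low[OF t z'(1)] z'(2) by force
      ultimately show "z \<in> K'" using z' by (simp add: K'_def)
    qed
    then show "supp N (r (h t)) \<subseteq> K'"
      unfolding supp_def by (rule closure_of_minimal[OF _ compactin_imp_closedin[OF Hausdorff_N K'N]])
  next
    have eq: "subtopology cylinder_topology ((topspace M - bd) \<times> {0..1}) = prod_topology N unit_interval"
      using subtopology_Times[of M unit_interval "topspace M - bd" "{0..1}"] by (simp add: subtopology_subtopology)
    have "continuous_map (prod_topology N unit_interval) M (\<lambda>(z, t). h t z)"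
      unfolding eq[symmetric] by (rule continuous_map_from_subtopology[OF ch])
    then have "continuous_map (prod_topology N unit_interval) N (\<lambda>(z, t). h t z)"
      using keep[OF fixes_bd] by (fastforce simp: continuous_map_in_subtopology)
    then show "continuous_map (prod_topology N unit_interval) N (\<lambda>(z, t). r (h t) z)"
      by (rule continuous_map_eq) (auto simp: r_def)
  qed
  moreover have "r (h 0) = (\<lambda>z \<in> topspace N. z)" by (auto simp: r_def h(3) fun_eq_iff)
  moreover from calculation(1) have "r g \<in> homeos N" using isotopyD[of N "\<lambda>t. r (h t)" 1] h(4) by simp
  ultimately have "r g \<in> carrier (Hc_group N)"
    using h(4) by (auto simp: Hc_group_def intro!: exI[of _ "\<lambda>t. r (h t)"])
  moreover have "iota (r g) = g"
    using fixes_bdD(2,7)[OF isotopic_rel_rel[OF g(1)]] by (auto simp: iota_def r_def fun_eq_iff extensional_def)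
  ultimately show ?thesis by (metis imageI)
qed

lemma compose_ext: "(\<And>p. p \<in> C \<Longrightarrow> g p \<in> C) \<Longrightarrow> compose (topspace M) (ext f) (ext g) = ext (f \<circ> g)"
  using ext_ext[of g] ext_extensional[of "f \<circ> g"] by (auto simp: compose_def extensional_def fun_eq_iff)

lemma hinv_ext: assumes "cyl_homeo f f'" shows "hinv (ext f) = ext f'"
proof
  fix z
  have "ext f' (ext f (hinv (ext f) z)) = hinv (ext f) z" if "z \<in> topspace M"
    using hinv(3)[OF fixes_bdD(1)[OF fixes_bd_ext[OF assms]] that]
    by (subst ext_ext) (auto simp: cyl_homeoD(4-7)[OF assms] intro: ext_id)
  then show "hinv (ext f) z = ext f' z"
    using hinv(1)[OF fixes_bdD(1)[OF fixes_bd_ext[OF assms]], of z] by (cases "z \<in> topspace M") (auto simp: hinv_def ext_def)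
qed

text \<open>An element differs from a word with the same germ by something in the image of
  \<open>iota\<close>, of norm at most \<open>B\<close>. The word consists of two commutators, each
  contributing a conjugate of \<open>\<Phi>\<close> and one of its inverse; hence
  \<open>4 * \<nu> \<Phi>\<close>.\<close>

theorem bounded_rel_group:
  assumes b: "bounded_group (Hc_group N)"
  shows "bounded_group rel_group"
  unfolding bounded_group_def
proof (intro conjI group_rel_group allI impI)
  fix \<nu> assume \<nu>: "conj_invariant_norm rel_group \<nu>"
  interpret G: group rel_group by (rule group_rel_group)
  obtain B where B: "\<And>g. g \<in> carrier (Hc_group N) \<Longrightarrow> \<nu> (iota g) \<le> B"
    using norm_bounded_on_image[OF b group_rel_group iota_hom \<nu>] by blast
  obtain \<phi> \<phi>' where \<phi>: "cyl_homeo \<phi> \<phi>'" and comms: "\<And>f g. cyl_homeo f g \<Longrightarrow> \<exists>F\<^sub>1 F\<^sub>1' T\<^sub>1 U\<^sub>1 F\<^sub>2 F\<^sub>2' T\<^sub>2 U\<^sub>2.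
     cyl_homeo F\<^sub>1 F\<^sub>1' \<and> cyl_homeo T\<^sub>1 U\<^sub>1 \<and> cyl_homeo F\<^sub>2 F\<^sub>2' \<and> cyl_homeo T\<^sub>2 U\<^sub>2 \<and>
     germ_eq f (comm \<phi> \<phi>' F\<^sub>1 F\<^sub>1' T\<^sub>1 U\<^sub>1 \<circ> comm \<phi> \<phi>' F\<^sub>2 F\<^sub>2' T\<^sub>2 U\<^sub>2)"
    using germ_commutators by blast
  obtain \<Phi> where \<Phi>: "isotopic_rel \<Phi>" "germ \<Phi> (ext \<phi>)" using realise_germ[OF \<phi>] by blast
  have norm: "\<nu> (a \<otimes>\<^bsub>rel_group\<^esub> b) \<le> \<nu> a + \<nu> b" "\<nu> (b \<otimes>\<^bsub>rel_group\<^esub> a \<otimes>\<^bsub>rel_group\<^esub> inv\<^bsub>rel_group\<^esub> b) = \<nu> a" "\<nu> (inv\<^bsub>rel_group\<^esub> a) = \<nu> a"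
    if "a \<in> carrier rel_group" "b \<in> carrier rel_group" for a b
    using \<nu> that by (auto simp: conj_invariant_norm_def)
  have germ_mult: "germ (a \<otimes>\<^bsub>rel_group\<^esub> b) (ext (f \<circ> g))"
    if "isotopic_rel a" "isotopic_rel b" "germ a (ext f)" "germ b (ext g)" "cyl_homeo g g'" for a b f g g'
    using germ_compose[OF that(3,4) fixes_bd_ext[OF that(5)]] that(1,2)
    by (simp add: rel_group_simps compose_ext cyl_homeoD(4)[OF that(5)])
  have germ_inv: "germ (inv\<^bsub>rel_group\<^esub> a) (ext f')" if "isotopic_rel a" "germ a (ext f)" "cyl_homeo f f'" for a f f'
    using germ_hinv[OF isotopic_rel_rel[OF that(1)] fixes_bd_ext[OF that(3)] that(2)] by (simp add: rel_group_inv that(1) hinv_ext[OF that(3)])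
  have closed: "isotopic_rel (a \<otimes>\<^bsub>rel_group\<^esub> b)" if "isotopic_rel a" "isotopic_rel b" for a b
    using that G.m_closed by (simp add: rel_group_simps(1)[symmetric])
  have closed_inv: "isotopic_rel (inv\<^bsub>rel_group\<^esub> a)" if "isotopic_rel a" for a
    using that G.inv_closed by (simp add: rel_group_simps(1)[symmetric])
  \<comment> \<open>Any representatives \<open>a\<close> and \<open>t\<close> of the germs of
    \<open>F\<close> and \<open>T\<close> will do: they enter only as conjugators, so the norm bound
    does not depend on them.\<close>
  have word: "\<exists>w. isotopic_rel w \<and> germ w (ext (comm \<phi> \<phi>' F F' T U)) \<and> \<nu> w \<le> 2 * \<nu> \<Phi>"
    if F: "cyl_homeo F F'" and T: "cyl_homeo T U" for F F' T U
  proof -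
    obtain a where a: "isotopic_rel a" "germ a (ext F)" using realise_germ[OF F] by blast
    obtain t where t: "isotopic_rel t" "germ t (ext T)" using realise_germ[OF T] by blast
    define X where "X = t \<otimes>\<^bsub>rel_group\<^esub> \<Phi> \<otimes>\<^bsub>rel_group\<^esub> inv\<^bsub>rel_group\<^esub> t"
    define Y where "Y = t \<otimes>\<^bsub>rel_group\<^esub> inv\<^bsub>rel_group\<^esub> \<Phi> \<otimes>\<^bsub>rel_group\<^esub> inv\<^bsub>rel_group\<^esub> t"
    note T' = cyl_homeo_sym[OF T] and F' = cyl_homeo_sym[OF F] and \<phi>' = cyl_homeo_sym[OF \<phi>]
    have X: "isotopic_rel X" "germ X (ext (T \<circ> \<phi> \<circ> U))"
      unfolding X_def
      by (intro closed closed_inv t \<Phi>)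
        (rule germ_mult[OF closed[OF t(1) \<Phi>(1)] closed_inv[OF t(1)]
            germ_mult[OF t(1) \<Phi>(1) t(2) \<Phi>(2) \<phi>] germ_inv[OF t T] T'])
    have Y: "isotopic_rel Y" "germ Y (ext (T \<circ> \<phi>' \<circ> U))"
      unfolding Y_def
      by (intro closed closed_inv t \<Phi>)
        (rule germ_mult[OF closed[OF t(1) closed_inv[OF \<Phi>(1)]] closed_inv[OF t(1)]
            germ_mult[OF t(1) closed_inv[OF \<Phi>(1)] t(2) germ_inv[OF \<Phi> \<phi>] \<phi>'] germ_inv[OF t T] T'])
    have "isotopic_rel (a \<otimes>\<^bsub>rel_group\<^esub> X \<otimes>\<^bsub>rel_group\<^esub> inv\<^bsub>rel_group\<^esub> a \<otimes>\<^bsub>rel_group\<^esub> Y)" by (intro closed closed_inv a X Y)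
    moreover have "germ (a \<otimes>\<^bsub>rel_group\<^esub> X \<otimes>\<^bsub>rel_group\<^esub> inv\<^bsub>rel_group\<^esub> a \<otimes>\<^bsub>rel_group\<^esub> Y) (ext (F \<circ> (T \<circ> \<phi> \<circ> U) \<circ> F' \<circ> (T \<circ> \<phi>' \<circ> U)))"
      by (rule germ_mult[OF _ Y(1) germ_mult[OF _ _ germ_mult[OF a(1) X(1) a(2) X(2)] germ_inv[OF a F] F'] Y(2)])
        (rule closed closed_inv a X Y cyl_homeo_comp T T' \<phi> \<phi>')+
    moreover have "\<nu> (a \<otimes>\<^bsub>rel_group\<^esub> X \<otimes>\<^bsub>rel_group\<^esub> inv\<^bsub>rel_group\<^esub> a \<otimes>\<^bsub>rel_group\<^esub> Y) \<le> 2 * \<nu> \<Phi>"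
    proof -
      have "\<nu> (a \<otimes>\<^bsub>rel_group\<^esub> X \<otimes>\<^bsub>rel_group\<^esub> inv\<^bsub>rel_group\<^esub> a \<otimes>\<^bsub>rel_group\<^esub> Y) \<le> \<nu> (a \<otimes>\<^bsub>rel_group\<^esub> X \<otimes>\<^bsub>rel_group\<^esub> inv\<^bsub>rel_group\<^esub> a) + \<nu> Y"
        by (rule norm(1)) (simp_all add: rel_group_simps(1) closed closed_inv a X Y)
      also have "\<nu> (a \<otimes>\<^bsub>rel_group\<^esub> X \<otimes>\<^bsub>rel_group\<^esub> inv\<^bsub>rel_group\<^esub> a) = \<nu> X" by (rule norm(2)) (simp_all add: rel_group_simps(1) a X)
      also have "\<nu> X = \<nu> \<Phi>" unfolding X_def by (rule norm(2)) (simp_all add: rel_group_simps(1) \<Phi> t)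
      also have "\<nu> Y = \<nu> (inv\<^bsub>rel_group\<^esub> \<Phi>)" unfolding Y_def by (rule norm(2)) (simp_all add: rel_group_simps(1) \<Phi> t closed_inv)
      also have "\<nu> (inv\<^bsub>rel_group\<^esub> \<Phi>) = \<nu> \<Phi>" by (rule norm(3)[OF _ G.one_closed]) (simp add: rel_group_simps(1) \<Phi>)
      finally show ?thesis by simp
    qed
    ultimately show ?thesis unfolding comm_def by blast
  qed
  have "\<nu> g \<le> B + 4 * \<nu> \<Phi>" if "g \<in> carrier rel_group" for g
  proof -
    have g: "isotopic_rel g" using that by (simp add: rel_group_simps)
    obtain f f' where f: "cyl_homeo f f'" "germ g (ext f)" using collar_representative[OF isotopic_rel_rel[OF g]] by blast
    obtain F1 F1' T1 U1 F2 F2' T2 U2 where G: "cyl_homeo F1 F1'" "cyl_homeo T1 U1" "cyl_homeo F2 F2'" "cyl_homeo T2 U2" and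
      eq: "germ_eq f (comm \<phi> \<phi>' F1 F1' T1 U1 \<circ> comm \<phi> \<phi>' F2 F2' T2 U2)" using comms[OF f(1)] by blast
    obtain u where u: "isotopic_rel u" "germ u (ext (comm \<phi> \<phi>' F1 F1' T1 U1))" "\<nu> u \<le> 2 * \<nu> \<Phi>" using word[OF G(1,2)] by blast
    obtain v where v: "isotopic_rel v" "germ v (ext (comm \<phi> \<phi>' F2 F2' T2 U2))" "\<nu> v \<le> 2 * \<nu> \<Phi>" using word[OF G(3,4)] by blast
    obtain l where l: "cyl_homeo (comm \<phi> \<phi>' F2 F2' T2 U2) l" using cyl_homeo_comm[OF \<phi> G(3,4)] by blast
    define w where "w = u \<otimes>\<^bsub>rel_group\<^esub> v"
    have w: "isotopic_rel w" unfolding w_def by (intro closed u v)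
    have gw: "germ g w"
      by (rule germ_trans[OF f(2) germ_trans[OF germ_ext[OF eq] germ_sym]])
        (unfold w_def, rule germ_mult[OF u(1) v(1) u(2) v(2) l])
    \<comment> \<open>The error term has trivial germ, because \<open>g\<close> and \<open>w\<close>
      agree near the base.\<close>
    define k where "k = g \<otimes>\<^bsub>rel_group\<^esub> inv\<^bsub>rel_group\<^esub> w"
    have k: "isotopic_rel k" unfolding k_def by (intro closed closed_inv g w)
    have "germ k (compose (topspace M) w (hinv w))"
      unfolding k_def using germ_compose[OF gw germ_refl fixes_bd_hinv[OF isotopic_rel_rel[OF w]]] closed_inv[OF w]
      by (simp add: rel_group_simps g rel_group_inv w)
    moreover have "germ (compose (topspace M) w (hinv w)) (\<lambda>z. z)"
      unfolding germ_def by (intro exI[of _ 1]) (auto simp: compose_eq hinv(1)[OF fixes_bdD(1)[OF isotopic_rel_rel[OF w]]])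
    ultimately have "k \<in> iota ` carrier (Hc_group N)" by (intro germ_id_iota k) (rule germ_trans)
    then have kB: "\<nu> k \<le> B" using B by blast
    have "g = k \<otimes>\<^bsub>rel_group\<^esub> w"
      unfolding k_def using g w by (simp add: G.m_assoc rel_group_simps(1)[symmetric])
    then have "\<nu> g \<le> \<nu> k + \<nu> w" using norm(1)[of k w] k w by (simp add: rel_group_simps(1))
    moreover have "\<nu> w \<le> \<nu> u + \<nu> v" unfolding w_def by (rule norm(1)) (simp_all add: rel_group_simps(1) u v)
    ultimately show ?thesis using kB u(3) v(3) by linarith
  qed
  then show "\<exists>B. \<forall>g\<in>carrier rel_group. \<nu> g \<le> B" by blast
qed

end

section \<open>Restriction to the boundary\<close>

context collar begin

abbreviation D :: "'a topology" where "D \<equiv> subtopology M bd"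

lemma topspace_D: "topspace D = bd" using bd_sub by auto

lemma Hausdorff_D: "Hausdorff_space D" by (simp add: Hausdorff Hausdorff_space_subtopology)

lemma compact_bd: "compactin M bd"
  unfolding bd_def by (rule compact_c) (auto simp: C_def compact_base compact_imp_closed closed_Times)

lemma compact_D: "compactin D bd"
  using compact_bd by (simp add: compactin_subtopology)

definition restr :: "('a \<Rightarrow> 'a) \<Rightarrow> 'a \<Rightarrow> 'a" where "restr g = (\<lambda>z \<in> bd. g z)"

definition base_map :: "('a \<Rightarrow> 'a) \<Rightarrow> 'b \<Rightarrow> 'b" where "base_map g x = fst (ci (g (c (x, 0))))"

lemma base_map:
  assumes "g (c (x, 0)) \<in> bd" "x \<in> S"
  shows "base_map g x \<in> S" "c (base_map g x, 0) = g (c (x, 0))"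
  using assms by (auto simp: base_map_def bd_def)

lemma base_isotopy:
  assumes h: "compactly_supported_isotopy D h"
  shows "continuous_on (S \<times> {0..1}) (\<lambda>(x, t). base_map (h t) x)"
proof -
  have ch: "continuous_map (prod_topology D unit_interval) D (\<lambda>(z, t). h t z)"
    using h by (auto simp: compactly_supported_isotopy_def isotopy_def)
  have "continuous_map (top_of_set S) (top_of_set C) (\<lambda>x. (x, 0))"
    by (auto simp: continuous_map_in_subtopology intro!: continuous_intros)
  from continuous_map_compose[OF this continuous_c]
  have "continuous_map (top_of_set S) D (\<lambda>x. c (x, 0))"
    by (auto simp: continuous_map_in_subtopology o_def bd_def)
  then have 1: "continuous_map (prod_topology (top_of_set S) unit_interval) D (\<lambda>w. c (fst w, 0))"
    using continuous_map_compose[OF continuous_map_fst[of "top_of_set S" unit_interval]] unfolding o_def by blast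
  have "continuous_map (prod_topology (top_of_set S) unit_interval) (prod_topology D unit_interval) (\<lambda>w. (c (fst w, 0), snd w))"
    unfolding continuous_map_pairwise o_def fst_conv snd_conv using 1 continuous_map_snd by blast
  from continuous_map_compose[OF this ch]
  have "continuous_map (prod_topology (top_of_set S) unit_interval) D (\<lambda>w. h (snd w) (c (fst w, 0)))" by (simp add: o_def)
  moreover have "continuous_map D (top_of_set C) ci"
    by (rule continuous_map_from_subtopology_mono[OF continuous_ci]) (auto simp: bd_def C_def)
  ultimately have "continuous_map (prod_topology (top_of_set S) unit_interval) (top_of_set C) (ci \<circ> (\<lambda>w. h (snd w) (c (fst w, 0))))"
    by (rule continuous_map_compose)
  then have "continuous_map (prod_topology (top_of_set S) unit_interval) (top_of_set C) (\<lambda>w. ci (h (snd w) (c (fst w, 0))))"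
    unfolding o_def .
  then have "continuous_on (S \<times> {0..1}) (\<lambda>w. ci (h (snd w) (c (fst w, 0))))"
    by (simp add: continuous_map_in_subtopology subtopology_Times[symmetric])
  then show ?thesis unfolding base_map_def case_prod_unfold by (rule continuous_on_fst)
qed

text \<open>At each height one stage of the isotopy acts on the base, so the inverse is the same
  formula for the inverse isotopy. The stage index runs back to 0 at height \<open>1/2\<close>,
  where \<open>h 0\<close> is the identity and the extension to \<open>M\<close> fits.\<close>

lemma extend_isotopy:
  assumes h: "compactly_supported_isotopy D h" "h 0 = (\<lambda>z \<in> bd. z)"
  obtains H where "compactly_supported_isotopy M H" "H 0 = (\<lambda>z \<in> topspace M. z)" "\<And>z. z \<in> bd \<Longrightarrow> H 1 z = h 1 z"
proof -
  let ?k = "\<lambda>t. \<lambda>x \<in> topspace D. inv_into (topspace D) (h t) x"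
  have k: "compactly_supported_isotopy D ?k" by (rule isotopy_inverse[OF Hausdorff_D h(1)])
  define fade where "fade t s = t * max 0 (1 - 2 * s)" for t s :: real
  have fade: "fade t s \<in> {0..1}" if "t \<in> {0..1}" "0 \<le> s" for t s
    using that by (auto simp: fade_def intro!: mult_le_one)
  define \<Phi> where "\<Phi> g t p = (base_map (g (fade t (snd p))) (fst p), snd p)" for g :: "real \<Rightarrow> 'a \<Rightarrow> 'a" and t and p :: "'b \<times> real"
  have cont: "continuous_on (C \<times> {0..1}) (\<lambda>(p, t). \<Phi> g t p)" if "compactly_supported_isotopy D g" for g
  proof -
    have "continuous_on (C \<times> {0..1}) (\<lambda>w. (\<lambda>(x, t). base_map (g t) x) (fst (fst w), fade (snd w) (snd (fst w))))"
      by (rule continuous_on_compose2[OF base_isotopy[OF that]])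
         (use fade in \<open>auto simp: fade_def intro!: continuous_intros\<close>)
    then show ?thesis unfolding \<Phi>_def case_prod_unfold by (intro continuous_intros) simp_all
  qed
  have hD: "h t z \<in> bd" "?k t z \<in> bd" "?k t (h t z) = z" "h t (?k t z) = z" if "t \<in> {0..1}" "z \<in> bd" for t z
    using homeosD(3-5)[OF isotopyD[OF h(1) that(1)]] that(2) f_inv_into_f[of z "h t" bd] inv_into_into[of z "h t" bd]
    unfolding topspace_D by auto
  have bdc: "c (x, 0) \<in> bd" if "x \<in> S" for x using that by (auto simp: bd_def)
  have inv: "base_map g' (base_map g x) = x" if "x \<in> S" "g (c (x, 0)) \<in> bd" "g' (g (c (x, 0))) = c (x, 0)" for g g' x
    using base_map[of g x, OF that(2,1)] that by (simp add: base_map_def[of g'])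
  have top: "top_fixing (\<Phi> h t)" if t: "t \<in> {0..1}" for t
  proof -
    have mem: "\<Phi> h t p \<in> C" "\<Phi> ?k t p \<in> C" if p: "p \<in> C" for p
      using base_map(1) hD(1,2)[OF fade[OF t]] bdc C_fst[OF p] C_snd[OF p] unfolding \<Phi>_def by simp_all
    have c1: "continuous_on C (\<Phi> g t)" if "compactly_supported_isotopy D g" for g
      using continuous_on_compose2[OF cont[OF that], of C "\<lambda>p. (p, t)"] t by (force intro: continuous_intros)
    have "homeomorphism C C (\<Phi> h t) (\<Phi> ?k t)"
    proof (rule homeomorphismI[OF c1[OF h(1)] c1[OF k]])
      show "\<Phi> h t ` C \<subseteq> C" "\<Phi> ?k t ` C \<subseteq> C" using mem by blast+
      show "\<Phi> ?k t (\<Phi> h t p) = p" if p: "p \<in> C" for p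
        using inv[OF C_fst[OF p]] hD[OF fade[OF t] bdc[OF C_fst[OF p]]] C_snd[OF p] unfolding \<Phi>_def by simp
      show "\<Phi> h t (\<Phi> ?k t p) = p" if p: "p \<in> C" for p
        using inv[OF C_fst[OF p]] hD[OF fade[OF t] bdc[OF C_fst[OF p]]] C_snd[OF p] unfolding \<Phi>_def by simp
    qed
    moreover have "\<Phi> h t (x, s) = (x, s)" if "x \<in> S" "1/2 \<le> s" for x s
      using that bdc[OF that(1)] by (simp add: \<Phi>_def fade_def base_map_def h(2))
    ultimately show ?thesis unfolding top_fixing_def by auto
  qed
  show ?thesis
  proof (rule that[OF ext_isotopy[OF cont[OF h(1)] top]])
    have "\<Phi> h 0 p = p" if "p \<in> C" for p
      using bdc[OF C_fst[OF that]] C_fst[OF that] by (simp add: \<Phi>_def fade_def base_map_def h(2))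
    then show "ext (\<Phi> h 0) = (\<lambda>z \<in> topspace M. z)"
      using ext_id[of "\<Phi> h 0"] ext_extensional[of "\<Phi> h 0"] by (auto simp: fun_eq_iff extensional_def)
    fix z assume "z \<in> bd"
    then obtain x where x: "x \<in> S" "z = c (x, 0)" by (auto simp: bd_def)
    then show "ext (\<Phi> h 1) z = h 1 z"
      using base_map(2)[of "h 1" x] hD(1)[of 1 z] \<open>z \<in> bd\<close> by (simp add: \<Phi>_def fade_def)
  qed
qed

text \<open>Restriction makes sense because homeomorphisms of \<open>M\<close> preserve
  \<open>bd\<close>; for the manifold boundary this is \<open>manifold_boundary_homeo\<close>.
  Extended isotopies show that restriction is onto.\<close>

theorem bounded_Hc_boundary:
  assumes inv: "\<And>g. g \<in> homeos M \<Longrightarrow> g ` bd = bd" and b: "bounded_group (Hc_group M)"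
  shows "bounded_group (Hc_group D)"
proof (rule bounded_group_image[OF b group_Hc_group[OF Hausdorff_D]])
  have rh: "restr g \<in> homeos D" if g: "g \<in> homeos M" for g
  proof -
    have cont: "continuous_map D D (restr f)" if "continuous_map M M f" "f ` bd = bd" for f
    proof -
      have "continuous_map D D f"
        using continuous_map_from_subtopology[OF that(1)] that(2) by (auto simp: continuous_map_in_subtopology)
      then show ?thesis by (rule continuous_map_eq) (auto simp: restr_def)
    qed
    have hg: "hinv g \<in> homeos M" unfolding hinv_def by (rule homeos_inv[OF g])
    show ?thesis
      by (rule homeosI[OF _ cont[OF homeosD(2)[OF g] inv[OF g]] cont[OF homeosD(2)[OF hg] inv[OF hg]]])
         (use inv[OF g] inv[OF hg] hinv[OF g] bd_sub in \<open>auto simp: restr_def topspace_D\<close>)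
  qed
  have ri: "compactly_supported_isotopy D (\<lambda>t. restr (h t))" if h: "compactly_supported_isotopy M h" for h
  proof (rule compactly_supported_isotopyI[OF rh[OF isotopyD[OF h]] _ compact_D])
    have ch: "continuous_map cylinder_topology M (\<lambda>(z, t). h t z)"
      using h by (auto simp: compactly_supported_isotopy_def isotopy_def)
    have eq: "subtopology cylinder_topology (bd \<times> {0..1}) = prod_topology D unit_interval"
      using subtopology_Times[of M unit_interval bd "{0..1}"] by (simp add: subtopology_subtopology)
    have "continuous_map (prod_topology D unit_interval) M (\<lambda>(z, t). h t z)"
      unfolding eq[symmetric] by (rule continuous_map_from_subtopology[OF ch])
    then have "continuous_map (prod_topology D unit_interval) D (\<lambda>(z, t). h t z)"
      using inv[OF isotopyD[OF h]] by (fastforce simp: continuous_map_in_subtopology)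
    then show "continuous_map (prod_topology D unit_interval) D (\<lambda>(z, t). restr (h t) z)"
      by (rule continuous_map_eq) (auto simp: restr_def)
    show "supp D (restr (h t)) \<subseteq> bd" for t
      using closure_of_subset_topspace[of D] unfolding supp_def topspace_D by blast
  qed
  show "restr \<in> hom (Hc_group M) (Hc_group D)"
  proof (rule homI)
    fix g assume g: "g \<in> carrier (Hc_group M)"
    then obtain h where h: "compactly_supported_isotopy M h" "h 0 = (\<lambda>z \<in> topspace M. z)" "h 1 = g"
      by (auto simp: Hc_group_def)
    have "restr (h 0) = (\<lambda>z \<in> topspace D. z)" using bd_sub by (auto simp: h(2) restr_def topspace_D fun_eq_iff)
    then show "restr g \<in> carrier (Hc_group D)"
      using ri[OF h(1)] h(3) rh[of g] g by (auto simp: Hc_group_def intro!: exI[of _ "\<lambda>t. restr (h t)"])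
    fix f assume f: "f \<in> carrier (Hc_group M)"
    have fg: "f \<in> homeos M" "g \<in> homeos M" using f g by (auto simp: Hc_group_def)
    have "g \<otimes>\<^bsub>Hc_group M\<^esub> f = compose (topspace M) g f"
      using homeos_Bij[OF fg(1)] homeos_Bij[OF fg(2)] by (simp add: Hc_group_def BijGroup_def)
    moreover have "restr g \<otimes>\<^bsub>Hc_group D\<^esub> restr f = compose bd (restr g) (restr f)"
      using homeos_Bij[OF rh[OF fg(1)]] homeos_Bij[OF rh[OF fg(2)]]
      unfolding topspace_D by (simp add: Hc_group_def BijGroup_def Int_absorb1[OF bd_sub])
    moreover have "restr (compose (topspace M) g f) = compose bd (restr g) (restr f)"
      using inv[OF fg(1)] bd_sub by (fastforce simp: restr_def compose_def fun_eq_iff)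
    ultimately show "restr (g \<otimes>\<^bsub>Hc_group M\<^esub> f) = restr g \<otimes>\<^bsub>Hc_group D\<^esub> restr f" by simp
  qed
  show "carrier (Hc_group D) \<subseteq> restr ` carrier (Hc_group M)"
  proof
    fix g assume "g \<in> carrier (Hc_group D)"
    then obtain h where h: "compactly_supported_isotopy D h" "h 0 = (\<lambda>z \<in> topspace D. z)" "h 1 = g" "g \<in> homeos D"
      by (auto simp: Hc_group_def)
    obtain H where H: "compactly_supported_isotopy M H" "H 0 = (\<lambda>z \<in> topspace M. z)" "\<And>z. z \<in> bd \<Longrightarrow> H 1 z = h 1 z"
      using extend_isotopy[OF h(1) h(2)[unfolded topspace_D]] by blast
    have "restr (H 1) = g"
      using homeosD(1)[OF h(4)] H(3) h(3) unfolding topspace_D by (auto simp: restr_def fun_eq_iff extensional_def)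
    moreover have "H 1 \<in> carrier (Hc_group M)"
      using H isotopyD[OF H(1), of 1] by (auto simp: Hc_group_def)
    ultimately show "g \<in> restr ` carrier (Hc_group M)" by blast
  qed
qed

end

section \<open>Paths of homeomorphisms of a compact space as isotopies\<close>

lemma topspace_compact_open: "topspace (compact_open_topology N) = homeos N"
proof -
  have "\<Union>{{h \<in> homeos N. h ` K \<subseteq> U} | K U. compactin N K \<and> openin N U} = homeos N"
  proof
    \<comment> \<open>For empty \<open>K\<close> the subbasic set is all of \<open>homeos N\<close>,
      so the subbasis covers it.\<close>
    have "{h \<in> homeos N. h ` {} \<subseteq> {}} \<in> {{h \<in> homeos N. h ` K \<subseteq> U} | K U. compactin N K \<and> openin N U}"
      by (intro CollectI exI[of _ "{}"]) auto
    then show "homeos N \<subseteq> \<Union>{{h \<in> homeos N. h ` K \<subseteq> U} | K U. compactin N K \<and> openin N U}" by auto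
  qed auto
  then show ?thesis unfolding compact_open_topology_def topology_generated_by_topspace .
qed

text \<open>The exponential law: a path gives a jointly continuous map because points of a compact
  Hausdorff space have small compact neighbourhoods, and the converse holds because projection along
  a compact space is closed.\<close>

lemma pathin_compact_open:
  assumes N: "compact_space N" "Hausdorff_space N"
  shows "pathin (compact_open_topology N) g \<longleftrightarrow> isotopy N g"
proof
  assume "pathin (compact_open_topology N) g"
  then have c: "continuous_map unit_interval (compact_open_topology N) g" by (simp add: pathin_def)
  have gh: "g t \<in> homeos N" if "t \<in> {0..1}" for t
    using continuous_map_image_subset_topspace[OF c] that by (auto simp: topspace_compact_open)
  have f: "(\<lambda>(x, t). g t x) w \<in> topspace N" if "w \<in> topspace (prod_topology N unit_interval)" for w
    using that homeosD(3)[OF gh] by auto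
  show "isotopy N g"
    unfolding isotopy_def
  proof (intro conjI ballI gh)
    show "continuous_map (prod_topology N unit_interval) N (\<lambda>(x, t). g t x)"
      unfolding continuous_map
    proof (intro conjI allI impI image_subsetI f)
      fix U assume U: "openin N U"
      show "openin (prod_topology N unit_interval) {w \<in> topspace (prod_topology N unit_interval). (\<lambda>(x, t). g t x) w \<in> U}"
      proof (subst openin_subopen, intro ballI)
        fix w assume "w \<in> {w \<in> topspace (prod_topology N unit_interval). (\<lambda>(x, t). g t x) w \<in> U}"
        then obtain x t where w: "w = (x, t)" "x \<in> topspace N" "t \<in> {0..1}" "g t x \<in> U" by auto
        have "openin N {x \<in> topspace N. g t x \<in> U}"
          by (rule openin_continuous_map_preimage[OF homeosD(2)[OF gh[OF w(3)]] U])
        \<comment> \<open>Regularity places a closed, hence compact, neighbourhood \<open>K\<close>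
          of \<open>x\<close> inside the preimage of \<open>U\<close>; nearby stages still map all
          of \<open>K\<close> into \<open>U\<close>.\<close>
        then obtain A K where A: "openin N A" "closedin N K" "x \<in> A" "A \<subseteq> K" "K \<subseteq> {x \<in> topspace N. g t x \<in> U}"
          using compact_Hausdorff_imp_regular_space[OF N] w
          unfolding neighbourhood_base_of_closedin[symmetric] neighbourhood_base_of by force
        have K: "compactin N K" by (rule closedin_compact_space[OF N(1) A(2)])
        let ?Z = "{h \<in> homeos N. h ` K \<subseteq> U}"
        have "openin (compact_open_topology N) ?Z"
          unfolding compact_open_topology_def by (rule topology_generated_by_Basis) (use K U in blast)
        then have J: "openin unit_interval {s \<in> topspace unit_interval. g s \<in> ?Z}"
          by (rule openin_continuous_map_preimage[OF c])
        let ?T = "A \<times> {s \<in> topspace unit_interval. g s \<in> ?Z}"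
        have "openin (prod_topology N unit_interval) ?T" using A(1) J by (simp only: openin_prod_Times_iff) simp
        moreover have "w \<in> ?T" using w A gh[OF w(3)] by auto
        moreover have "?T \<subseteq> {w \<in> topspace (prod_topology N unit_interval). (\<lambda>(x, t). g t x) w \<in> U}"
          using A(4) openin_subset[OF A(1)] by (fastforce simp: image_subset_iff)
        ultimately show "\<exists>T. openin (prod_topology N unit_interval) T \<and> w \<in> T \<and>
            T \<subseteq> {w \<in> topspace (prod_topology N unit_interval). (\<lambda>(x, t). g t x) w \<in> U}" by blast
      qed
    qed
  qed
next
  assume "isotopy N g"
  then have gh: "\<And>t. t \<in> {0..1} \<Longrightarrow> g t \<in> homeos N"
    and c: "continuous_map (prod_topology N unit_interval) N (\<lambda>(x, t). g t x)" by (auto simp: isotopy_def)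
  show "pathin (compact_open_topology N) g"
    unfolding pathin_def compact_open_topology_def
  proof (rule continuous_on_generated_topo)
    fix Z assume "Z \<in> {{h \<in> homeos N. h ` K \<subseteq> U} | K U. compactin N K \<and> openin N U}"
    then obtain K U where Z: "Z = {h \<in> homeos N. h ` K \<subseteq> U}" and K: "compactin N K" and U: "openin N U" by auto
    \<comment> \<open>\<open>Q\<close> collects the points and times violating the subbasic
      condition; the bad times are its projection, which is closed.\<close>
    define Q where "Q = (K \<times> {0..1}) \<inter> {w \<in> topspace (prod_topology N unit_interval). (\<lambda>(x, t). g t x) w \<in> topspace N - U}"
    have "closedin N K" by (rule compactin_imp_closedin[OF N(2) K])
    then have "closedin (prod_topology N unit_interval) (K \<times> {0..1})" by (simp add: closedin_prod_Times_iff)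
    moreover have "closedin (prod_topology N unit_interval)
        {w \<in> topspace (prod_topology N unit_interval). (\<lambda>(x, t). g t x) w \<in> topspace N - U}"
      by (rule closedin_continuous_map_preimage[OF c]) (use U in blast)
    ultimately have "closedin (prod_topology N unit_interval) Q" unfolding Q_def by (rule closedin_Int)
    then have "closedin unit_interval (snd ` Q)" using closed_map_snd[OF N(1)] by (auto simp: closed_map_def)
    moreover have "g -` Z \<inter> topspace unit_interval = topspace unit_interval - snd ` Q"
    proof -
      have "t \<in> snd ` Q \<longleftrightarrow> \<not> g t ` K \<subseteq> U" if t: "t \<in> {0..1}" for t
      proof -
        have KN: "K \<subseteq> topspace N" using K by (rule compactin_subset_topspace)
        have "\<exists>x. (x, t) \<in> Q" if "\<not> g t ` K \<subseteq> U"
          using that t KN homeosD(3)[OF gh[OF t]] by (auto simp: Q_def image_subset_iff subset_iff)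
        moreover have "\<not> g t ` K \<subseteq> U" if "(x, t) \<in> Q" for x using that by (auto simp: Q_def)
        ultimately show ?thesis by (force simp: image_iff)
      qed
      then have "t \<in> g -` Z \<inter> {0..1} \<longleftrightarrow> t \<in> {0..1} - snd ` Q" for t
        using gh[of t] unfolding Z by blast
      then have "g -` Z \<inter> {0..1} = {0..1} - snd ` Q" by blast
      then show ?thesis by (simp only: topspace_euclidean_subtopology)
    qed
    ultimately show "openin unit_interval (g -` Z \<inter> topspace unit_interval)" by auto
  next
    show "g ` topspace unit_interval \<subseteq> \<Union>{{h \<in> homeos N. h ` K \<subseteq> U} | K U. compactin N K \<and> openin N U}"
      using topspace_compact_open[of N] gh unfolding compact_open_topology_def topology_generated_by_topspace by auto
  qed
qed

text \<open>On a compact space every isotopy is compactly supported, the whole space serving as the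
  compact set.\<close>

lemma H_group_eq_Hc_group:
  assumes "compact_space N" "Hausdorff_space N"
  shows "H_group N = Hc_group N"
proof -
  have cs: "compactly_supported_isotopy N h \<longleftrightarrow> isotopy N h" for h
    using assms(1) closure_of_subset_topspace[of N]
    unfolding compactly_supported_isotopy_def supp_def compact_space_def by blast
  have "path_component_of_set (compact_open_topology N) (\<lambda>x \<in> topspace N. x) =
     {g \<in> homeos N. \<exists>h. compactly_supported_isotopy N h \<and> h 0 = (\<lambda>x \<in> topspace N. x) \<and> h 1 = g}"
    unfolding path_component_of_def pathin_compact_open[OF assms] cs
    by (auto simp: isotopy_def)
  then show ?thesis by (simp add: H_group_def Hc_group_def)
qed

section \<open>Boundary charts\<close>

text \<open>The coordinates are the distances to a countable dense set, obtained from finite nets of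
  mesh \<open>1 / (n + 1)\<close>. This replaces the abstract boundary by a compact subset of a
  complete metric type, on which a \<open>cylinder\<close> can be based.\<close>

lemma compact_metrizable_embedding:
  assumes "compact_space X" "metrizable_space X"
  obtains e :: "'a \<Rightarrow> nat \<Rightarrow> real" where "continuous_map X euclidean e" "inj_on e (topspace X)"
proof -
  obtain A d where "Metric_space A d" and X: "X = Metric_space.mtopology A d"
    using assms(2) by (auto simp: metrizable_space_def)
  interpret Metric_space A d by fact
  have tX: "topspace X = A" by (simp add: X)
  have "mtotally_bounded A"
    using compactin_imp_mtotally_bounded assms(1) by (simp add: compact_space_def X)
  then have "\<exists>F. finite F \<and> F \<subseteq> A \<and> A \<subseteq> (\<Union>x\<in>F. mball x (1 / (real n + 1)))" for n
    unfolding mtotally_bounded_def by (auto simp: add_pos_nonneg)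
  then obtain F where F: "\<And>n. finite (F n)" "\<And>n. F n \<subseteq> A" "\<And>n. A \<subseteq> (\<Union>x\<in>F n. mball x (1 / (real n + 1)))"
    by metis
  define Q where "Q = (\<Union>n. F n)"
  have cQ: "countable Q" unfolding Q_def using F(1) by (auto intro: countable_finite)
  define q where "q = from_nat_into Q"
  define e where "e x n = d x (q n)" for x n
  have QA: "Q \<subseteq> A" using F(2) by (auto simp: Q_def)
  show ?thesis
  proof (cases "A = {}")
    case True
    then show ?thesis using that[of "\<lambda>_ _. 0"] tX by (simp add: continuous_map_def)
  next
    case False
    then have "Q \<noteq> {}" using F(3)[of 0] by (auto simp: Q_def)
    then have qA: "q n \<in> A" for n using from_nat_into[of Q n] QA by (auto simp: q_def)
    have "continuous_map X euclideanreal (\<lambda>x. d x (q n))" for n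
    proof -
      have "mdist (metric (A, d)) = d" "mtopology_of (metric (A, d)) = X" by (simp_all add: mtopology_of_def X)
      then show ?thesis
        using continuous_map_mdist[of X "metric (A, d)" "\<lambda>x. x" "\<lambda>_. q n"] qA[of n] by (simp add: tX)
    qed
    then have "continuous_map X euclidean e"
      unfolding euclidean_product_topology[symmetric] by (simp add: continuous_map_componentwise_UNIV e_def)
    moreover have "inj_on e (topspace X)"
    proof (rule inj_onI, rule ccontr)
      fix x y assume xy: "x \<in> topspace X" "y \<in> topspace X" "e x = e y" "x \<noteq> y"
      then have pos: "0 < d x y" by (simp add: tX)
      \<comment> \<open>A net point closer to \<open>x\<close> than half of \<open>d x y\<close> has
        different distances to \<open>x\<close> and \<open>y\<close>.\<close>
      then obtain n where n: "1 / (real n + 1) < d x y / 2"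
        using reals_Archimedean[of "d x y / 2"] by (auto simp: inverse_eq_divide add_ac)
      obtain z where z: "z \<in> F n" "d z x < 1 / (real n + 1)" using F(3)[of n] xy(1) by (auto simp: tX)
      then have "z \<in> Q" by (auto simp: Q_def)
      then obtain k where "q k = z" using from_nat_into_surj[OF cQ] by (auto simp: q_def)
      then have "d y z = d x z" using fun_cong[OF xy(3), of k] by (simp add: e_def)
      moreover have "d x y \<le> d x z + d z y" using triangle[of x z y] xy QA \<open>z \<in> Q\<close> by (auto simp: tX)
      ultimately show False using z(2) n by (simp add: commute)
    qed
    ultimately show ?thesis by (rule that)
  qed
qed

lemma manifold_interior_homeo:
  assumes g: "g \<in> homeos M" and x: "x \<in> manifold_interior n M"
  shows "g x \<in> manifold_interior n M"
proof -
  obtain U V where UV: "openin M U" "x \<in> U" "openin (Euclidean_space n) V"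
    "subtopology M U homeomorphic_space subtopology (Euclidean_space n) V" and xM: "x \<in> topspace M"
    using x by (auto simp: manifold_interior_def)
  have h: "homeomorphic_map M M g" using g by (simp add: homeos_def)
  have "openin M (g ` U)" using homeomorphic_imp_open_map[OF h] UV(1) by (simp add: open_map_def)
  moreover have "subtopology M U homeomorphic_space subtopology M (g ` U)"
  proof (rule homeomorphic_map_imp_homeomorphic_space[OF homeomorphic_map_subtopologies[OF h]])
    show "g ` (topspace M \<inter> U) = topspace M \<inter> g ` U"
      using openin_subset[OF UV(1)] openin_subset[OF \<open>openin M (g ` U)\<close>] by (simp add: Int_absorb1)
  qed
  then have "subtopology M (g ` U) homeomorphic_space subtopology (Euclidean_space n) V"
    using UV(4) homeomorphic_space_trans homeomorphic_space_sym by blast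
  ultimately show ?thesis
    unfolding manifold_interior_def using UV homeosD(3)[OF g xM] by blast
qed

lemma manifold_boundary_homeo:
  assumes g: "g \<in> homeos M"
  shows "g ` manifold_boundary n M = manifold_boundary n M"
proof
  let ?g' = "\<lambda>x \<in> topspace M. inv_into (topspace M) g x"
  have g': "?g' \<in> homeos M" by (rule homeos_inv[OF g])
  have inv: "?g' (g x) = x" "g (?g' x) = x" if "x \<in> topspace M" for x
    using that homeosD(3-5)[OF g] by (auto simp: f_inv_into_f)
  show "g ` manifold_boundary n M \<subseteq> manifold_boundary n M"
    using manifold_interior_homeo[OF g', of "g _" n] inv(1) homeosD(3)[OF g]
    by (auto simp: manifold_boundary_def) (metis inv(1))
  show "manifold_boundary n M \<subseteq> g ` manifold_boundary n M"
  proof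
    fix x assume x: "x \<in> manifold_boundary n M"
    then have "?g' x \<in> manifold_boundary n M"
      using manifold_interior_homeo[OF g, of "?g' x" n] inv(2) homeosD(3)[OF g', of x]
      by (auto simp: manifold_boundary_def)
    then show "x \<in> g ` manifold_boundary n M" using inv(2)[of x] x by (force simp: manifold_boundary_def)
  qed
qed

lemma open_manifold_interior: "openin M (manifold_interior n M)"
proof (subst openin_subopen, intro ballI)
  fix x assume "x \<in> manifold_interior n M"
  then obtain U V where UV: "openin M U" "x \<in> U" "openin (Euclidean_space n) V"
    "subtopology M U homeomorphic_space subtopology (Euclidean_space n) V" by (auto simp: manifold_interior_def)
  have "U \<subseteq> manifold_interior n M"
    using UV openin_subset[OF UV(1)] unfolding manifold_interior_def by blast
  then show "\<exists>T. openin M T \<and> x \<in> T \<and> T \<subseteq> manifold_interior n M" using UV by blast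
qed

lemma closed_manifold_boundary: "closedin M (manifold_boundary n M)"
  unfolding manifold_boundary_def using open_manifold_interior by blast

lemma Euclidean_space_top: "Euclidean_space n = top_of_set {x. \<forall>i\<ge>n. x i = 0}"
  by (simp add: Euclidean_space_def euclidean_product_topology)

lemma half_space_top: "half_space n = top_of_set {x. (\<forall>i\<ge>n. x i = 0) \<and> 0 \<le> x 0}"
  by (simp add: half_space_def Euclidean_space_top subtopology_subtopology) (rule arg_cong[where f=top_of_set], auto)

text \<open>Coordinate 0 measures the distance from the face of the half space;
  \<open>set0 y 0\<close> is the foot of the perpendicular from \<open>y\<close>.\<close>

definition set0 :: "(nat \<Rightarrow> real) \<Rightarrow> real \<Rightarrow> nat \<Rightarrow> real" where "set0 y t = y(0 := t)"

lemma set0_simps [simp]: "set0 y t 0 = t" "set0 (set0 y s) t = set0 y t" "set0 y (y 0) = y"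
  by (auto simp: set0_def)

lemma continuous_set0 [continuous_intros]:
  "continuous_on A f \<Longrightarrow> continuous_on A g \<Longrightarrow> continuous_on A (\<lambda>w. set0 (f w) (g w))"
proof -
  assume "continuous_on A f" "continuous_on A g"
  then have "continuous_on A (\<lambda>w. set0 (f w) (g w) i)" for i
    by (cases i) (auto simp: set0_def intro: continuous_on_product_then_coordinatewise)
  then show ?thesis by (rule continuous_on_coordinatewise_then_product)
qed

text \<open>Where coordinate 0 is positive, the chart restricts to a Euclidean one. Conversely, a
  Euclidean chart around a point of the face would, by invariance of domain, have an image open in
  Euclidean space although it lies in the half space.\<close>

lemma chart_boundary:
  assumes n: "1 \<le> n" and U: "openin M U" and V: "openin (half_space n) V"
    and \<psi>: "homeomorphic_maps (subtopology M U) (subtopology (half_space n) V) \<psi> \<psi>'"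
    and z: "z \<in> U"
  shows "z \<in> manifold_boundary n M \<longleftrightarrow> \<psi> z 0 = 0"
proof -
  have UM: "U \<subseteq> topspace M" using U by (rule openin_subset)
  have Vh: "V \<subseteq> {x. (\<forall>i\<ge>n. x i = 0) \<and> 0 \<le> x 0}" using openin_subset[OF V] by (simp add: half_space_top)
  have tU: "topspace (subtopology M U) = U" and tV: "topspace (subtopology (half_space n) V) = V"
    using UM Vh by (auto simp: half_space_top)
  have hm: "homeomorphic_map (subtopology M U) (subtopology (half_space n) V) \<psi>"
    using \<psi> homeomorphic_maps_map by blast
  have \<psi>V: "\<psi> w \<in> V" if "w \<in> U" for w
    using homeomorphic_imp_surjective_map[OF hm] that unfolding tU tV by blast
  have inj: "inj_on \<psi> U" using homeomorphic_imp_injective_map[OF hm] unfolding tU .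
  obtain W where W: "open W" "V = {x. (\<forall>i\<ge>n. x i = 0) \<and> 0 \<le> x 0} \<inter> W"
    using V by (auto simp: half_space_top openin_open)
  have interior: "z \<in> manifold_interior n M" if pos: "0 < \<psi> z 0"
  proof -
    define V1 where "V1 = {x. (\<forall>i\<ge>n. x i = 0)} \<inter> (W \<inter> {x. 0 < x 0})"
    have "open {x::nat \<Rightarrow> real. 0 < x 0}" by (rule open_Collect_less) (auto intro: continuous_intros)
    then have V1: "openin (Euclidean_space n) V1"
      unfolding V1_def Euclidean_space_top using W(1) by (intro openin_open_Int open_Int)
    have V1V: "V1 \<subseteq> V" by (auto simp: V1_def W(2))
    define U1 where "U1 = {w \<in> U. \<psi> w \<in> V1}"
    have V1o: "openin (subtopology (half_space n) V) V1"
    proof -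
      have "V1 = V \<inter> (W \<inter> {x. 0 < x 0})" by (auto simp: V1_def W(2))
      moreover have "subtopology (half_space n) V = top_of_set V"
        using Vh by (simp add: half_space_top subtopology_subtopology Int_absorb1)
      ultimately show ?thesis using W(1) \<open>open {x::nat \<Rightarrow> real. 0 < x 0}\<close> by (metis open_Int openin_open_Int)
    qed
    have "openin (subtopology M U) {w \<in> topspace (subtopology M U). \<psi> w \<in> V1}"
      by (rule openin_continuous_map_preimage[OF homeomorphic_imp_continuous_map[OF hm] V1o])
    then have U1: "openin M U1" using U unfolding tU U1_def[symmetric] by (rule openin_trans_full)
    have "subtopology (subtopology M U) U1 homeomorphic_space subtopology (subtopology (half_space n) V) V1"
    proof (rule homeomorphic_map_imp_homeomorphic_space[OF homeomorphic_map_subtopologies[OF hm]])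
      show "\<psi> ` (topspace (subtopology M U) \<inter> U1) = topspace (subtopology (half_space n) V) \<inter> V1"
        using homeomorphic_imp_surjective_map[OF hm] V1V unfolding tU tV by (auto simp: U1_def)
    qed
    moreover have "U1 \<subseteq> U" by (auto simp: U1_def)
    moreover have "subtopology (subtopology (half_space n) V) V1 = subtopology (Euclidean_space n) V1"
      using V1V Vh by (simp add: half_space_def subtopology_subtopology Int_absorb1 Int_absorb2 inf.absorb2) (metis (no_types, lifting) Int_absorb1 V1V Vh inf.assoc le_infI2 mem_Collect_eq subsetI subset_iff)
    ultimately have "subtopology M U1 homeomorphic_space subtopology (Euclidean_space n) V1"
      by (simp add: subtopology_subtopology Int_absorb1)
    moreover have "z \<in> U1" using z pos \<psi>V[OF z] by (simp add: U1_def V1_def W(2))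
    ultimately show ?thesis unfolding manifold_interior_def using U1 V1 z UM by blast
  qed
  have boundary: "\<psi> z 0 \<noteq> 0" if "z \<in> manifold_interior n M"
  proof
    assume 0: "\<psi> z 0 = 0"
    obtain U2 V2 where 2: "openin M U2" "z \<in> U2" "openin (Euclidean_space n) V2"
      "subtopology M U2 homeomorphic_space subtopology (Euclidean_space n) V2"
      using \<open>z \<in> manifold_interior n M\<close> by (auto simp: manifold_interior_def)
    obtain \<xi> \<xi>' where \<xi>: "homeomorphic_maps (subtopology M U2) (subtopology (Euclidean_space n) V2) \<xi> \<xi>'"
      using 2(4) by (auto simp: homeomorphic_space_def)
    have U2M: "U2 \<subseteq> topspace M" using 2(1) by (rule openin_subset)
    have V2E: "V2 \<subseteq> topspace (Euclidean_space n)" using 2(3) by (rule openin_subset)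
    have t2: "topspace (subtopology M U2) = U2" "topspace (subtopology (Euclidean_space n) V2) = V2"
      using U2M V2E by auto
    have c': "continuous_map (subtopology (Euclidean_space n) V2) (subtopology M U2) \<xi>'"
      using \<xi> by (simp add: homeomorphic_maps_def)
    have \<xi>'\<xi>: "\<And>w. w \<in> U2 \<Longrightarrow> \<xi>' (\<xi> w) = w" and \<xi>\<xi>': "\<And>w. w \<in> V2 \<Longrightarrow> \<xi> (\<xi>' w) = w"
      and \<xi>V: "\<And>w. w \<in> U2 \<Longrightarrow> \<xi> w \<in> V2"
      using \<xi> t2 by (auto simp: homeomorphic_maps_def continuous_map_def)
    define V3 where "V3 = {v \<in> V2. \<xi>' v \<in> U}"
    have "openin (subtopology M U2) (U2 \<inter> U)"
      using U by (meson openin_subtopology_Int2)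
    from openin_continuous_map_preimage[OF c' this]
    have "openin (subtopology (Euclidean_space n) V2) {v \<in> V2. \<xi>' v \<in> U2 \<inter> U}" unfolding t2 .
    moreover have "\<xi>' v \<in> U2" if "v \<in> V2" for v
      using continuous_map_image_subset_topspace[OF c'] that unfolding t2 by blast
    then have "{v \<in> V2. \<xi>' v \<in> U2 \<inter> U} = V3" by (auto simp: V3_def)
    ultimately have V3: "openin (Euclidean_space n) V3" using 2(3) openin_trans_full by metis
    let ?f = "\<psi> \<circ> \<xi>'"
    have "continuous_map (subtopology (Euclidean_space n) V3) (subtopology M U) \<xi>'"
      using continuous_map_from_subtopology_mono[OF continuous_map_into_fulltopology[OF c'], of V3]
      by (auto simp: V3_def continuous_map_in_subtopology)
    from continuous_map_compose[OF this homeomorphic_imp_continuous_map[OF hm]]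
    have "continuous_map (subtopology (Euclidean_space n) V3) (Euclidean_space n) ?f"
      unfolding half_space_def subtopology_subtopology by (rule continuous_map_into_fulltopology)
    moreover have "inj_on ?f V3"
    proof (rule inj_onI)
      fix v w assume vw: "v \<in> V3" "w \<in> V3" "?f v = ?f w"
      then have m: "v \<in> V2" "w \<in> V2" "\<xi>' v \<in> U" "\<xi>' w \<in> U" by (auto simp: V3_def)
      from vw(3) have "\<psi> (\<xi>' v) = \<psi> (\<xi>' w)" unfolding o_def .
      then have "\<xi>' v = \<xi>' w" by (rule inj_onD[OF inj _ m(3,4)])
      then have "\<xi> (\<xi>' v) = \<xi> (\<xi>' w)" by (rule arg_cong)
      then show "v = w" unfolding \<xi>\<xi>'[OF m(1)] \<xi>\<xi>'[OF m(2)] .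
    qed
    ultimately have op: "openin (Euclidean_space n) (?f ` V3)"
      by (rule invariance_of_domain_Euclidean_space[OF V3])
    have "\<psi> z \<in> ?f ` V3"
      using 2(2) z \<xi>V[OF 2(2)] \<xi>'\<xi>[OF 2(2)] by (auto simp: V3_def intro!: image_eqI[of _ _ "\<xi> z"])
    obtain W3 where W3: "open W3" "?f ` V3 = {x. \<forall>i\<ge>n. x i = 0} \<inter> W3"
      using op by (auto simp: Euclidean_space_top openin_open)
    have "continuous_on UNIV (\<lambda>e. set0 (\<psi> z) e)" by (intro continuous_intros)
    then have "open ((\<lambda>e. set0 (\<psi> z) e) -` W3)" using W3(1) by (simp add: continuous_on_open_vimage)
    moreover have "0 \<in> (\<lambda>e. set0 (\<psi> z) e) -` W3"
      using \<open>\<psi> z \<in> ?f ` V3\<close> set0_simps(3)[of "\<psi> z"] unfolding W3(2) 0 by simp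
    ultimately obtain e where e: "e > 0" "ball 0 e \<subseteq> (\<lambda>e. set0 (\<psi> z) e) -` W3" by (rule openE)
    have "- e/2 \<in> ball 0 e" using e(1) by simp
    \<comment> \<open>Openness allows coordinate 0 to be moved slightly below zero, out of the half
      space.\<close>
    then have "set0 (\<psi> z) (- e/2) \<in> W3" using e(2) by blast
    moreover have "\<forall>i\<ge>n. set0 (\<psi> z) (- e/2) i = 0" using \<psi>V[OF z] Vh n by (auto simp: set0_def)
    ultimately have "set0 (\<psi> z) (- e/2) \<in> ?f ` V3" using W3(2) by blast
    then have "set0 (\<psi> z) (- e/2) \<in> V" using \<psi>V by (auto simp: V3_def)
    then show False using Vh e(1) by auto
  qed
  have "0 \<le> \<psi> z 0" using \<psi>V[OF z] Vh by auto
  then show ?thesis using interior boundary z UM by (auto simp: manifold_boundary_def less_le)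
qed

section \<open>Existence of collars\<close>

text \<open>Connelly's argument: \<open>attached\<close> is \<open>M\<close> with an infinite exterior collar glued to \<open>B\<close>, realised inside
  \<open>M \<times> \<real>\<close>. Pushing along local collars moves \<open>B\<close> into the exterior collar; the inverse of the total push
  carries part of the exterior collar into \<open>M\<close>.\<close>

definition attached :: "'a topology \<Rightarrow> 'a set \<Rightarrow> ('a \<times> real) topology" where
  "attached M B = subtopology (prod_topology M euclideanreal) (topspace M \<times> {0} \<union> B \<times> {..0})"

lemma topspace_attached:
  "B \<subseteq> topspace M \<Longrightarrow> (z, s) \<in> topspace (attached M B) \<longleftrightarrow> z \<in> topspace M \<and> (s = 0 \<or> z \<in> B \<and> s \<le> 0)"
  by (auto simp: attached_def)

lemma continuous_map_attached:
  "continuous_map (attached M B) M fst" "continuous_map (attached M B) euclideanreal snd"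
  unfolding attached_def
  by (auto intro: continuous_map_from_subtopology continuous_map_fst continuous_map_snd)

text \<open>\<open>down l\<close> translates by \<open>- l\<close> below \<open>0\<close>, is the identity above \<open>1/2\<close> and affine in between; \<open>undo l\<close> is its
  inverse.\<close>

definition down :: "real \<Rightarrow> real \<Rightarrow> real" where "down l u = min u (max (u - l) (u * (1 + 2 * l) - l))"
definition undo :: "real \<Rightarrow> real \<Rightarrow> real" where "undo l u = max u (min (u + l) ((u + l) / (1 + 2 * l)))"

lemma down_nonpos: "0 \<le> l \<Longrightarrow> u \<le> 0 \<Longrightarrow> down l u = u - l"
proof -
  assume "0 \<le> l" "u \<le> 0"
  then have "u * (1 + 2 * l) - l \<le> u - l" using mult_nonneg_nonpos[of l u] by (simp add: algebra_simps)
  then show ?thesis using \<open>0 \<le> l\<close> by (simp add: down_def)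
qed

lemma down_half: "0 \<le> l \<Longrightarrow> 1/2 \<le> u \<Longrightarrow> down l u = u"
proof -
  assume "0 \<le> l" "1/2 \<le> u"
  then have "l * 1 \<le> l * (2 * u)" by (intro mult_left_mono) auto
  then show ?thesis by (simp add: down_def algebra_simps)
qed

lemma down_middle: "0 \<le> l \<Longrightarrow> 0 \<le> u \<Longrightarrow> u \<le> 1/2 \<Longrightarrow> down l u = u * (1 + 2 * l) - l"
proof -
  assume "0 \<le> l" "0 \<le> u" "u \<le> 1/2"
  then have "l * (2 * u) \<le> l * 1" "0 \<le> u * l" using mult_left_mono[of "2 * u" 1 l] by simp_all
  then show ?thesis by (simp add: down_def algebra_simps)
qed

lemma undo_low: "0 \<le> l \<Longrightarrow> u \<le> - l \<Longrightarrow> undo l u = u + l"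
proof -
  assume l: "0 \<le> l" "u \<le> - l"
  then have "(u + l) * (1 + 2 * l) \<le> (u + l) * 1" by (intro mult_left_mono_neg) auto
  then have "u + l \<le> (u + l) / (1 + 2 * l)" using l by (simp add: le_divide_eq)
  then show ?thesis using l by (simp add: undo_def)
qed

lemma undo_half: "0 \<le> l \<Longrightarrow> 1/2 \<le> u \<Longrightarrow> undo l u = u"
proof -
  assume l: "0 \<le> l" "1/2 \<le> u"
  then have "l * 1 \<le> l * (2 * u)" by (intro mult_left_mono) auto
  then have "(u + l) / (1 + 2 * l) \<le> u" using l by (simp add: divide_le_eq algebra_simps)
  then show ?thesis by (simp add: undo_def)
qed

lemma undo_middle: "0 \<le> l \<Longrightarrow> - l \<le> u \<Longrightarrow> u \<le> 1/2 \<Longrightarrow> undo l u = (u + l) / (1 + 2 * l)"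
proof -
  assume l: "0 \<le> l" "- l \<le> u" "u \<le> 1/2"
  have "(u + l) * 1 \<le> (u + l) * (1 + 2 * l)" using l by (intro mult_left_mono) auto
  then have 1: "(u + l) / (1 + 2 * l) \<le> u + l" using l by (simp add: divide_le_eq)
  have "l * (2 * u) \<le> l * 1" using l by (intro mult_left_mono) auto
  then have "u \<le> (u + l) / (1 + 2 * l)" using l by (simp add: le_divide_eq algebra_simps)
  then show ?thesis using 1 by (simp add: undo_def)
qed

lemma undo_down: assumes "0 \<le> l" shows "undo l (down l u) = u"
proof -
  consider "u \<le> 0" | "0 \<le> u" "u \<le> 1/2" | "1/2 \<le> u" by linarith
  then show ?thesis
  proof cases
    case 1 then show ?thesis using assms by (simp add: down_nonpos undo_low)
  next
    case 2
    have "0 \<le> u * (1 + 2 * l)" using 2 assms by simp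
    moreover have "u * (1 + 2 * l) \<le> 1/2 * (1 + 2 * l)" by (rule mult_right_mono) (use 2 assms in auto)
    then have "u * (1 + 2 * l) - l \<le> 1/2" by (simp only: distrib_left)
    ultimately show ?thesis using 2 assms by (simp add: down_middle undo_middle)
  next
    case 3 then show ?thesis using assms by (simp add: down_half undo_half)
  qed
qed

lemma down_undo: assumes "0 \<le> l" shows "down l (undo l u) = u"
proof -
  consider "u \<le> - l" | "- l \<le> u" "u \<le> 1/2" | "1/2 \<le> u" by linarith
  then show ?thesis
  proof cases
    case 1 then show ?thesis using assms by (simp add: down_nonpos undo_low)
  next
    case 2
    have "0 \<le> (u + l) / (1 + 2 * l)" "(u + l) / (1 + 2 * l) \<le> 1/2"
      using 2 assms by (simp_all add: divide_le_eq)
    then show ?thesis using 2 assms by (simp add: down_middle undo_middle)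
  next
    case 3 then show ?thesis using assms by (simp add: down_half undo_half)
  qed
qed

lemma down_0: "down 0 u = u" and undo_0: "undo 0 u = u"
  by (simp_all add: down_def undo_def)

lemma down_less_1: "u < 1 \<Longrightarrow> down l u < 1"
  by (simp add: down_def min_less_iff_disj)

lemma undo_less_1: assumes "0 \<le> l" "u < 1" shows "undo l u < 1"
proof -
  consider "u \<le> - l" | "- l \<le> u" "u \<le> 1/2" | "1/2 \<le> u" by linarith
  then show ?thesis
    using assms by cases (simp_all add: undo_low undo_middle undo_half divide_less_eq)
qed

section \<open>Pushes along a local collar\<close>

text \<open>\<open>h\<close> and the pair \<open>(\<rho>, \<tau>)\<close> are mutually inverse and
  identify the open set \<open>W\<close> with \<open>(W \<inter> B) \<times> [0, 1)\<close>. Foot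
  and height are separate maps because a push acts on the height alone.\<close>

locale local_collar =
  fixes M :: "'a topology" and B :: "'a set" and W :: "'a set" and h :: "'a \<times> real \<Rightarrow> 'a"
    and \<rho> :: "'a \<Rightarrow> 'a" and \<tau> :: "'a \<Rightarrow> real"
  assumes Haus: "Hausdorff_space M" and closed_B: "closedin M B" and open_W: "openin M W"
    and cont_h: "continuous_map (prod_topology (subtopology M (W \<inter> B)) (top_of_set {0..<1})) M h"
    and cont_\<rho>: "continuous_map (subtopology M W) M \<rho>"
    and cont_\<tau>: "continuous_map (subtopology M W) euclideanreal \<tau>"
    and h: "\<And>x t. x \<in> W \<inter> B \<Longrightarrow> 0 \<le> t \<Longrightarrow> t < 1 \<Longrightarrow> h (x, t) \<in> W \<and> \<rho> (h (x, t)) = x \<and> \<tau> (h (x, t)) = t"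
    and \<rho>\<tau>: "\<And>z. z \<in> W \<Longrightarrow> \<rho> z \<in> W \<inter> B \<and> 0 \<le> \<tau> z \<and> \<tau> z < 1 \<and> h (\<rho> z, \<tau> z) = z"
    and h0: "\<And>x. x \<in> W \<inter> B \<Longrightarrow> h (x, 0) = x"
begin

lemma B_sub: "B \<subseteq> topspace M" using closed_B by (rule closedin_subset)
lemma bottom: "x \<in> W \<inter> B \<Longrightarrow> \<rho> x = x \<and> \<tau> x = 0"
  using h[of x 0] h0[of x] by simp

text \<open>The fibre through \<open>z\<close> together with the exterior collar below it is a line
  with coordinate \<open>\<tau> z + s\<close>: its positive part is a height in \<open>W\<close>,
  its negative part a depth outside \<open>M\<close>. The line is reparametrised by \<open>q\<close>
  with the length given by \<open>l\<close>.\<close>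

definition push :: "(real \<Rightarrow> real \<Rightarrow> real) \<Rightarrow> ('a \<Rightarrow> real) \<Rightarrow> 'a \<times> real \<Rightarrow> 'a \<times> real" where
  "push q l w = (if fst w \<in> W then let u = q (l (\<rho> (fst w))) (\<tau> (fst w) + snd w) in
     (h (\<rho> (fst w), max 0 u), min 0 u) else w)"

lemma push_eq: "z \<in> W \<Longrightarrow> push q l (z, s) = (let u = q (l (\<rho> z)) (\<tau> z + s) in (h (\<rho> z, max 0 u), min 0 u))"
  by (simp add: push_def)

lemma push_fix:
  assumes "(z, s) \<in> topspace (attached M B)" "z \<in> W \<Longrightarrow> q (l (\<rho> z)) (\<tau> z + s) = \<tau> z + s"
  shows "push q l (z, s) = (z, s)"
proof (cases "z \<in> W")
  case True
  show ?thesis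
  proof (cases "s = 0")
    case s: False
    then have "z \<in> B" "s < 0" using assms(1) by (auto simp: topspace_attached[OF B_sub])
    then show ?thesis using assms(2) True bottom[of z] h0[of z] by (simp add: push_eq)
  qed (use assms(2) True \<rho>\<tau>[of z] in \<open>simp add: push_eq\<close>)
qed (simp add: push_def)

lemma push_push:
  assumes w: "w \<in> topspace (attached M B)"
    and q: "\<And>l u. 0 \<le> l \<Longrightarrow> q' l (q l u) = u" "\<And>l u. 0 \<le> l \<Longrightarrow> u < 1 \<Longrightarrow> q l u < 1"
    and l: "\<And>x. x \<in> B \<Longrightarrow> 0 \<le> l x"
  shows "push q' l (push q l w) = w"
proof -
  obtain z s where zs: "w = (z, s)" by fastforce
  have ws: "z \<in> topspace M" "s = 0 \<or> z \<in> B \<and> s \<le> 0" using w by (auto simp: zs topspace_attached[OF B_sub])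
  show ?thesis
  proof (cases "z \<in> W")
    case True
    define u where "u = q (l (\<rho> z)) (\<tau> z + s)"
    have l0: "0 \<le> l (\<rho> z)" using \<rho>\<tau>[OF True] l by blast
    have "\<tau> z + s < 1" using \<rho>\<tau>[OF True] ws(2) by auto
    then have u1: "max 0 u < 1" unfolding u_def using q(2)[OF l0] by simp
    have hu: "h (\<rho> z, max 0 u) \<in> W \<and> \<rho> (h (\<rho> z, max 0 u)) = \<rho> z \<and> \<tau> (h (\<rho> z, max 0 u)) = max 0 u"
      using u1 \<rho>\<tau>[OF True] by (intro h) auto
    \<comment> \<open>The pushed point stays on its fibre, and the sum of its height and depth gives
      back the coordinate \<open>u\<close>.\<close>
    have "max 0 u + min 0 u = u" by simp
    then have "push q' l (push q l w) = (h (\<rho> z, max 0 (\<tau> z + s)), min 0 (\<tau> z + s))"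
      using hu True q(1)[OF l0, of "\<tau> z + s"] by (simp add: zs push_eq Let_def u_def[symmetric])
    also have "\<dots> = w"
    proof (cases "s = 0")
      case False
      then show ?thesis using ws bottom[of z] h0[of z] True by (simp add: zs)
    qed (use \<rho>\<tau>[OF True] in \<open>simp add: zs\<close>)
    finally show ?thesis .
  qed (simp add: zs push_def)
qed

text \<open>Over \<open>W\<close> the map is a composition of continuous ones. Elsewhere it is the
  identity, and this already holds off the closed set \<open>Z\<close> lying over \<open>W\<close>;
  the two open regions cover \<open>attached M B\<close>.\<close>

lemma continuous_push:
  assumes q: "continuous_on ({0..} \<times> UNIV) (\<lambda>(l, u). q l u)" "\<And>l u. 0 \<le> l \<Longrightarrow> u < 1 \<Longrightarrow> q l u < 1"
      "\<And>u. q 0 u = u" "\<And>l u. 0 \<le> l \<Longrightarrow> 1/2 \<le> u \<Longrightarrow> q l u = u"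
    and l: "continuous_map (subtopology M B) euclideanreal l" "\<And>x. x \<in> B \<Longrightarrow> 0 \<le> l x"
    and K: "compactin M K" "K \<subseteq> W \<inter> B" "\<And>x. x \<in> B - K \<Longrightarrow> l x = 0"
  shows "continuous_map (attached M B) (attached M B) (push q l)"
proof (rule continuous_map_open_cover)
  let ?A = "attached M B"
  let ?U = "{w \<in> topspace ?A. fst w \<in> W}"
  \<comment> \<open>All that the push can move: heights up to \<open>1/2\<close> and all depths,
    over the compact set \<open>K\<close> off which \<open>l\<close> vanishes.\<close>
  define Z where "Z = h ` (K \<times> {0..1/2}) \<times> {0} \<union> K \<times> {..0::real}"
  let ?V = "{w \<in> topspace ?A. w \<in> topspace (prod_topology M euclideanreal) - Z}"
  show U: "openin ?A ?U" by (rule openin_continuous_map_preimage[OF continuous_map_attached(1) open_W])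
  have "closedin M (h ` (K \<times> {0..1/2}))"
  proof (rule compactin_imp_closedin[OF Haus image_compactin[OF _ cont_h]])
    have "compactin (subtopology M (W \<inter> B)) K" using K by (simp add: compactin_subtopology)
    moreover have "compactin (top_of_set {0..<1::real}) {0..1/2}" by (auto simp: compactin_subtopology)
    ultimately show "compactin (prod_topology (subtopology M (W \<inter> B)) (top_of_set {0..<1})) (K \<times> {0..1/2::real})"
      by (simp add: compactin_Times)
  qed
  moreover have "closedin M K" by (rule compactin_imp_closedin[OF Haus K(1)])
  ultimately have "closedin (prod_topology M euclideanreal) Z"
    unfolding Z_def by (intro closedin_Un) (simp_all add: closedin_prod_Times_iff)
  then have oV: "openin (prod_topology M euclideanreal) (topspace (prod_topology M euclideanreal) - Z)" by blast
  have "continuous_map ?A (prod_topology M euclideanreal) id"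
    unfolding attached_def by (rule continuous_map_from_subtopology) simp
  from openin_continuous_map_preimage[OF this oV]
  show "openin ?A ?V" by simp
  have ZW: "fst w \<in> W" if "w \<in> Z" for w
    using that K(2) h by (fastforce simp: Z_def)
  show "topspace ?A \<subseteq> ?U \<union> ?V" using ZW by (auto simp: attached_def)
  show "continuous_map (subtopology ?A ?V) ?A (push q l)"
  proof (rule continuous_map_eq)
    show "continuous_map (subtopology ?A ?V) ?A id" by (intro continuous_map_from_subtopology) simp
    fix w assume w: "w \<in> topspace (subtopology ?A ?V)"
    obtain z s where zs: "w = (z, s)" by fastforce
    have A: "(z, s) \<in> topspace ?A" "(z, s) \<notin> Z" using w zs by auto
    have "push q l (z, s) = (z, s)"
    proof (rule push_fix[OF A(1)])
      assume zW: "z \<in> W"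
      show "q (l (\<rho> z)) (\<tau> z + s) = \<tau> z + s"
      proof (cases "\<rho> z \<in> K")
        case True
        have "1/2 \<le> \<tau> z + s"
        proof (cases "s = 0")
          case s: True
          show ?thesis
          proof (rule ccontr)
            assume "\<not> ?thesis"
            then have "z \<in> h ` (K \<times> {0..1/2})"
              using \<rho>\<tau>[OF zW] True s by (intro image_eqI[of _ _ "(\<rho> z, \<tau> z)"]) auto
            then show False using A(2) s by (auto simp: Z_def)
          qed
        next
          case False
          then have "z \<in> B" "s \<le> 0" using A(1) by (auto simp: topspace_attached[OF B_sub])
          then show ?thesis using bottom[of z] zW True A(2) by (auto simp: Z_def)
        qed
        then show ?thesis using q(4) l(2) True K(2) by auto
      next
        case False
        then have "l (\<rho> z) = 0" using K(3) \<rho>\<tau>[OF zW] by blast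
        then show ?thesis by (simp add: q(3))
      qed
    qed
    then show "id w = push q l w" by (simp add: zs)
  qed
  show "continuous_map (subtopology ?A ?U) ?A (push q l)"
  proof (rule continuous_map_eq)
    let ?u = "\<lambda>w. q (l (\<rho> (fst w))) (\<tau> (fst w) + snd w)"
    have f: "continuous_map (subtopology ?A ?U) (subtopology M W) fst"
      using continuous_map_from_subtopology[OF continuous_map_attached(1)] by (auto simp: continuous_map_in_subtopology)
    have "continuous_map (subtopology M W) (subtopology M (W \<inter> B)) \<rho>"
      using cont_\<rho> \<rho>\<tau> by (auto simp: continuous_map_in_subtopology)
    from continuous_map_compose[OF f this]
    have r: "continuous_map (subtopology ?A ?U) (subtopology M (W \<inter> B)) (\<lambda>w. \<rho> (fst w))" by (simp add: o_def)
    then have "continuous_map (subtopology ?A ?U) (subtopology M B) (\<lambda>w. \<rho> (fst w))"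
      by (auto simp: continuous_map_in_subtopology)
    from continuous_map_compose[OF this l(1)]
    have lr: "continuous_map (subtopology ?A ?U) euclideanreal (\<lambda>w. l (\<rho> (fst w)))" by (simp add: o_def)
    have "continuous_map (subtopology ?A ?U) euclideanreal (\<lambda>w. \<tau> (fst w))"
      using continuous_map_compose[OF f cont_\<tau>] by (simp add: o_def)
    then have ts: "continuous_map (subtopology ?A ?U) euclideanreal (\<lambda>w. \<tau> (fst w) + snd w)"
      by (rule continuous_map_add[OF _ continuous_map_from_subtopology[OF continuous_map_attached(2)]])
    have "continuous_map (subtopology ?A ?U) (prod_topology euclideanreal euclideanreal) (\<lambda>w. (l (\<rho> (fst w)), \<tau> (fst w) + snd w))"
      unfolding continuous_map_pairwise o_def fst_conv snd_conv using lr ts by blast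
    then have "continuous_map (subtopology ?A ?U) (top_of_set ({0..} \<times> UNIV)) (\<lambda>w. (l (\<rho> (fst w)), \<tau> (fst w) + snd w))"
      using l(2) \<rho>\<tau> by (auto simp: continuous_map_in_subtopology)
    moreover have "continuous_map (top_of_set ({0..} \<times> UNIV)) euclideanreal (\<lambda>(l, u). q l u)" using q(1) by simp
    ultimately have "continuous_map (subtopology ?A ?U) euclideanreal ((\<lambda>(l, u). q l u) \<circ> (\<lambda>w. (l (\<rho> (fst w)), \<tau> (fst w) + snd w)))"
      by (rule continuous_map_compose)
    then have u: "continuous_map (subtopology ?A ?U) euclideanreal ?u" by (simp add: o_def)
    have u1: "?u w < 1" if "w \<in> topspace (subtopology ?A ?U)" for w
    proof -
      have "fst w \<in> W" "snd w \<le> 0" using that by (auto simp: attached_def)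
      then show ?thesis using q(2) l(2) \<rho>\<tau>[of "fst w"] by auto
    qed
    have mx: "continuous_map (subtopology ?A ?U) euclideanreal (\<lambda>w. max 0 (?u w))"
      and mn: "continuous_map (subtopology ?A ?U) euclideanreal (\<lambda>w. min 0 (?u w))"
      using u by (auto intro!: continuous_map_real_max continuous_map_real_min)
    have "continuous_map (subtopology ?A ?U) (top_of_set {0..<1}) (\<lambda>w. max 0 (?u w))"
      using mx u1 by (auto simp: continuous_map_in_subtopology)
    then have "continuous_map (subtopology ?A ?U) (prod_topology (subtopology M (W \<inter> B)) (top_of_set {0..<1}))
       (\<lambda>w. (\<rho> (fst w), max 0 (?u w)))"
      unfolding continuous_map_pairwise o_def fst_conv snd_conv using r by blast
    from continuous_map_compose[OF this cont_h]
    have hm: "continuous_map (subtopology ?A ?U) M (\<lambda>w. h (\<rho> (fst w), max 0 (?u w)))" by (simp add: o_def)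
    have "continuous_map (subtopology ?A ?U) (prod_topology M euclideanreal) (\<lambda>w. (h (\<rho> (fst w), max 0 (?u w)), min 0 (?u w)))"
      unfolding continuous_map_pairwise o_def fst_conv snd_conv using hm mn by blast
    moreover have "(h (\<rho> (fst w), max 0 (?u w)), min 0 (?u w)) \<in> topspace M \<times> {0} \<union> B \<times> {..0}"
      if w: "w \<in> topspace (subtopology ?A ?U)" for w
    proof (cases "0 \<le> ?u w")
      case True
      then show ?thesis using continuous_map_image_subset_topspace[OF hm] w by auto
    next
      case False
      have "fst w \<in> W" using w by auto
      then show ?thesis using \<rho>\<tau>[of "fst w"] h0[of "\<rho> (fst w)"] False by auto
    qed
    ultimately show "continuous_map (subtopology ?A ?U) ?A (\<lambda>w. (h (\<rho> (fst w), max 0 (?u w)), min 0 (?u w)))"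
      by (auto simp: attached_def continuous_map_in_subtopology)
    fix w assume "w \<in> topspace (subtopology ?A ?U)"
    then show "(h (\<rho> (fst w), max 0 (?u w)), min 0 (?u w)) = push q l w" by (auto simp: push_def Let_def)
  qed
qed

lemma push_homeomorphic:
  assumes l: "continuous_map (subtopology M B) euclideanreal l" "\<And>x. x \<in> B \<Longrightarrow> 0 \<le> l x"
    and K: "compactin M K" "K \<subseteq> W \<inter> B" "\<And>x. x \<in> B - K \<Longrightarrow> l x = 0"
  shows "homeomorphic_maps (attached M B) (attached M B) (push down l) (push undo l)"
    "\<And>x s. x \<in> B \<Longrightarrow> s \<le> 0 \<Longrightarrow> push down l (x, s) = (x, s - l x)"
proof -
  have "continuous_on ({0..} \<times> UNIV) (\<lambda>(l, u). down l u)"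
    unfolding down_def case_prod_unfold by (intro continuous_intros)
  moreover have "continuous_on ({0..} \<times> UNIV) (\<lambda>(l, u). undo l u)"
    unfolding undo_def case_prod_unfold by (intro continuous_intros) auto
  ultimately show "homeomorphic_maps (attached M B) (attached M B) (push down l) (push undo l)"
    unfolding homeomorphic_maps_def
    by (intro conjI continuous_push[OF _ _ _ _ l K] ballI push_push l)
      (auto simp: down_less_1 undo_less_1 down_0 undo_0 down_half undo_half undo_down down_undo)
  fix x s assume x: "x \<in> B" "s \<le> (0::real)"
  show "push down l (x, s) = (x, s - l x)"
  proof (cases "x \<in> W")
    case True
    then show ?thesis using x bottom[of x] h0[of x] l(2)[OF x(1)] by (simp add: push_eq Let_def down_nonpos)
  next
    case False
    then have "l x = 0" using K x by auto
    then show ?thesis using False by (simp add: push_def)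
  qed
qed

end

section \<open>From boundary charts to a global collar\<close>

text \<open>Within a boundary chart a box over a neighbourhood of the image of \<open>p\<close> in
  the face is a product; its height \<open>r\<close> is normalised to 1.\<close>

lemma chart_local_collar:
  assumes n: "1 \<le> n" and M: "Hausdorff_space M" and U: "openin M U" and V: "openin (half_space n) V"
    and \<psi>: "homeomorphic_maps (subtopology M U) (subtopology (half_space n) V) \<psi> \<psi>'"
    and p: "p \<in> U" "p \<in> manifold_boundary n M"
  shows "\<exists>W h \<rho> \<tau>. local_collar M (manifold_boundary n M) W h \<rho> \<tau> \<and> p \<in> W"
proof -
  let ?B = "manifold_boundary n M"
  let ?H = "{x. (\<forall>i\<ge>n. x i = 0) \<and> 0 \<le> x 0} :: (nat \<Rightarrow> real) set"
  note B = chart_boundary[OF n U V \<psi>]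
  have UM: "U \<subseteq> topspace M" using U by (rule openin_subset)
  have VH: "V \<subseteq> ?H" using openin_subset[OF V] by (simp add: half_space_top)
  have sV: "subtopology (half_space n) V = top_of_set V"
    using VH by (simp add: half_space_top subtopology_subtopology Int_absorb1)
  have c: "continuous_map (subtopology M U) (top_of_set V) \<psi>"
    and c': "continuous_map (top_of_set V) (subtopology M U) \<psi>'"
    using \<psi> by (simp_all add: homeomorphic_maps_def sV)
  have inv: "z \<in> U \<Longrightarrow> \<psi>' (\<psi> z) = z" "y \<in> V \<Longrightarrow> \<psi> (\<psi>' y) = y" for z y
    using \<psi> UM by (auto simp: homeomorphic_maps_def sV)
  have mem: "z \<in> U \<Longrightarrow> \<psi> z \<in> V" "y \<in> V \<Longrightarrow> \<psi>' y \<in> U" for z y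
    using continuous_map_image_subset_topspace[OF c] continuous_map_image_subset_topspace[OF c'] UM by auto
  have set0H: "set0 y t \<in> ?H" if "y \<in> ?H" "0 \<le> t" for y t using that n by (auto simp: set0_def)
  \<comment> \<open>Pairs of a foot and a height whose combination stays in the chart. A product
    neighbourhood inside this open set yields one height \<open>r\<close> valid for all nearby
    feet.\<close>
  define D where "D = {w \<in> ?H \<times> {0..}. set0 (fst w) (snd w) \<in> V}"
  have "openin (top_of_set (?H \<times> {0..})) ((?H \<times> {0..}) \<inter> (\<lambda>w. set0 (fst w) (snd w)) -` V)"
  proof (rule continuous_openin_preimage)
    show "continuous_on (?H \<times> {0..}) (\<lambda>w. set0 (fst w) (snd w))" by (intro continuous_intros)
    show "(\<lambda>w. set0 (fst w) (snd w)) \<in> ?H \<times> {0..} \<rightarrow> ?H" using set0H by fastforce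
    show "openin (top_of_set ?H) V" using V by (simp add: half_space_top)
  qed
  moreover have "(?H \<times> {0..}) \<inter> (\<lambda>w. set0 (fst w) (snd w)) -` V = D" by (auto simp: D_def)
  ultimately have "openin (top_of_set (?H \<times> {0..})) D" by metis
  then have "openin (prod_topology (top_of_set ?H) (top_of_set {0..})) D" by simp
  moreover have \<psi>p0: "\<psi> p 0 = 0" using B[OF p(1)] p(2) by simp
  then have "set0 (\<psi> p) 0 = \<psi> p" using set0_simps(3)[of "\<psi> p"] by simp
  then have "(\<psi> p, 0) \<in> D" using mem(1)[OF p(1)] VH by (auto simp: D_def)
  ultimately obtain Y T where Y: "openin (top_of_set ?H) Y" "openin (top_of_set {0::real..}) T" "\<psi> p \<in> Y" "0 \<in> T" "Y \<times> T \<subseteq> D"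
    unfolding openin_prod_topology_alt by meson
  obtain T' where T': "open T'" "T = {0..} \<inter> T'" using Y(2) by (auto simp: openin_open)
  then obtain r where r: "r > 0" "ball 0 r \<subseteq> T'" using Y(4) openE[of T' 0] by auto
  have inV: "set0 y t \<in> V" if "set0 y 0 \<in> Y" "0 \<le> t" "t < r" for y t
  proof -
    have "t \<in> T" using that r T' by (auto simp: dist_real_def)
    then have "(set0 y 0, t) \<in> D" using that Y(5) by blast
    then show ?thesis by (simp add: D_def)
  qed
  \<comment> \<open>Points with foot in \<open>Y\<close> and height below \<open>r\<close>; the
    vertical segments of length \<open>r\<close> through them stay in the chart, so \<open>W\<close>
    is a full product.\<close>
  define G where "G = {y \<in> V. set0 y 0 \<in> Y \<and> y 0 < r}"
  define W where "W = {z \<in> U. \<psi> z \<in> G}"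
  define h where "h w = \<psi>' (set0 (\<psi> (fst w)) (r * snd w))" for w :: "'a \<times> real"
  define \<rho> where "\<rho> z = \<psi>' (set0 (\<psi> z) 0)" for z
  define \<tau> where "\<tau> z = \<psi> z 0 / r" for z
  have "openin (top_of_set V) G"
  proof -
    have "openin (top_of_set V) (V \<inter> (\<lambda>y. set0 y 0) -` Y)"
    proof (rule continuous_openin_preimage)
      show "continuous_on V (\<lambda>y. set0 y 0)" by (intro continuous_intros)
      show "(\<lambda>y. set0 y 0) \<in> V \<rightarrow> ?H"
      proof (rule Pi_I)
        fix y assume "y \<in> V"
        then have "y \<in> ?H" using VH by (rule subsetD[rotated])
        then show "set0 y 0 \<in> ?H" by (rule set0H) simp
      qed
    qed (rule Y(1))
    moreover have "open {y::nat \<Rightarrow> real. y 0 < r}" by (rule open_Collect_less) (auto intro: continuous_intros)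
    then have "openin (top_of_set V) (V \<inter> {y. y 0 < r})" by (rule openin_open_Int)
    ultimately have "openin (top_of_set V) ((V \<inter> (\<lambda>y. set0 y 0) -` Y) \<inter> (V \<inter> {y. y 0 < r}))" by (rule openin_Int)
    moreover have "(V \<inter> (\<lambda>y. set0 y 0) -` Y) \<inter> (V \<inter> {y. y 0 < r}) = G" by (auto simp: G_def)
    ultimately show ?thesis by simp
  qed
  from openin_continuous_map_preimage[OF c this]
  have "openin (subtopology M U) W" using UM by (simp add: W_def Int_absorb1 Int_def subset_iff conj_commute cong: conj_cong)
  then have oW: "openin M W" using U by (rule openin_trans_full)
  have WU: "W \<subseteq> U" by (auto simp: W_def)
  have nn: "0 \<le> \<psi> z 0" if "z \<in> U" for z using mem(1)[OF that] VH by auto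
  have cW: "continuous_map (subtopology M W) (top_of_set V) \<psi>"
    by (rule continuous_map_from_subtopology_mono[OF c WU])
  have c'M: "continuous_map (top_of_set V) M \<psi>'" by (rule continuous_map_into_fulltopology[OF c'])
  have slice: "\<psi>' (set0 (\<psi> z) t) \<in> W" "\<psi> (\<psi>' (set0 (\<psi> z) t)) = set0 (\<psi> z) t" if "z \<in> W" "0 \<le> t" "t < r" for z t
  proof -
    have v: "set0 (\<psi> z) t \<in> V" using inV[of "\<psi> z" t] that by (auto simp: W_def G_def)
    then show "\<psi> (\<psi>' (set0 (\<psi> z) t)) = set0 (\<psi> z) t" by (rule inv(2))
    then show "\<psi>' (set0 (\<psi> z) t) \<in> W" using v mem(2) that by (auto simp: W_def G_def)
  qed
  have rt: "0 \<le> r * t" "r * t < r" if "0 \<le> t" "t < 1" for t using that r(1) by auto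
  have lc: "local_collar M ?B W h \<rho> \<tau>"
  proof
    show "Hausdorff_space M" "closedin M ?B" "openin M W" by (rule M closed_manifold_boundary oW)+
    let ?P = "prod_topology (subtopology M (W \<inter> ?B)) (top_of_set {0..<1::real})"
    have "continuous_map (subtopology M (W \<inter> ?B)) euclidean \<psi>"
      using continuous_map_from_subtopology_mono[OF cW, of "W \<inter> ?B"] continuous_map_into_fulltopology by blast
    then have "continuous_map ?P euclidean (\<lambda>w. \<psi> (fst w))"
      using continuous_map_compose[OF continuous_map_fst] unfolding o_def by blast
    moreover have "continuous_map (top_of_set {0..<1::real}) euclideanreal (\<lambda>t. r * t)"
      by (simp add: continuous_intros)
    then have "continuous_map ?P euclideanreal (\<lambda>w. r * snd w)"
      using continuous_map_compose[OF continuous_map_snd] unfolding o_def by blast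
    ultimately have "continuous_map ?P (prod_topology euclidean euclideanreal) (\<lambda>w. (\<psi> (fst w), r * snd w))"
      unfolding continuous_map_pairwise o_def fst_conv snd_conv by blast
    moreover have "continuous_map (prod_topology euclidean euclideanreal) euclidean (\<lambda>w. set0 (fst w) (snd w))"
      by (simp add: continuous_intros)
    ultimately have "continuous_map ?P euclidean (\<lambda>w. set0 (\<psi> (fst w)) (r * snd w))"
      using continuous_map_compose[of ?P _ "\<lambda>w. (\<psi> (fst w), r * snd w)" _ "\<lambda>w. set0 (fst w) (snd w)"] unfolding o_def fst_conv snd_conv by blast
    moreover have "set0 (\<psi> (fst w)) (r * snd w) \<in> V" if "w \<in> topspace ?P" for w
      using that inV rt by (auto simp: W_def G_def)
    ultimately have "continuous_map ?P (top_of_set V) (\<lambda>w. set0 (\<psi> (fst w)) (r * snd w))"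
      unfolding continuous_map_in_subtopology by blast
    from continuous_map_compose[OF this c'M] show "continuous_map ?P M h" unfolding h_def o_def .
    have bottom: "continuous_map (top_of_set G) (top_of_set V) (\<lambda>y. set0 y 0)"
      using inV[of _ 0] r(1) continuous_set0[OF continuous_on_id continuous_on_const, of G 0] by (auto simp: G_def)
    have "continuous_map (subtopology M W) (top_of_set G) \<psi>"
      using cW by (auto simp: continuous_map_in_subtopology W_def)
    from continuous_map_compose[OF continuous_map_compose[OF this bottom] c'M]
    show "continuous_map (subtopology M W) M \<rho>" unfolding \<rho>_def o_def .
    have "continuous_map (top_of_set V) euclideanreal (\<lambda>y. y 0 / r)"
    proof -
      have "continuous_on V (\<lambda>y::nat \<Rightarrow> real. y 0)"
        by (rule continuous_on_subset[OF continuous_on_product_coordinates]) simp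
      then have "continuous_on V (\<lambda>y. y 0 / r)"
        by (rule continuous_on_divide[OF _ continuous_on_const]) (use r(1) in simp)
      then show ?thesis by (simp only: continuous_map_iff_continuous)
    qed
    from continuous_map_compose[OF cW this]
    show "continuous_map (subtopology M W) euclideanreal \<tau>" unfolding \<tau>_def o_def .
    show "h (x, t) \<in> W \<and> \<rho> (h (x, t)) = x \<and> \<tau> (h (x, t)) = t" if "x \<in> W \<inter> ?B" "0 \<le> t" "t < 1" for x t
    proof -
      have x: "x \<in> W" "x \<in> U" "\<psi> x 0 = 0" using that(1) WU B by auto
      have "set0 (\<psi> x) 0 = \<psi> x" using set0_simps(3)[of "\<psi> x"] x(3) by simp
      then show ?thesis using slice[OF x(1) rt[OF that(2,3)]] inv(1)[OF x(2)] r(1) by (simp add: h_def \<rho>_def \<tau>_def)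
    qed
    show "\<rho> z \<in> W \<inter> ?B \<and> 0 \<le> \<tau> z \<and> \<tau> z < 1 \<and> h (\<rho> z, \<tau> z) = z" if z: "z \<in> W" for z
    proof -
      have zU: "z \<in> U" "\<psi> z 0 < r" using z by (auto simp: W_def G_def)
      have 0: "\<rho> z \<in> W" "\<psi> (\<rho> z) = set0 (\<psi> z) 0" using slice[OF z, of 0] r(1) by (simp_all add: \<rho>_def)
      then have "\<rho> z \<in> ?B" using B[of "\<rho> z"] WU by auto
      moreover have "0 \<le> \<tau> z" "\<tau> z < 1" "r * \<tau> z = \<psi> z 0" using nn[OF zU(1)] zU r(1) by (auto simp: \<tau>_def)
      ultimately show ?thesis using 0 inv(1)[OF zU(1)] by (simp add: h_def)
    qed
    show "h (x, 0) = x" if "x \<in> W \<inter> ?B" for x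
    proof -
      have x: "x \<in> U" "\<psi> x 0 = 0" using that WU B by auto
      then show ?thesis using set0_simps(3)[of "\<psi> x"] inv(1)[OF x(1)] by (simp add: h_def)
    qed
  qed
  have "p \<in> W"
    using p(1) mem(1)[OF p(1)] Y(3) \<psi>p0 r(1) \<open>set0 (\<psi> p) 0 = \<psi> p\<close> by (simp add: W_def G_def)
  then show ?thesis using lc by blast
qed

text \<open>Urysohn's lemma on the compact Hausdorff space \<open>B\<close> supplies the length of
  the push: positive at \<open>p\<close> and zero off a compact part of \<open>W\<close>.\<close>

lemma local_push:
  assumes lc: "local_collar M B W h \<rho> \<tau>" and p: "p \<in> W" "p \<in> B" and cB: "compactin M B"
  shows "\<exists>l P P'. continuous_map (subtopology M B) euclideanreal l \<and> (\<forall>x\<in>B. 0 \<le> l x) \<and> 0 < l p \<and>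
    homeomorphic_maps (attached M B) (attached M B) P P' \<and> (\<forall>x\<in>B. \<forall>s\<le>0. P (x, s) = (x, s - l x))"
proof -
  interpret local_collar M B W h \<rho> \<tau> by (rule lc)
  let ?X = "subtopology M B"
  have tX: "topspace ?X = B" using B_sub by auto
  have X: "compact_space ?X" "Hausdorff_space ?X"
    using cB Haus by (auto simp: compact_space_subtopology Hausdorff_space_subtopology)
  have "openin ?X (B \<inter> W)" using open_W by (rule openin_subtopology_Int2)
  then have "openin ?X (B \<inter> W) \<and> p \<in> B \<inter> W" using p by simp
  from compact_Hausdorff_imp_regular_space[OF X, unfolded neighbourhood_base_of_closedin[symmetric]
      neighbourhood_base_of, rule_format, OF this]
  obtain A K where A: "openin ?X A" "closedin ?X K" "p \<in> A" "A \<subseteq> K" "K \<subseteq> B \<inter> W"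
    by (elim exE conjE)
  have "normal_space ?X" using X compact_Hausdorff_or_regular_imp_normal_space by blast
  moreover have "closedin ?X (topspace ?X - A)" using A(1) by (rule openin_closedin_eq[THEN iffD1, THEN conjunct2])
  then have "closedin ?X (B - A)" unfolding tX .
  moreover have "closedin ?X {p}" using X(2) p tX by (simp add: closedin_Hausdorff_singleton)
  moreover have "disjnt (B - A) {p}" using A(3) by (auto simp: disjnt_def)
  ultimately obtain f where f: "continuous_map ?X euclideanreal f" "f ` (B - A) \<subseteq> {0}" "f ` {p} \<subseteq> {1}"
    by (rule Urysohn_lemma_alt)
  define l where "l x = max 0 (f x)" for x
  have l: "continuous_map ?X euclideanreal l" unfolding l_def by (intro continuous_map_real_max f(1)) simp
  have "compactin ?X K" by (rule closedin_compact_space[OF X(1) A(2)])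
  then have K: "compactin M K" by (simp add: compactin_subtopology)
  have K2: "K \<subseteq> W \<inter> B" using A(5) by blast
  have K3: "l x = 0" if "x \<in> B - K" for x
  proof -
    have "x \<in> B - A" using that A(4) by blast
    then have "f x = 0" using f(2) by blast
    then show ?thesis by (simp add: l_def)
  qed
  have l0: "\<And>x. x \<in> B \<Longrightarrow> 0 \<le> l x" by (simp add: l_def)
  show ?thesis
  proof (rule exI[of _ l], rule exI[of _ "push down l"], rule exI[of _ "push undo l"])
    have "0 < l p" using f(3) by (simp add: l_def)
    then show "continuous_map ?X euclideanreal l \<and> (\<forall>x\<in>B. 0 \<le> l x) \<and> 0 < l p \<and>
      homeomorphic_maps (attached M B) (attached M B) (push down l) (push undo l) \<and>
      (\<forall>x\<in>B. \<forall>s\<le>0. push down l (x, s) = (x, s - l x))"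
      using l l0 push_homeomorphic[OF l l0 K K2 K3] by blast
  qed
qed

theorem collar_exists:
  fixes M :: "'a topology"
  assumes n: "1 \<le> n" and met: "metrizable_space M" and man: "topological_manifold n M"
    and cB: "compactin M (manifold_boundary n M)"
  shows "\<exists>(S :: (nat \<Rightarrow> real) set) c. collar S M c \<and> collar.bd S c = manifold_boundary n M"
proof -
  define B where "B = manifold_boundary n M"
  have cB: "compactin M B" using cB by (simp add: B_def)
  let ?A = "attached M B" and ?X = "subtopology M B"
  have Haus: "Hausdorff_space M" using man by (simp add: topological_manifold_def)
  have clB: "closedin M B" unfolding B_def by (rule closed_manifold_boundary)
  have BM: "B \<subseteq> topspace M" using clB by (rule closedin_subset)
  have tX: "topspace ?X = B" using BM by auto
  define R where "R p l P P' \<longleftrightarrow> continuous_map ?X euclideanreal l \<and> (\<forall>x\<in>B. 0 \<le> l x) \<and> 0 < l p \<and>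
      homeomorphic_maps ?A ?A P P' \<and> (\<forall>x\<in>B. \<forall>s\<le>0. P (x, s) = (x, s - l x))" for p l P P'
  have "\<exists>l P P'. R p l P P'" if p: "p \<in> B" for p
  proof -
    have "p \<in> topspace M" using p BM by blast
    then obtain U V where UV: "openin M U" "p \<in> U" "openin (half_space n) V"
        "subtopology M U homeomorphic_space subtopology (half_space n) V"
      using man unfolding topological_manifold_def by blast
    then obtain \<psi> \<psi>' where "homeomorphic_maps (subtopology M U) (subtopology (half_space n) V) \<psi> \<psi>'"
      by (auto simp: homeomorphic_space_def)
    from chart_local_collar[OF n Haus UV(1,3) this UV(2)] p
    obtain W h \<rho> \<tau> where W: "local_collar M B W h \<rho> \<tau>" "p \<in> W" unfolding B_def by blast
    show ?thesis using local_push[OF W p cB] unfolding R_def .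
  qed
  then obtain l P P' where R: "\<And>p. p \<in> B \<Longrightarrow> R p (l p) (P p) (P' p)" by metis
  have l: "\<And>p. p \<in> B \<Longrightarrow> continuous_map ?X euclideanreal (l p)"
      "\<And>p x. p \<in> B \<Longrightarrow> x \<in> B \<Longrightarrow> 0 \<le> l p x" "\<And>p. p \<in> B \<Longrightarrow> 0 < l p p"
      "\<And>p. p \<in> B \<Longrightarrow> homeomorphic_maps ?A ?A (P p) (P' p)"
      "\<And>p x s. p \<in> B \<Longrightarrow> x \<in> B \<Longrightarrow> s \<le> 0 \<Longrightarrow> P p (x, s) = (x, s - l p x)"
    using R unfolding R_def by simp_all
  have cover: "\<exists>F. finite F \<and> F \<subseteq> (\<lambda>p. {x \<in> topspace ?X. l p x \<in> {0<..}}) ` B \<and> B \<subseteq> \<Union>F"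
  proof (rule compactinD)
    show "compactin ?X B" using cB by (simp add: compactin_subtopology)
    show "openin ?X U" if "U \<in> (\<lambda>p. {x \<in> topspace ?X. l p x \<in> {0<..}}) ` B" for U
      using that openin_continuous_map_preimage[OF l(1), of _ "{0<..}"] by auto
    show "B \<subseteq> \<Union>((\<lambda>p. {x \<in> topspace ?X. l p x \<in> {0<..}}) ` B)" using l(3) BM by auto
  qed
  from cover obtain F where F: "finite F" "F \<subseteq> (\<lambda>p. {x \<in> topspace ?X. l p x \<in> {0<..}}) ` B" "B \<subseteq> \<Union>F"
    by (elim exE conjE)
  from finite_subset_image[OF F(1,2)] obtain T where T: "finite T" "T \<subseteq> B"
    and FT: "F = (\<lambda>p. {x \<in> topspace ?X. l p x \<in> {0<..}}) ` T"
    by (elim exE conjE)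
  have T3: "B \<subseteq> (\<Union>p\<in>T. {x \<in> topspace ?X. l p x \<in> {0<..}})" using F(3) unfolding FT .
  define \<Lambda> where "\<Lambda> x = (\<Sum>p\<in>T. l p x)" for x
  have \<Lambda>pos: "0 < \<Lambda> x" if x: "x \<in> B" for x
  proof -
    obtain p where "p \<in> T" "0 < l p x" using T3 x by auto
    then show ?thesis unfolding \<Lambda>_def using T(1,2) l(2) x by (intro sum_pos2[of _ p]) auto
  qed
  have \<Lambda>c: "continuous_map ?X euclideanreal \<Lambda>"
    unfolding \<Lambda>_def by (rule continuous_map_sum[OF T(1)]) (use l(1) T(2) in blast)
  \<comment> \<open>On the exterior collar each local push subtracts its own length, and the
    intermediate coordinates stay nonpositive; so along the composition the lengths add up to
    \<open>\<Lambda>\<close>.\<close>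
  have "\<exists>Q Q'. homeomorphic_maps ?A ?A Q Q' \<and> (\<forall>x\<in>B. \<forall>s\<le>0. Q (x, s) = (x, s - (\<Sum>p\<in>T. l p x)))"
    using T(1,2)
  proof (induction T rule: finite_induct)
    case empty
    show ?case by (intro exI[of _ id]) (simp add: homeomorphic_maps_def)
  next
    case (insert p T)
    then obtain Q Q' where Q: "homeomorphic_maps ?A ?A Q Q'" "\<And>x s. x \<in> B \<Longrightarrow> s \<le> 0 \<Longrightarrow> Q (x, s) = (x, s - (\<Sum>p\<in>T. l p x))"
      by auto
    have p: "p \<in> B" using insert by auto
    have "(P p \<circ> Q) (x, s) = (x, s - (\<Sum>p\<in>insert p T. l p x))" if "x \<in> B" "s \<le> 0" for x s
    proof -
      have "0 \<le> (\<Sum>p\<in>T. l p x)" by (rule sum_nonneg) (use l(2) insert that in auto)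
      then show ?thesis using Q(2)[OF that] l(5)[OF p that(1), of "s - (\<Sum>p\<in>T. l p x)"] that insert by simp
    qed
    then show ?case using homeomorphic_maps_compose[of ?A ?A Q Q' ?A "P p" "P' p"] Q(1) l(4)[OF p] by blast
  qed
  then obtain Q Q' where Q: "homeomorphic_maps ?A ?A Q Q'" and Qx: "\<And>x s. x \<in> B \<Longrightarrow> s \<le> 0 \<Longrightarrow> Q (x, s) = (x, s - \<Lambda> x)"
    unfolding \<Lambda>_def by blast
  have QD: "continuous_map ?A ?A Q" "continuous_map ?A ?A Q'" "\<And>w. w \<in> topspace ?A \<Longrightarrow> Q' (Q w) = w"
    "\<And>w. w \<in> topspace ?A \<Longrightarrow> Q (Q' w) = w"
    using Q by (auto simp: homeomorphic_maps_def)
  note tA = topspace_attached[OF BM]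
  \<comment> \<open>\<open>Q\<close> moves \<open>B\<close> to depth \<open>\<Lambda> x\<close>, so
    \<open>Q'\<close> carries the exterior points between this depth and 0 into \<open>M\<close>.
    The parameter \<open>t = 0\<close> is the depth \<open>\<Lambda> x\<close>, which returns to
    \<open>B\<close>; \<open>t = 1\<close> is the point \<open>(x, 0)\<close>.\<close>
  define k where "k x t = Q' (x, - \<Lambda> x * (1 - t))" for x t
  have kA: "(x, - \<Lambda> x * (1 - t)) \<in> topspace ?A" if "x \<in> B" "t \<le> 1" for x t
    using that BM \<Lambda>pos[OF that(1)] by (auto simp: tA mult_nonneg_nonneg less_imp_le)
  have k0: "snd (k x t) = 0 \<and> k x t \<in> topspace ?A" if x: "x \<in> B" and t: "0 \<le> t" "t \<le> 1" for x t
  proof -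
    have kin: "k x t \<in> topspace ?A"
      using continuous_map_image_subset_topspace[OF QD(2)] kA[OF x t(2)] by (auto simp: k_def)
    obtain z s where zs: "k x t = (z, s)" by fastforce
    \<comment> \<open>A preimage with \<open>s < 0\<close> lies in the exterior collar, where
      \<open>Q\<close> is explicit; it would satisfy \<open>s = \<Lambda> x * t\<close>, which is
      nonnegative.\<close>
    have "s = 0"
    proof (rule ccontr)
      assume "s \<noteq> 0"
      then have z: "z \<in> B" "s < 0" using kin by (auto simp: zs tA)
      have "Q (z, s) = (x, - \<Lambda> x * (1 - t))" using QD(4)[OF kA[OF x t(2)]] by (simp add: k_def zs[symmetric, unfolded k_def])
      then have "z = x" "s - \<Lambda> x = - \<Lambda> x * (1 - t)" using Qx[of z s] z by auto
      then have "s = \<Lambda> x * t" by (simp add: algebra_simps)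
      then show False using z(2) t(1) \<Lambda>pos[OF x] by (simp add: mult_less_0_iff)
    qed
    then show ?thesis using kin zs by simp
  qed
  have kQ: "Q (fst (k x t), 0) = (x, - \<Lambda> x * (1 - t))" if "x \<in> B" "0 \<le> t" "t \<le> 1" for x t
  proof -
    have "(fst (k x t), 0) = k x t" using k0[OF that] by (simp add: prod_eq_iff)
    then show ?thesis using QD(4)[OF kA[OF that(1,3)]] by (simp add: k_def)
  qed
  have k_bottom: "k x 0 = (x, 0)" if "x \<in> B" for x
    using Qx[OF that, of 0] QD(3)[of "(x, 0)"] BM that by (auto simp: k_def tA)
  obtain e :: "'a \<Rightarrow> nat \<Rightarrow> real" where e: "continuous_map ?X euclidean e" "inj_on e B"
  proof (rule compact_metrizable_embedding[of ?X])
    show "compact_space ?X" using cB by (simp add: compact_space_subtopology)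
    show "metrizable_space ?X" by (rule metrizable_space_subtopology[OF met])
  qed (use tX in auto)
  define S where "S = e ` B"
  have cX: "compactin ?X B" using cB by (simp add: compactin_subtopology)
  have "compact S" using image_compactin[OF cX e(1)] by (simp add: S_def)
  have "closed_map ?X euclidean e"
    by (rule continuous_imp_closed_map_gen[OF _ _ e(1)])
       (use cB in \<open>auto simp: compact_space_subtopology Hausdorff_imp_kc_space\<close>)
  then have "homeomorphic_map ?X (top_of_set S) e"
    using injective_closed_imp_embedding_map[OF e(1)] e(2) unfolding tX embedding_map_def S_def by simp
  then obtain e' where e': "homeomorphic_maps ?X (top_of_set S) e e'" using homeomorphic_map_maps by blast
  have e'D: "continuous_map (top_of_set S) ?X e'" "\<And>x. x \<in> B \<Longrightarrow> e' (e x) = x" "\<And>y. y \<in> S \<Longrightarrow> e' y \<in> B"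
    "\<And>y. y \<in> S \<Longrightarrow> e (e' y) = y"
    using e' continuous_map_image_subset_topspace[of "top_of_set S" ?X e'] unfolding homeomorphic_maps_def tX by auto
  define c where "c p = fst (k (e' (fst p)) (snd p))" for p
  interpret cylinder S by unfold_locales (rule \<open>compact S\<close>)
  have C: "e' (fst p) \<in> B" "0 \<le> snd p" "snd p \<le> 1" if "p \<in> C" for p
    using e'D(3) C_fst[OF that] C_snd[OF that] by auto
  have cont: "continuous_map (top_of_set C) M c"
  proof -
    have "continuous_map (top_of_set C) (top_of_set S) fst"
      using continuous_on_fst[OF continuous_on_id, of "S \<times> {0..1}"] by (auto simp: C_def)
    from continuous_map_compose[OF this e'D(1)]
    have 1: "continuous_map (top_of_set C) ?X (\<lambda>p. e' (fst p))" unfolding o_def .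
    have "continuous_map (top_of_set C) euclideanreal (\<lambda>p. \<Lambda> (e' (fst p)))"
      using continuous_map_compose[OF 1 \<Lambda>c] unfolding o_def .
    moreover have "continuous_map (top_of_set C) euclideanreal (\<lambda>p. 1 - snd p)" by (auto intro!: continuous_intros)
    ultimately have "continuous_map (top_of_set C) euclideanreal (\<lambda>p. - (\<Lambda> (e' (fst p)) * (1 - snd p)))"
      by (intro continuous_map_minus continuous_map_real_mult)
    moreover have "continuous_map (top_of_set C) M (\<lambda>p. e' (fst p))" by (rule continuous_map_into_fulltopology[OF 1])
    ultimately have "continuous_map (top_of_set C) (prod_topology M euclideanreal) (\<lambda>p. (e' (fst p), - \<Lambda> (e' (fst p)) * (1 - snd p)))"
      unfolding continuous_map_pairwise o_def fst_conv snd_conv by simp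
    moreover have "(e' (fst p), - \<Lambda> (e' (fst p)) * (1 - snd p)) \<in> topspace M \<times> {0} \<union> B \<times> {..0}" if "p \<in> C" for p
      using C[OF that] \<Lambda>pos[of "e' (fst p)"] by (auto intro!: mult_nonneg_nonneg)
    ultimately have "continuous_map (top_of_set C) ?A (\<lambda>p. (e' (fst p), - \<Lambda> (e' (fst p)) * (1 - snd p)))"
      unfolding attached_def by (auto simp: continuous_map_in_subtopology)
    from continuous_map_compose[OF continuous_map_compose[OF this QD(2)] continuous_map_attached(1)]
    show ?thesis unfolding c_def k_def o_def .
  qed
  have inj: "inj_on c C"
  proof (rule inj_onI)
    fix p q assume pq: "p \<in> C" "q \<in> C" "c p = c q"
    have "(e' (fst p), - \<Lambda> (e' (fst p)) * (1 - snd p)) = Q (c p, 0)"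
      unfolding c_def by (rule kQ[OF C[OF pq(1)], symmetric])
    also have "\<dots> = (e' (fst q), - \<Lambda> (e' (fst q)) * (1 - snd q))"
      unfolding pq(3) unfolding c_def by (rule kQ[OF C[OF pq(2)]])
    finally have "(e' (fst p), - \<Lambda> (e' (fst p)) * (1 - snd p)) = (e' (fst q), - \<Lambda> (e' (fst q)) * (1 - snd q))" .
    then have x: "e' (fst p) = e' (fst q)" and "\<Lambda> (e' (fst p)) * (1 - snd p) = \<Lambda> (e' (fst q)) * (1 - snd q)" by auto
    from this(2) have "snd p = snd q" using \<Lambda>pos[OF C(1)[OF pq(2)]] unfolding x by simp
    moreover have "fst p = fst q" using x e'D(4) C_fst pq by metis
    ultimately show "p = q" by (simp add: prod_eq_iff)
  qed
  have op: "openin M (c ` (S \<times> {0..<r}))" if r: "0 < r" "r \<le> 1" for r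
  proof -
    \<comment> \<open>The image is the preimage, under \<open>z \<mapsto> Q (z, 0)\<close>, of an
      open region of the exterior collar. Points of negative coordinate lie over \<open>B\<close>,
      so \<open>\<Lambda>\<close> can be evaluated at them.\<close>
    let ?O = "{w \<in> topspace ?A. snd w \<in> {..<0}}"
    have O: "openin ?A ?O" by (rule openin_continuous_map_preimage[OF continuous_map_attached(2)]) simp
    have Of: "continuous_map (subtopology ?A ?O) ?X fst"
      using continuous_map_from_subtopology[OF continuous_map_attached(1)]
      by (auto simp: continuous_map_in_subtopology attached_def)
    have "continuous_map (subtopology ?A ?O) euclideanreal (\<lambda>w. snd w + \<Lambda> (fst w) * (1 - r))"
      using continuous_map_compose[OF Of \<Lambda>c] unfolding o_def
      by (intro continuous_map_add continuous_map_real_mult continuous_map_from_subtopology[OF continuous_map_attached(2)]) auto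
    from openin_continuous_map_preimage[OF this, of "{..<0}"]
    have "openin (subtopology ?A ?O) {w \<in> topspace (subtopology ?A ?O). snd w + \<Lambda> (fst w) * (1 - r) \<in> {..<0}}" by simp
    then have "openin ?A {w \<in> topspace (subtopology ?A ?O). snd w + \<Lambda> (fst w) * (1 - r) \<in> {..<0}}"
      using O openin_trans_full by blast
    moreover have "continuous_map M ?A (\<lambda>z. (z, 0))"
      unfolding attached_def by (auto simp: continuous_map_in_subtopology continuous_map_pairwise o_def)
    then have cQ: "continuous_map M ?A (\<lambda>z. Q (z, 0))" using continuous_map_compose[OF _ QD(1)] unfolding o_def by blast
    ultimately have "openin M {z \<in> topspace M. Q (z, 0) \<in> {w \<in> topspace (subtopology ?A ?O). snd w + \<Lambda> (fst w) * (1 - r) \<in> {..<0}}}"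
      by (intro openin_continuous_map_preimage)
    moreover have "{z \<in> topspace M. Q (z, 0) \<in> {w \<in> topspace (subtopology ?A ?O). snd w + \<Lambda> (fst w) * (1 - r) \<in> {..<0}}}
      = c ` (S \<times> {0..<r})"
    proof (intro equalityI subsetI)
      fix z assume "z \<in> c ` (S \<times> {0..<r})"
      then obtain y t where yt: "y \<in> S" "0 \<le> t" "t < r" "z = c (y, t)" by auto
      define x where "x = e' y"
      have x: "x \<in> B" using e'D(3)[OF yt(1)] by (simp add: x_def)
      have t1: "t \<le> 1" "t < 1" using yt r by auto
      have z: "z = fst (k x t)" using yt by (simp add: c_def x_def)
      have kk: "k x t = (z, 0)" using k0[OF x yt(2) t1(1)] z by (simp add: prod_eq_iff)
      have Qz: "Q (z, 0) = (x, - \<Lambda> x * (1 - t))" using kQ[OF x yt(2) t1(1)] z by simp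
      have "\<Lambda> x * (1 - r) < \<Lambda> x * (1 - t)" "0 < \<Lambda> x * (1 - t)" using \<Lambda>pos[OF x] yt(3) t1 by auto
      moreover have "z \<in> topspace M" using k0[OF x yt(2) t1(1)] unfolding kk by (simp add: tA)
      ultimately show "z \<in> {z \<in> topspace M. Q (z, 0) \<in> {w \<in> topspace (subtopology ?A ?O). snd w + \<Lambda> (fst w) * (1 - r) \<in> {..<0}}}"
        using kA[OF x t1(1)] by (simp add: Qz)
    next
      fix z assume "z \<in> {z \<in> topspace M. Q (z, 0) \<in> {w \<in> topspace (subtopology ?A ?O). snd w + \<Lambda> (fst w) * (1 - r) \<in> {..<0}}}"
      moreover obtain x u where xu: "Q (z, 0) = (x, u)" by fastforce
      ultimately have zx: "z \<in> topspace M" "(x, u) \<in> topspace ?A" "u < 0" "u + \<Lambda> x * (1 - r) < 0" by auto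
      have x: "x \<in> B" using zx(2,3) by (auto simp: tA)
      have zA: "(z, 0) \<in> topspace ?A" using zx(1) by (simp add: tA)
      \<comment> \<open>Anything deeper than \<open>\<Lambda> x\<close> is the image under
        \<open>Q\<close> of an exterior point, so by injectivity it is not the image of a point of
        \<open>M\<close>.\<close>
      have "- \<Lambda> x \<le> u"
      proof (rule ccontr)
        assume n: "\<not> - \<Lambda> x \<le> u"
        have "Q (x, u + \<Lambda> x) = (x, u)" using Qx[OF x, of "u + \<Lambda> x"] n by simp
        moreover have "(x, u + \<Lambda> x) \<in> topspace ?A" using x n BM by (auto simp: tA)
        ultimately have "Q' (x, u) = (x, u + \<Lambda> x)" using QD(3)[of "(x, u + \<Lambda> x)"] by simp
        moreover have "Q' (x, u) = (z, 0)" using QD(3)[OF zA] unfolding xu .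
        ultimately have "(x, u + \<Lambda> x) = (z, 0)" by (rule trans[OF sym])
        then show False using n by simp
      qed
      define t where "t = 1 + u / \<Lambda> x"
      have t: "0 \<le> t" "t \<le> 1" "t < r" "- \<Lambda> x * (1 - t) = u"
        using \<Lambda>pos[OF x] \<open>- \<Lambda> x \<le> u\<close> zx(3,4) by (auto simp: t_def field_simps)
      have "k x t = (z, 0)" using QD(3)[OF zA] unfolding k_def t(4) xu by simp
      then have "z = c (e x, t)" using e'D(2)[OF x] by (simp add: c_def)
      then show "z \<in> c ` (S \<times> {0..<r})" using x t by (auto simp: S_def)
    qed
    ultimately show ?thesis by simp
  qed
  have col: "collar S M c" by unfold_locales (rule Haus cont inj op; assumption?)+
  have "collar.bd S c = B"
    unfolding collar.bd_def[OF col]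
  proof (intro equalityI subsetI)
    fix z assume "z \<in> c ` (S \<times> {0})"
    then show "z \<in> B" using k_bottom e'D(3) by (auto simp: c_def)
  next
    fix z assume "z \<in> B"
    then have "z = c (e z, 0)" "e z \<in> S" using k_bottom e'D(2) by (auto simp: c_def S_def)
    then show "z \<in> c ` (S \<times> {0})" by auto
  qed
  then show ?thesis using col unfolding B_def by blast
qed

theorem theorem1p5:
  fixes M :: "'a topology" and n :: nat
  assumes "1 \<le> n"
    and "metrizable_space M"
    and "topological_manifold n M"
    and "compactin M (manifold_boundary n M)"
  shows "(bounded_group (Hc_group M) \<longrightarrow>
            bounded_group (H_group (subtopology M (manifold_boundary n M)))) \<and>
         (bounded_group (Hc_group (subtopology M (manifold_interior n M))) \<longrightarrow>
            bounded_group (Hc_boundary_group n M))"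
proof -
  obtain S :: "(nat \<Rightarrow> real) set" and c where col: "collar S M c" and bd: "collar.bd S c = manifold_boundary n M"
    using collar_exists[OF assms] by blast
  interpret collar S M c by (rule col)
  have "H_group D = Hc_group D"
    by (rule H_group_eq_Hc_group) (use compact_D topspace_D Hausdorff_D in \<open>auto simp: compact_space_def\<close>)
  moreover have "bounded_group (Hc_group D)" if "bounded_group (Hc_group M)"
    by (rule bounded_Hc_boundary[OF _ that]) (simp add: bd manifold_boundary_homeo)
  moreover have "topspace M - bd = manifold_interior n M"
    unfolding bd by (auto simp: manifold_boundary_def manifold_interior_def)
  moreover have "rel_group = Hc_boundary_group n M"
    by (simp add: rel_group_def isotopic_rel_def Hc_boundary_group_def bd)
  ultimately show ?thesis using bounded_rel_group bd by simp
qed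

end
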